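(* Let $X=\mathbb{P}^n$ (complex projective space). Then for any integer $m\ge1$, $\delta_m(-K_X)=1$.
   Context: For an ample line bundle $L$ on a projective manifold $X$ and $d_m:=\dim H^0(X,mL)$, an $m$-basis divisor of $L$ is $D=\frac{1}{md_m}\sum_{i=1}^{d_m}(s_i)$ for a basis $\{s_i\}$ of $H^0(X,mL)$, where $(s_i)$ is the zero divisor of $s_i$. For a prime divisor $F\subset Y\xrightarrow{\pi}X$ over $X$ ($\pi$ proper birational), $A_X(F):=1+\mathrm{ord}_F(K_Y-\pi^*K_X)$ and $\mathrm{ord}_F(D)$ is the vanishing order of $\pi^*D$ along $F$. $\mathrm{lct}(X,D):=\inf_FA_X(F)/\mathrm{ord}_F(D)$, and $\delta_m(L):=\inf\{\mathrm{lct}(X,D):D\text{ an }m\text{-basis divisor of }L\}$. *)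

theory Defs
  imports
    "HOL-Library.Poly_Mapping"
    "HOL-Library.Extended_Real"
    "HOL-Computational_Algebra.Fraction_Field"
    "Jordan_Normal_Form.Determinant"
begin

text \<open>
  Complex varieties (integral separated schemes of finite type over the complex numbers) are
  handled in the Zariski--Chevalley language of models: a variety is the set of the local rings
  of all its scheme-theoretic points, viewed as subrings of its function field. The latter lies
  in an ambient field \<^typ>\<open>'a\<close>, and \<open>\<iota> :: complex \<Rightarrow> 'a\<close> is the embedding of the constants.
  A point specialises to another one iff its local ring contains the other local ring.
\<close>

definition subalgebra :: "(complex \<Rightarrow> 'a::field) \<Rightarrow> 'a set \<Rightarrow> bool" where
  "subalgebra \<iota> A \<longleftrightarrow> range \<iota> \<subseteq> A \<and> (\<forall>x\<in>A. \<forall>y\<in>A. x + y \<in> A \<and> x * y \<in> A)"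

definition adjoin :: "(complex \<Rightarrow> 'a::field) \<Rightarrow> 'a set \<Rightarrow> 'a set" where
  "adjoin \<iota> S = \<Inter>{A. subalgebra \<iota> A \<and> S \<subseteq> A}"

definition fractions :: "'a::field set \<Rightarrow> 'a set" where
  "fractions A = {a / b | a b. a \<in> A \<and> b \<in> A \<and> b \<noteq> 0}"

definition prime_ideal :: "'a::field set \<Rightarrow> 'a set \<Rightarrow> bool" where
  "prime_ideal A P \<longleftrightarrow> P \<subseteq> A \<and> 0 \<in> P \<and> 1 \<notin> P \<and>
     (\<forall>x\<in>P. \<forall>y\<in>P. x + y \<in> P) \<and> (\<forall>a\<in>A. \<forall>x\<in>P. a * x \<in> P) \<and>
     (\<forall>a\<in>A. \<forall>b\<in>A. a * b \<in> P \<longrightarrow> a \<in> P \<or> b \<in> P)"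

definition localization :: "'a::field set \<Rightarrow> 'a set \<Rightarrow> 'a set" where
  "localization A P = {a / b | a b. a \<in> A \<and> b \<in> A \<and> b \<notin> P}"

text \<open>The affine variety \<open>Spec A\<close>.\<close>

definition spec :: "'a::field set \<Rightarrow> 'a set set" where
  "spec A = {localization A P | P. prime_ideal A P}"

definition nonunits :: "'a::field set \<Rightarrow> 'a set" where
  "nonunits R = {x \<in> R. x = 0 \<or> inverse x \<notin> R}"

text \<open>For local rings: \<open>S \<subseteq> R\<close> and the inclusion is a local homomorphism.\<close>

definition dominates :: "'a::field set \<Rightarrow> 'a set \<Rightarrow> bool" where
  "dominates R S \<longleftrightarrow> S \<subseteq> R \<and> nonunits S \<subseteq> nonunits R"

definition function_field :: "'a::field set set \<Rightarrow> 'a set" where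
  "function_field X = (\<Union>R\<in>X. fractions R)"

definition valuation_ring :: "(complex \<Rightarrow> 'a::field) \<Rightarrow> 'a set \<Rightarrow> 'a set \<Rightarrow> bool" where
  "valuation_ring \<iota> K V \<longleftrightarrow> subalgebra \<iota> V \<and> V \<subseteq> K \<and> (\<forall>x\<in>K. x \<in> V \<or> inverse x \<in> V)"

text \<open>
  A variety is a finite union of affine ones with the same function field; the last clause is the
  valuative criterion of separatedness (Zariski's irredundance).
\<close>

definition variety :: "(complex \<Rightarrow> 'a::field) \<Rightarrow> 'a set set \<Rightarrow> bool" where
  "variety \<iota> X \<longleftrightarrow>
     (\<exists>\<A>. finite \<A> \<and> \<A> \<noteq> {} \<and> X = (\<Union>A\<in>\<A>. spec A) \<and>
        (\<forall>A\<in>\<A>. (\<exists>S. finite S \<and> A = adjoin \<iota> S) \<and> fractions A = function_field X)) \<and>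
     (\<forall>V R S. valuation_ring \<iota> (function_field X) V \<and> R \<in> X \<and> S \<in> X \<and>
        dominates V R \<and> dominates V S \<longrightarrow> R = S)"

text \<open>
  A birational morphism \<open>\<pi> : Y \<rightarrow> X\<close>, where the function fields are identified along \<open>\<pi>\<^sup>*\<close>:
  every local ring of \<open>Y\<close> dominates the one of the image point. Properness is expressed by the
  valuative criterion.
\<close>

definition proper_birational_morphism ::
    "(complex \<Rightarrow> 'a::field) \<Rightarrow> 'a set set \<Rightarrow> 'a set set \<Rightarrow> bool" where
  "proper_birational_morphism \<iota> Y X \<longleftrightarrow>
     function_field Y = function_field X \<and>
     (\<forall>R\<in>Y. \<exists>S\<in>X. dominates R S) \<and>
     (\<forall>V. valuation_ring \<iota> (function_field X) V \<and> (\<exists>S\<in>X. dominates V S) \<longrightarrow>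
        (\<exists>R\<in>Y. dominates V R))"

definition uniformizer :: "'a::field set \<Rightarrow> 'a \<Rightarrow> bool" where
  "uniformizer R t \<longleftrightarrow> t \<noteq> 0 \<and> t \<in> nonunits R \<and>
     (\<forall>f\<in>R - {0}. \<exists>e::nat. \<exists>u\<in>R - nonunits R. f = u * t ^ e)"

text \<open>
  A prime divisor is represented by its generic point. On a normal variety the points of
  codimension one are exactly those whose local ring is a discrete valuation ring. On a
  non-normal one, requiring a discrete valuation ring keeps the prime divisors along which there
  is a vanishing order; their valuations are the same as on the normalization.
\<close>

definition prime_divisors :: "'a::field set set \<Rightarrow> 'a set set" where
  "prime_divisors X = {R \<in> X. \<exists>t. uniformizer R t}"

definition ord :: "'a::field set \<Rightarrow> 'a \<Rightarrow> int" where
  "ord R f = (THE e. \<exists>t u. uniformizer R t \<and> u \<in> R - nonunits R \<and> f = u * t powi e)"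

definition divisors_over :: "(complex \<Rightarrow> 'a::field) \<Rightarrow> 'a set set \<Rightarrow> 'a set set" where
  "divisors_over \<iota> X =
     {F. \<exists>Y. variety \<iota> Y \<and> proper_birational_morphism \<iota> Y X \<and> F \<in> prime_divisors Y}"

text \<open>
  Divisors on \<open>X\<close> are functions of its prime divisors. For a \<open>\<rat>\<close>-Cartier divisor \<open>D\<close> on \<open>X\<close> and
  \<open>F \<subset> Y\<close> over \<open>X\<close>, \<open>ord_pullback X D F\<close> is the coefficient of \<open>\<pi>\<^sup>*D\<close> along \<open>F\<close>: if \<open>g\<close> is an
  equation of \<open>N D\<close> at the centre of \<open>F\<close> on \<open>X\<close>, it equals \<open>ord\<^sub>F g / N\<close>.
\<close>

definition center :: "'a::field set set \<Rightarrow> 'a set \<Rightarrow> 'a set" where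
  "center X F = (THE S. S \<in> X \<and> dominates F S)"

definition local_equation ::
    "'a::field set set \<Rightarrow> ('a set \<Rightarrow> real) \<Rightarrow> 'a set \<Rightarrow> 'a \<Rightarrow> bool" where
  "local_equation X D S g \<longleftrightarrow> g \<in> function_field X \<and> g \<noteq> 0 \<and>
     (\<forall>E\<in>prime_divisors X. S \<subseteq> E \<longrightarrow> D E = of_int (ord E g))"

definition ord_pullback :: "'a::field set set \<Rightarrow> ('a set \<Rightarrow> real) \<Rightarrow> 'a set \<Rightarrow> real" where
  "ord_pullback X D F = (THE r. \<exists>N g. N > (0::nat) \<and>
     local_equation X (\<lambda>E. of_nat N * D E) (center X F) g \<and> r = of_int (ord F g) / of_nat N)"

text \<open>
  Rational differential forms of top degree \<open>n\<close> (the dimension of \<open>X\<close>) are viewed as alternating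
  \<open>n\<close>-linear functions of derivations of the function field \<open>K\<close> over the constants. Only their
  values on tuples of such derivations matter. \<open>wedge n x\<close> is \<open>dx\<^sub>0 \<and> \<dots> \<and> dx\<^sub>n\<^sub>-\<^sub>1\<close>; since forms of
  top degree make up a line over \<open>K\<close>, each of them is \<open>f \<cdot> wedge n x\<close> for some \<open>f\<close> and \<open>x\<close> in \<open>K\<close>.
\<close>

definition derivation :: "(complex \<Rightarrow> 'a::field) \<Rightarrow> 'a set \<Rightarrow> ('a \<Rightarrow> 'a) \<Rightarrow> bool" where
  "derivation \<iota> K D \<longleftrightarrow> (\<forall>x\<in>K. D x \<in> K) \<and> (\<forall>c. D (\<iota> c) = 0) \<and>
     (\<forall>x\<in>K. \<forall>y\<in>K. D (x + y) = D x + D y \<and> D (x * y) = D x * y + x * D y)"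

definition frames ::
    "(complex \<Rightarrow> 'a::field) \<Rightarrow> 'a set \<Rightarrow> nat \<Rightarrow> (nat \<Rightarrow> 'a \<Rightarrow> 'a) set" where
  "frames \<iota> K n = {\<theta>. \<forall>j<n. derivation \<iota> K (\<theta> j)}"

definition wedge :: "nat \<Rightarrow> (nat \<Rightarrow> 'a) \<Rightarrow> (nat \<Rightarrow> 'a \<Rightarrow> 'a) \<Rightarrow> 'a::field" where
  "wedge n x \<theta> = det (mat n n (\<lambda>(i, j). \<theta> j (x i)))"

definition nonzero_top_form ::
    "(complex \<Rightarrow> 'a::field) \<Rightarrow> nat \<Rightarrow> 'a set \<Rightarrow> ((nat \<Rightarrow> 'a \<Rightarrow> 'a) \<Rightarrow> 'a) \<Rightarrow> bool" where
  "nonzero_top_form \<iota> n K \<omega> \<longleftrightarrow>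
     (\<exists>f\<in>K. \<exists>x. (\<forall>i<n. x i \<in> K) \<and> (\<forall>\<theta>\<in>frames \<iota> K n. \<omega> \<theta> = f * wedge n x \<theta>)) \<and>
     (\<exists>\<theta>\<in>frames \<iota> K n. \<omega> \<theta> \<noteq> 0)"

text \<open>
  The \<open>R\<close>-module spanned by all \<open>dr\<^sub>0 \<and> \<dots> \<and> dr\<^sub>n\<^sub>-\<^sub>1\<close> with \<open>r\<^sub>i \<in> R\<close>, that is, the stalk of the
  canonical sheaf at the generic point of a prime divisor \<open>R\<close>, is free of rank one; being a local
  ring, \<open>R\<close> has a generator of it among those products. The order of \<open>\<omega>\<close> along \<open>R\<close> is the order
  of its coefficient with respect to such a generator.
\<close>

definition canonical_generator ::
    "(complex \<Rightarrow> 'a::field) \<Rightarrow> nat \<Rightarrow> 'a set \<Rightarrow> (nat \<Rightarrow> 'a) \<Rightarrow> bool" where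
  "canonical_generator \<iota> n R r \<longleftrightarrow> (\<forall>i<n. r i \<in> R) \<and>
     (\<exists>\<theta>\<in>frames \<iota> (fractions R) n. wedge n r \<theta> \<noteq> 0) \<and>
     (\<forall>s. (\<forall>i<n. s i \<in> R) \<longrightarrow>
        (\<exists>a\<in>R. \<forall>\<theta>\<in>frames \<iota> (fractions R) n. wedge n s \<theta> = a * wedge n r \<theta>))"

definition ord_form ::
    "(complex \<Rightarrow> 'a::field) \<Rightarrow> nat \<Rightarrow> 'a set \<Rightarrow> ((nat \<Rightarrow> 'a \<Rightarrow> 'a) \<Rightarrow> 'a) \<Rightarrow> int" where
  "ord_form \<iota> n R \<omega> = (THE e. \<exists>r. \<exists>f\<in>fractions R. canonical_generator \<iota> n R r \<and>
     (\<forall>\<theta>\<in>frames \<iota> (fractions R) n. \<omega> \<theta> = f * wedge n r \<theta>) \<and> e = ord R f)"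

definition div_form ::
    "(complex \<Rightarrow> 'a::field) \<Rightarrow> nat \<Rightarrow> 'a set set \<Rightarrow> ((nat \<Rightarrow> 'a \<Rightarrow> 'a) \<Rightarrow> 'a) \<Rightarrow> 'a set \<Rightarrow> int" where
  "div_form \<iota> n X \<omega> E = (if E \<in> prime_divisors X then ord_form \<iota> n E \<omega> else 0)"

definition canonical_divisor ::
    "(complex \<Rightarrow> 'a::field) \<Rightarrow> nat \<Rightarrow> 'a set set \<Rightarrow> ('a set \<Rightarrow> int) \<Rightarrow> bool" where
  "canonical_divisor \<iota> n X D \<longleftrightarrow>
     (\<exists>\<omega>. nonzero_top_form \<iota> n (function_field X) \<omega> \<and> D = div_form \<iota> n X \<omega>)"

text \<open>
  \<open>A\<^sub>X(F) = 1 + ord\<^sub>F(K\<^sub>Y - \<pi>\<^sup>*K\<^sub>X)\<close>, where \<open>K\<^sub>X\<close> and \<open>K\<^sub>Y\<close> are the divisors on \<open>X\<close> and \<open>Y\<close> of one and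
  the same rational form \<open>\<omega>\<close>; the value does not depend on \<open>\<omega>\<close>.
\<close>

definition log_discrepancy ::
    "(complex \<Rightarrow> 'a::field) \<Rightarrow> nat \<Rightarrow> 'a set set \<Rightarrow> 'a set \<Rightarrow> real" where
  "log_discrepancy \<iota> n X F = (THE a. \<exists>\<omega>. nonzero_top_form \<iota> n (function_field X) \<omega> \<and>
     a = 1 + (of_int (ord_form \<iota> n F \<omega>) - ord_pullback X (\<lambda>E. of_int (div_form \<iota> n X \<omega> E)) F))"

text \<open>In \<^typ>\<open>ereal\<close> a positive number divided by \<open>0\<close> is \<open>\<infinity>\<close>, as needed when \<open>ord\<^sub>F(D) = 0\<close>.\<close>

definition lct ::
    "(complex \<Rightarrow> 'a::field) \<Rightarrow> nat \<Rightarrow> 'a set set \<Rightarrow> ('a set \<Rightarrow> real) \<Rightarrow> ereal" where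
  "lct \<iota> n X D =
     (INF F\<in>divisors_over \<iota> X. ereal (log_discrepancy \<iota> n X F) / ereal (ord_pullback X D F))"

text \<open>
  The line bundle of a divisor \<open>L\<close> has the rational functions \<open>f\<close> with \<open>div f + L \<ge> 0\<close> as its
  global sections, and the zero divisor of the section \<open>f \<noteq> 0\<close> is \<open>div f + L\<close>.
\<close>

definition global_sections :: "'a::field set set \<Rightarrow> ('a set \<Rightarrow> int) \<Rightarrow> 'a set" where
  "global_sections X L =
     {f \<in> function_field X. f = 0 \<or> (\<forall>E\<in>prime_divisors X. ord E f + L E \<ge> 0)}"

definition zero_divisor :: "('a::field set \<Rightarrow> int) \<Rightarrow> 'a \<Rightarrow> 'a set \<Rightarrow> int" where
  "zero_divisor L f E = ord E f + L E"

definition basis_over :: "(complex \<Rightarrow> 'a::field) \<Rightarrow> 'a set \<Rightarrow> 'a set \<Rightarrow> bool" where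
  "basis_over \<iota> V B \<longleftrightarrow>
     \<not> Modules.module.dependent (\<lambda>c x. \<iota> c * x) B \<and> Modules.module.span (\<lambda>c x. \<iota> c * x) B = V"

definition basis_divisors ::
    "(complex \<Rightarrow> 'a::field) \<Rightarrow> 'a set set \<Rightarrow> ('a set \<Rightarrow> int) \<Rightarrow> nat \<Rightarrow> ('a set \<Rightarrow> real) set" where
  "basis_divisors \<iota> X L m =
     (let mL = (\<lambda>E. int m * L E);
          H = global_sections X mL;
          d = Vector_Spaces.vector_space.dim (\<lambda>c x. \<iota> c * x) H
      in {\<lambda>E. (\<Sum>s\<in>B. of_int (zero_divisor mL s E)) / (of_nat m * of_nat d) | B. basis_over \<iota> H B})"

definition delta ::
    "(complex \<Rightarrow> 'a::field) \<Rightarrow> nat \<Rightarrow> 'a set set \<Rightarrow> ('a set \<Rightarrow> int) \<Rightarrow> nat \<Rightarrow> ereal" where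
  "delta \<iota> n X L m = (INF D\<in>basis_divisors \<iota> X L m. lct \<iota> n X D)"

text \<open>
  Projective space, glued from the charts \<open>Spec \<complex>[x\<^sub>0/x\<^sub>i, \<dots>, x\<^sub>n/x\<^sub>i]\<close>, \<open>i \<le> n\<close>. The ambient field is
  that of rational functions in \<open>x\<^sub>0, x\<^sub>1, x\<^sub>2, \<dots>\<close>; the function field is its subfield generated by
  the \<open>x\<^sub>j/x\<^sub>i\<close> with \<open>i, j \<le> n\<close>.
\<close>

type_synonym ratfun = "((nat \<Rightarrow>\<^sub>0 nat) \<Rightarrow>\<^sub>0 complex) fract"

definition const :: "complex \<Rightarrow> ratfun" where
  "const c = Fract (Poly_Mapping.single 0 c) 1"

definition coord :: "nat \<Rightarrow> ratfun" where
  "coord i = Fract (Poly_Mapping.single (Poly_Mapping.single i 1) 1) 1"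

definition proj_space :: "nat \<Rightarrow> ratfun set set" where
  "proj_space n = (\<Union>i\<le>n. spec (adjoin const {coord j / coord i | j. j \<le> n}))"

end

theory Submission
  imports Defs
begin

text \<open>
  On a chart the sections of \<open>-m K\<close> become the polynomials of degree at most \<open>m (n + 1)\<close>; that there are
  no others follows from the factoriality of the coordinate rings of the charts.

  Upper bound: on the monomial basis every coordinate hyperplane has coefficient \<open>1\<close> in the
  basis divisor, and its log discrepancy is \<open>1\<close>.

  Lower bound: let \<open>F\<close> be a divisor over \<open>P\<^sup>n\<close> with valuation \<open>v\<close>, centred on the chart with coordinates
  \<open>y\<^sub>1, \<dots>, y\<^sub>n\<close>; put \<open>N = m (n + 1)\<close> and let \<open>s\<^sub>1, \<dots>, s\<^sub>d\<close> be a basis of the polynomials of degree at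
  most \<open>N\<close>. The generalised Wronskian \<open>det (\<partial>\<^sup>\<beta> s\<^sub>k)\<close> over \<open>|\<beta>| \<le> N\<close> is a nonzero constant, as one sees
  on monomials. The derivations that do not lower \<open>v\<close> form a lattice whose index in the lattice of the
  \<open>\<partial>\<^sub>i\<close> is governed by the log discrepancy \<open>A(F)\<close>. Bringing a basis of it into Hermite normal form
  yields derivations \<open>D\<^sub>j \<in> \<partial>\<^sub>j + \<Sum>\<^bsub>i<j\<^esub> K \<partial>\<^sub>i\<close> lowering \<open>v\<close> by at most \<open>a\<^sub>j\<close>, where \<open>\<Sum>\<^sub>j a\<^sub>j \<le> A(F)\<close>. Replacing
  \<open>\<partial>\<^sup>\<beta>\<close> by \<open>D\<^sup>\<beta>\<close> is a unitriangular change and leaves the Wronskian unchanged, hence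
  \<open>\<Sum>\<^sub>k v(s\<^sub>k) \<le> \<Sum>\<^sub>\<beta> \<Sum>\<^sub>j \<beta>\<^sub>j a\<^sub>j = m d \<Sum>\<^sub>j a\<^sub>j \<le> m d A(F)\<close>.
\<close>

section \<open>Subalgebras, localizations and discrete valuation rings\<close>

text \<open>The lower bound must hold for arbitrary valuations, which need not be monomial in any
  coordinates. The Wronskian depends, up to a constant factor, only on the span of the sections, so
  no basis adapted to \<open>F\<close> has to be found. Why the constant is exactly 1: derivations
  that merely preserve the valuation ring may lower v by one at every application. Making a frame of
  them logarithmic multiplies its determinant by at most one uniformizer. The frame dual to a
  canonical generator has a determinant inverse to the Jacobian J of the generator, so the index
  becomes 1 - v(J), and this is A(F): the orders of a form in the chart and of its divisor on the
  base cancel. Why triangular: the derivations D_j need not commute, and a composite of them is a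
  combination of many partial derivatives. If D_j involves only partials of index at most j, with
  coefficient 1 at index j, all extra terms are smaller for a suitable weight. Why only the sum of
  the a_j matters: with a slack variable the n + 1 exponents become symmetric, so each coordinate
  occurs N d / (n + 1) = m d times in total.\<close>

locale constants =
  fixes \<iota> :: "complex \<Rightarrow> 'a::field"
  assumes const_add: "\<iota> (a + b) = \<iota> a + \<iota> b"
    and const_mult: "\<iota> (a * b) = \<iota> a * \<iota> b"
    and const_1 [simp]: "\<iota> 1 = 1"
begin

lemma const_0 [simp]: "\<iota> 0 = 0"
  using const_add[of 0 0] by (metis add.right_neutral add_left_cancel)

lemma const_minus: "\<iota> (- a) = - \<iota> a"
  using const_add[of a "- a"] by (simp add: eq_neg_iff_add_eq_0 add.commute)

lemma const_of_nat: "\<iota> (of_nat k) = of_nat k"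
  by (induction k) (auto simp: const_add)

lemma const_inverse: "\<iota> (inverse a) = inverse (\<iota> a)"
proof (cases "a = 0")
  case False
  then have "\<iota> a * \<iota> (inverse a) = 1"
    by (simp flip: const_mult)
  then show ?thesis
    by (metis inverse_unique)
qed simp

lemma const_eq_0_iff [simp]: "\<iota> a = 0 \<longleftrightarrow> a = 0"
proof
  assume "\<iota> a = 0"
  then show "a = 0"
    using const_mult[of a "inverse a"] by (cases "a = 0") auto
qed simp

text \<open>Characteristic zero passes from the complex numbers to the ambient field. The arguments
  by differentiation, such as transcendence of coordinates and independence of monomials, rest on
  it.\<close>

lemma of_nat_field_eq_0_iff: "of_nat k = (0::'a) \<longleftrightarrow> k = 0"
  using const_eq_0_iff[of "of_nat k"] by (simp add: const_of_nat)

definition subfield :: "'a set \<Rightarrow> bool" where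
  "subfield K \<longleftrightarrow> subalgebra \<iota> K \<and> (\<forall>x\<in>K. inverse x \<in> K)"

context
  fixes A assumes A: "subalgebra \<iota> A"
begin

lemma subalg_const: "\<iota> c \<in> A"
  and subalg_add: "x \<in> A \<Longrightarrow> y \<in> A \<Longrightarrow> x + y \<in> A"
  and subalg_mult: "x \<in> A \<Longrightarrow> y \<in> A \<Longrightarrow> x * y \<in> A"
  using A by (auto simp: subalgebra_def)

lemma subalg_0: "0 \<in> A" and subalg_1: "1 \<in> A"
  using subalg_const[of 0] subalg_const[of 1] by auto

lemma subalg_minus: "x \<in> A \<Longrightarrow> - x \<in> A"
  using subalg_mult[OF subalg_const[of "-1"], of x] by (simp add: const_minus)

lemma subalg_diff: "x \<in> A \<Longrightarrow> y \<in> A \<Longrightarrow> x - y \<in> A"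
  using subalg_add[of x "- y"] subalg_minus by simp

lemma subalg_of_nat: "of_nat k \<in> A"
  using subalg_const[of "of_nat k"] by (simp add: const_of_nat)

lemma subalg_sum: "(\<And>i. i \<in> I \<Longrightarrow> f i \<in> A) \<Longrightarrow> sum f I \<in> A"
  by (induction I rule: infinite_finite_induct) (auto intro: subalg_add subalg_0)

lemma subalg_prod: "(\<And>i. i \<in> I \<Longrightarrow> f i \<in> A) \<Longrightarrow> prod f I \<in> A"
  by (induction I rule: infinite_finite_induct) (auto intro: subalg_mult subalg_1)

lemma subalg_power: "x \<in> A \<Longrightarrow> x ^ k \<in> A"
  by (induction k) (auto intro: subalg_mult subalg_1)

lemma subalg_signof: "signof p \<in> A"
  by (auto simp: sign_def intro: subalg_1 subalg_minus)

lemma subalg_det: "(\<And>i j. i < n \<Longrightarrow> j < n \<Longrightarrow> f (i, j) \<in> A) \<Longrightarrow> det (mat n n f) \<in> A"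
  by (subst det_def'[of _ n])
     (auto intro!: subalg_sum subalg_mult subalg_prod subalg_signof simp: permutes_in_image)

lemma fractionsI: "a \<in> A \<Longrightarrow> b \<in> A \<Longrightarrow> b \<noteq> 0 \<Longrightarrow> a / b \<in> fractions A"
  by (auto simp: fractions_def)

lemma subset_fractions: "A \<subseteq> fractions A"
  using fractionsI[of _ 1] subalg_1 by fastforce

lemma subfield_fractions: "subfield (fractions A)"
proof -
  have "x + y \<in> fractions A \<and> x * y \<in> fractions A" if xy: "x \<in> fractions A" "y \<in> fractions A" for x y
  proof -
    obtain a b c d where *: "a \<in> A" "b \<in> A" "b \<noteq> 0" "x = a / b" "c \<in> A" "d \<in> A" "d \<noteq> 0" "y = c / d"
      using xy by (auto simp: fractions_def)
    have "x + y = (a * d + c * b) / (b * d)" "x * y = (a * c) / (b * d)"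
      using * by (auto simp: field_simps)
    moreover have "(a * d + c * b) / (b * d) \<in> fractions A" "(a * c) / (b * d) \<in> fractions A"
      using * by (auto intro!: fractionsI subalg_add subalg_mult)
    ultimately show ?thesis
      by metis
  qed
  moreover have "inverse x \<in> fractions A" if x: "x \<in> fractions A" for x
  proof -
    obtain a b where *: "a \<in> A" "b \<in> A" "b \<noteq> 0" "x = a / b"
      using x by (auto simp: fractions_def)
    then show ?thesis
      using fractionsI[of b a] subset_fractions subalg_0 by (cases "a = 0") auto
  qed
  ultimately show ?thesis
    using subset_fractions subalg_const by (auto simp: subfield_def subalgebra_def)
qed

end

lemma subfieldD: "subfield K \<Longrightarrow> subalgebra \<iota> K"
  by (simp add: subfield_def)

lemma subfield_inverse: "subfield K \<Longrightarrow> x \<in> K \<Longrightarrow> inverse x \<in> K"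
  by (simp add: subfield_def)

lemma subfield_divide: "subfield K \<Longrightarrow> x \<in> K \<Longrightarrow> y \<in> K \<Longrightarrow> x / y \<in> K"
  by (auto simp: divide_inverse subfield_def intro: subalg_mult)

lemma subfield_powi: "subfield K \<Longrightarrow> x \<in> K \<Longrightarrow> x powi k \<in> K"
  by (auto simp: power_int_def subfield_def intro: subalg_power)

lemma fractions_least: "subfield K \<Longrightarrow> A \<subseteq> K \<Longrightarrow> fractions A \<subseteq> K"
  by (auto simp: fractions_def intro!: subfield_divide)

lemma fractions_mono: "A \<subseteq> B \<Longrightarrow> fractions A \<subseteq> fractions B"
  by (auto simp: fractions_def)

lemma subalgebra_adjoin: "subalgebra \<iota> (adjoin \<iota> S)"
  unfolding adjoin_def subalgebra_def by blast

lemma adjoin_superset: "S \<subseteq> adjoin \<iota> S"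
  unfolding adjoin_def by blast

lemma adjoin_least: "subalgebra \<iota> A \<Longrightarrow> S \<subseteq> A \<Longrightarrow> adjoin \<iota> S \<subseteq> A"
  unfolding adjoin_def by blast

lemma adjoin_mono: "S \<subseteq> T \<Longrightarrow> adjoin \<iota> S \<subseteq> adjoin \<iota> T"
  unfolding adjoin_def by blast

section \<open>Localizations at prime ideals and domination\<close>

context
  fixes A P assumes A: "subalgebra \<iota> A" and P: "prime_ideal A P"
begin

lemma prime_idealD: "P \<subseteq> A" "0 \<in> P" "1 \<notin> P"
  "x \<in> P \<Longrightarrow> y \<in> P \<Longrightarrow> x + y \<in> P" "a \<in> A \<Longrightarrow> x \<in> P \<Longrightarrow> a * x \<in> P" "a \<in> A \<Longrightarrow> x \<in> P \<Longrightarrow> x * a \<in> P"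
  "a \<in> A \<Longrightarrow> b \<in> A \<Longrightarrow> a \<notin> P \<Longrightarrow> b \<notin> P \<Longrightarrow> a * b \<notin> P"
  using P by (auto simp: prime_ideal_def mult.commute)

lemma localizationI: "a \<in> A \<Longrightarrow> b \<in> A \<Longrightarrow> b \<notin> P \<Longrightarrow> a / b \<in> localization A P"
  by (auto simp: localization_def)

lemma localizationE:
  assumes "x \<in> localization A P"
  obtains a b where "a \<in> A" "b \<in> A" "b \<notin> P" "b \<noteq> 0" "x = a / b"
  using assms prime_idealD by (auto simp: localization_def)

lemma subset_localization: "A \<subseteq> localization A P"
  using localizationI[of _ 1] prime_idealD subalg_1[OF A] by force

lemma subalgebra_localization: "subalgebra \<iota> (localization A P)"
proof -
  have "x + y \<in> localization A P \<and> x * y \<in> localization A P"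
    if xy: "x \<in> localization A P" "y \<in> localization A P" for x y
  proof -
    obtain a b c d where *: "a \<in> A" "b \<in> A" "b \<notin> P" "b \<noteq> 0" "x = a / b" "c \<in> A" "d \<in> A" "d \<notin> P" "d \<noteq> 0" "y = c / d"
      using xy by (auto elim!: localizationE)
    have "x + y = (a * d + c * b) / (b * d)" "x * y = (a * c) / (b * d)"
      using * by (auto simp: field_simps)
    moreover have "(a * d + c * b) / (b * d) \<in> localization A P" "(a * c) / (b * d) \<in> localization A P"
      using * by (auto intro!: localizationI subalg_add[OF A] subalg_mult[OF A] simp: prime_idealD)
    ultimately show ?thesis
      by metis
  qed
  then show ?thesis
    using subset_localization subalg_const[OF A] by (auto simp: subalgebra_def)
qed

lemma localization_subset_fractions: "localization A P \<subseteq> fractions A"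
  using prime_idealD by (auto simp: localization_def fractions_def)

lemma fractions_localization: "fractions (localization A P) = fractions A"
  using fractions_least[OF subfield_fractions[OF A] localization_subset_fractions]
    fractions_mono[OF subset_localization] by auto

lemma nonunit_localization_iff:
  assumes "a \<in> A" "b \<in> A" "b \<notin> P"
  shows "a / b \<in> nonunits (localization A P) \<longleftrightarrow> a \<in> P"
proof
  assume "a \<in> P"
  have "inverse (a / b) \<notin> localization A P" if "a \<noteq> 0"
  proof
    assume "inverse (a / b) \<in> localization A P"
    then obtain c d where "c \<in> A" "d \<in> A" "d \<notin> P" "d \<noteq> 0" "inverse (a / b) = c / d"
      by (elim localizationE)
    then have "b * d = c * a"
      using that by (simp add: field_simps)
    then show False
      using prime_idealD(5)[OF \<open>c \<in> A\<close> \<open>a \<in> P\<close>] prime_idealD(7)[OF \<open>b \<in> A\<close> \<open>d \<in> A\<close>] assms \<open>d \<notin> P\<close> by metis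
  qed
  then show "a / b \<in> nonunits (localization A P)"
    using assms localizationI by (auto simp: nonunits_def)
next
  assume "a / b \<in> nonunits (localization A P)"
  then show "a \<in> P"
    using localizationI[of b a] assms prime_idealD by (auto simp: nonunits_def)
qed

lemma nonunit_localization_iff': "a \<in> A \<Longrightarrow> a \<in> nonunits (localization A P) \<longleftrightarrow> a \<in> P"
  using nonunit_localization_iff[of a 1] subalg_1[OF A] prime_idealD by simp

lemma nonunits_localization_add:
  assumes "x \<in> nonunits (localization A P)" "y \<in> nonunits (localization A P)"
  shows "x + y \<in> nonunits (localization A P)"
proof -
  obtain a b c d where *: "a \<in> A" "b \<in> A" "b \<notin> P" "b \<noteq> 0" "x = a / b" "c \<in> A" "d \<in> A" "d \<notin> P" "d \<noteq> 0" "y = c / d"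
    using assms by (auto elim!: localizationE simp: nonunits_def)
  then have "a \<in> P" "c \<in> P"
    using assms nonunit_localization_iff by auto
  moreover have "x + y = (a * d + c * b) / (b * d)"
    using * by (auto simp: field_simps)
  ultimately show ?thesis
    using * nonunit_localization_iff[of "a * d + c * b" "b * d"]
    by (auto intro!: prime_idealD(4) simp: prime_idealD subalg_mult[OF A] subalg_add[OF A])
qed

lemma nonunits_localization_mult:
  assumes "x \<in> localization A P" "y \<in> nonunits (localization A P)"
  shows "x * y \<in> nonunits (localization A P)"
proof -
  obtain a b c d where *: "a \<in> A" "b \<in> A" "b \<notin> P" "b \<noteq> 0" "x = a / b" "c \<in> A" "d \<in> A" "d \<notin> P" "d \<noteq> 0" "y = c / d"
    using assms by (auto elim!: localizationE simp: nonunits_def)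
  then have "c \<in> P"
    using assms nonunit_localization_iff by auto
  then show ?thesis
    using * nonunit_localization_iff[of "a * c" "b * d"] by (auto simp: prime_idealD subalg_mult[OF A])
qed

text \<open>An element of \<open>A\<close> outside \<open>P\<close> is invertible in the
  localization, hence in \<open>V\<close>. So \<open>P\<close> is the contraction of the nonunits of
  \<open>V\<close>, and a point of an affine variety is determined by any ring that dominates
  it.\<close>

lemma dominates_localizationD:
  assumes "subalgebra \<iota> V" "dominates V (localization A P)"
  shows "A \<subseteq> V" "P = {a \<in> A. a \<in> nonunits V}"
proof -
  have sub: "localization A P \<subseteq> V" "nonunits (localization A P) \<subseteq> nonunits V"
    using assms by (auto simp: dominates_def)
  show AV: "A \<subseteq> V"
    using sub subset_localization by auto
  have "a \<in> P" if "a \<in> A" "a \<in> nonunits V" for a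
  proof (rule ccontr)
    assume "a \<notin> P"
    then have "inverse a \<in> V" "a \<noteq> 0"
      using localizationI[of 1 a] sub that subalg_1[OF A] prime_idealD by (auto simp: divide_inverse)
    then show False
      using that by (auto simp: nonunits_def)
  qed
  moreover have "a \<in> nonunits V" if "a \<in> P" for a
    using nonunit_localization_iff'[of a] that prime_idealD(1) sub by auto
  ultimately show "P = {a \<in> A. a \<in> nonunits V}"
    using prime_idealD(1) by auto
qed

end

lemma prime_ideal_zero: "subalgebra \<iota> A \<Longrightarrow> prime_ideal A {0}"
  using subalg_0 by (auto simp: prime_ideal_def)

lemma fractions_spec: "subalgebra \<iota> A \<Longrightarrow> R \<in> spec A \<Longrightarrow> fractions R = fractions A"
  using fractions_localization by (auto simp: spec_def)

lemma subalgebra_spec: "subalgebra \<iota> A \<Longrightarrow> R \<in> spec A \<Longrightarrow> subalgebra \<iota> R"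
  using subalgebra_localization by (auto simp: spec_def)

lemma subset_spec: "subalgebra \<iota> A \<Longrightarrow> R \<in> spec A \<Longrightarrow> A \<subseteq> R"
  using subset_localization by (auto simp: spec_def)

end

lemma dominates_refl: "dominates R R"
  by (simp add: dominates_def)

section \<open>Discrete valuation rings: orders and the filtration by powers of a
  uniformizer\<close>

locale dvr = constants \<iota> for \<iota> :: "complex \<Rightarrow> 'a::field" +
  fixes R :: "'a set" and t :: 'a
  assumes ring: "subalgebra \<iota> R" and uniformizer: "uniformizer R t"
begin

definition U where "U = R - nonunits R"
abbreviation K where "K \<equiv> fractions R"

lemma K: "subfield K" "subalgebra \<iota> K"
  using subfield_fractions[OF ring] subfieldD by auto

lemma R_subset_K: "R \<subseteq> K"
  by (rule subset_fractions[OF ring])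

lemma U_iff: "u \<in> U \<longleftrightarrow> u \<in> R \<and> u \<noteq> 0 \<and> inverse u \<in> R"
  by (auto simp: U_def nonunits_def)

lemma U_mult: "u \<in> U \<Longrightarrow> w \<in> U \<Longrightarrow> u * w \<in> U"
  and U_inverse: "u \<in> U \<Longrightarrow> inverse u \<in> U"
  and U_1: "1 \<in> U"
  and U_power: "u \<in> U \<Longrightarrow> u ^ k \<in> U"
  by (auto simp: U_iff intro: subalg_mult[OF ring] subalg_1[OF ring] subalg_power[OF ring] simp flip: power_inverse)

lemma U_powi: "u \<in> U \<Longrightarrow> u powi e \<in> U"
  by (auto simp: power_int_def intro: U_power U_inverse)

lemma U_const: "c \<noteq> 0 \<Longrightarrow> \<iota> c \<in> U"
  by (auto simp: U_iff subalg_const[OF ring] simp flip: const_inverse)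

lemma t: "t \<noteq> 0" "t \<in> R" "inverse t \<notin> R" "t \<in> K"
  using uniformizer R_subset_K by (auto simp: uniformizer_def nonunits_def)

text \<open>A positive power of \<open>t\<close> with an inverse in \<open>R\<close> would give an
  inverse of \<open>t\<close> in \<open>R\<close>; negative powers are reduced to positive ones by
  inverting.\<close>

lemma powi_t_unit:
  assumes "t powi e \<in> U" shows "e = 0"
proof -
  have False if "e > 0" "t powi e \<in> U" for e
  proof -
    have "t powi (e - 1) = t ^ nat (e - 1)"
      using that by (simp add: power_int_def)
    moreover have "inverse t = t powi (e - 1) * inverse (t powi e)"
      using t(1) by (simp add: power_int_diff divide_inverse)
    moreover have "t ^ nat (e - 1) * inverse (t powi e) \<in> R"
      using that subalg_mult[OF ring subalg_power[OF ring t(2)]] by (auto simp: U_iff)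
    ultimately have "inverse t \<in> R"
      by simp
    then show False
      using t by simp
  qed
  from this[of e] this[of "- e"] U_inverse[OF assms] assms show ?thesis
    by (cases e "0::int" rule: linorder_cases) (auto simp: power_int_minus)
qed

lemma decomposition:
  assumes "f \<in> K" "f \<noteq> 0"
  obtains u e where "u \<in> U" "f = u * t powi e"
proof -
  have *: "\<exists>u e. u \<in> U \<and> f = u * t ^ e" if "f \<in> R" "f \<noteq> 0" for f
    using uniformizer that by (force simp: uniformizer_def U_def)
  obtain a b where ab: "a \<in> R" "b \<in> R" "b \<noteq> 0" "f = a / b"
    using assms(1) by (auto simp: fractions_def)
  obtain u e where u: "u \<in> U" "a = u * t ^ e"
    using *[of a] ab assms by auto
  obtain w k where w: "w \<in> U" "b = w * t ^ k"
    using *[of b] ab by auto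
  have "f = (u * inverse w) * t powi (int e - int k)"
    using u w ab t by (simp add: power_int_diff field_simps)
  then show ?thesis
    using that[OF U_mult[OF u(1) U_inverse[OF w(1)]]] by blast
qed

lemma decomposition_unique:
  assumes "u \<in> U" "w \<in> U" "u * t powi e = w * t powi k"
  shows "e = k"
proof -
  have "t powi (e - k) = w * inverse u"
    using assms t unfolding U_iff by (simp add: power_int_diff) (simp add: field_simps)
  then have "t powi (e - k) \<in> U"
    using U_mult[OF assms(2) U_inverse[OF assms(1)]] by simp
  then show ?thesis
    using powi_t_unit by force
qed

text \<open>\<open>ord\<close> quantifies over all uniformizers, so its value must not depend on the
  choice. Writing \<open>s\<close> through \<open>t\<close> and \<open>t\<close> through
  \<open>s\<close> gives exponents with product 1.\<close>

lemma uniformizer_associate: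
  assumes "uniformizer R s"
  obtains u where "u \<in> U" "s = u * t"
proof -
  have s: "s \<noteq> 0" "s \<in> R" "s \<in> nonunits R"
    using assms by (auto simp: uniformizer_def nonunits_def)
  obtain u e where u: "u \<in> U" "s = u * t ^ e"
    using uniformizer s by (force simp: uniformizer_def U_def)
  obtain w k where w: "w \<in> U" "t = w * s ^ k"
    using assms t unfolding uniformizer_def U_def by (metis DiffI singletonD)
  have "1 * t powi 1 = (w * u ^ k) * t powi (int (e * k))"
  proof -
    have "s ^ k = u ^ k * t powi (int (e * k))"
      by (subst u(2)) (simp only: power_mult_distrib power_mult power_int_of_nat)
    then show ?thesis
      using w(2) by (simp only: power_int_1_right mult_1_left mult.assoc)
  qed
  then have "1 = int (e * k)"
    using decomposition_unique[OF U_1 U_mult[OF w(1) U_power[OF u(1)]]] by blast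
  then have "e = 1"
    by (metis of_nat_eq_1_iff nat_mult_eq_1_iff)
  then show ?thesis
    using u that by simp
qed

lemma ord_eq:
  assumes "u \<in> U" "f = u * t powi e"
  shows "ord R f = e"
  unfolding ord_def U_def[symmetric]
proof (rule the_equality)
  show "\<exists>s u. uniformizer R s \<and> u \<in> U \<and> f = u * s powi e"
    using assms uniformizer by blast
next
  fix k assume "\<exists>s u. uniformizer R s \<and> u \<in> U \<and> f = u * s powi k"
  then obtain s w where s: "uniformizer R s" "w \<in> U" "f = w * s powi k"
    by blast
  obtain x where x: "x \<in> U" "s = x * t"
    using uniformizer_associate[OF s(1)] .
  have "(w * x powi k) * t powi k = u * t powi e"
    using s assms x by (simp add: power_int_mult_distrib)
  then show "k = e"
    using decomposition_unique[OF U_mult[OF s(2) U_powi[OF x(1)]] assms(1)] by blast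
qed

lemma ord_decomposition:
  assumes "f \<in> K" "f \<noteq> 0"
  obtains u where "u \<in> U" "f = u * t powi (ord R f)"
  using decomposition[OF assms] ord_eq by metis

lemma ord_unit: "u \<in> U \<Longrightarrow> ord R u = 0"
  using ord_eq[of u u 0] by simp

lemma ord_1 [simp]: "ord R 1 = 0"
  using ord_unit[OF U_1] .

lemma ord_uniformizer: "ord R t = 1"
  using ord_eq[OF U_1, of t 1] by simp

lemma ord_mult:
  assumes "f \<in> K" "f \<noteq> 0" "g \<in> K" "g \<noteq> 0"
  shows "ord R (f * g) = ord R f + ord R g"
proof -
  obtain u w where "u \<in> U" "f = u * t powi (ord R f)" "w \<in> U" "g = w * t powi (ord R g)"
    using ord_decomposition assms by metis
  then have "f * g = (u * w) * t powi (ord R f + ord R g)"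
    using t by (simp add: power_int_add) (metis mult.assoc mult.left_commute)
  then show ?thesis
    using ord_eq[OF U_mult[OF \<open>u \<in> U\<close> \<open>w \<in> U\<close>]] by blast
qed

lemma ord_inverse:
  assumes "f \<in> K" "f \<noteq> 0"
  shows "ord R (inverse f) = - ord R f"
  using ord_mult[OF assms, of "inverse f"] assms subfield_inverse[OF K(1)] by simp

lemma ord_divide:
  assumes "f \<in> K" "f \<noteq> 0" "g \<in> K" "g \<noteq> 0"
  shows "ord R (f / g) = ord R f - ord R g"
  using ord_mult[of f "inverse g"] ord_inverse assms subfield_inverse[OF K(1)] by (simp add: divide_inverse)

lemma ord_power:
  assumes "f \<in> K" "f \<noteq> 0"
  shows "ord R (f ^ k) = int k * ord R f"
  using assms by (induction k) (auto simp: ord_mult subalg_power[OF K(2)] algebra_simps)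

lemma ord_prod:
  assumes "\<And>i. i \<in> I \<Longrightarrow> f i \<in> K \<and> f i \<noteq> 0"
  shows "ord R (\<Prod>i\<in>I. f i) = (\<Sum>i\<in>I. ord R (f i))"
  using assms
proof (induction I rule: infinite_finite_induct)
  case (insert x F)
  then show ?case
    by (subst prod.insert) (auto simp: ord_mult subalg_prod[OF K(2)])
qed auto

lemma mem_iff_ord:
  assumes "f \<in> K" "f \<noteq> 0"
  shows "f \<in> R \<longleftrightarrow> ord R f \<ge> 0"
proof -
  obtain u where u: "u \<in> U" "f = u * t powi (ord R f)"
    using ord_decomposition assms by metis
  show ?thesis
  proof
    assume "ord R f \<ge> 0"
    then show "f \<in> R"
      using u subalg_mult[OF ring, of u "t ^ nat (ord R f)"] subalg_power[OF ring t(2)]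
      by (simp add: power_int_def U_iff split: if_splits)
  next
    assume "f \<in> R"
    then obtain w k where "w \<in> U" "f = w * t ^ k"
      using uniformizer assms by (force simp: uniformizer_def U_def)
    then show "ord R f \<ge> 0"
      using ord_eq[of w f "int k"] by simp
  qed
qed

lemma U_iff_ord:
  assumes "f \<in> K" "f \<noteq> 0"
  shows "f \<in> U \<longleftrightarrow> ord R f = 0"
proof -
  have "inverse f \<in> K" "inverse f \<noteq> 0"
    using assms subfield_inverse[OF K(1)] by auto
  then show ?thesis
    using mem_iff_ord[OF assms] mem_iff_ord[of "inverse f"] ord_inverse[OF assms] assms
    by (auto simp: U_iff)
qed

text \<open>This is the fractional ideal generated by the k-th power of \<open>t\<close>. Zero is
  added by hand because \<open>ord R 0\<close> is an unspecified value; bounds stated as membership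
  in \<open>filt\<close> avoid case distinctions on vanishing.\<close>

definition filt :: "int \<Rightarrow> 'a set" where
  "filt k = {f \<in> K. f = 0 \<or> ord R f \<ge> k}"

lemma filt_subset: "filt k \<subseteq> K"
  by (auto simp: filt_def)

lemma filt_0: "filt 0 = R"
  using mem_iff_ord R_subset_K subalg_0[OF ring] by (auto simp: filt_def)

lemma filt_iff: "f \<in> filt k \<longleftrightarrow> f * t powi (- k) \<in> R" if "f \<in> K"
proof (cases "f = 0")
  case False
  have "t powi (- k) \<in> K" "t powi (- k) \<noteq> 0"
    using t subfield_powi[OF K(1)] by auto
  moreover have "ord R (t powi (- k)) = - k"
    using ord_eq[OF U_1, of "t powi (- k)"] by simp
  ultimately show ?thesis
    using that False mem_iff_ord[of "f * t powi (- k)"] ord_mult[of f "t powi (- k)"] subalg_mult[OF K(2)]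
    by (auto simp: filt_def)
qed (use that subalg_0[OF ring] in \<open>auto simp: filt_def\<close>)

text \<open>The ultrametric inequality: multiplication with a power of \<open>t\<close> moves
  \<open>filt k\<close> onto \<open>R\<close>, which is closed under addition.\<close>

lemma filt_add: "f \<in> filt k \<Longrightarrow> g \<in> filt k \<Longrightarrow> f + g \<in> filt k"
  using filt_iff[of f k] filt_iff[of g k] filt_iff[of "f + g" k] filt_subset subalg_add[OF K(2), of f g]
    subalg_add[OF ring, of "f * t powi - k" "g * t powi - k"]
  by (auto simp: distrib_right)

lemma filt_zero: "0 \<in> filt k"
  by (auto simp: filt_def subalg_0[OF K(2)])

lemma filt_mult: "f \<in> filt j \<Longrightarrow> g \<in> filt k \<Longrightarrow> f * g \<in> filt (j + k)"
  using ord_mult[of f g] by (cases "f = 0 \<or> g = 0") (auto simp: filt_def intro: subalg_mult[OF K(2)])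

lemma filt_minus: "f \<in> filt k \<Longrightarrow> - f \<in> filt k"
  using filt_mult[of "- 1" 0 f k] subalg_minus[OF ring subalg_1[OF ring]] by (simp add: filt_0)

lemma filt_sum: "(\<And>i. i \<in> I \<Longrightarrow> f i \<in> filt k) \<Longrightarrow> sum f I \<in> filt k"
  by (induction I rule: infinite_finite_induct) (auto intro: filt_add filt_zero)

lemma filt_prod:
  assumes "finite I" "\<And>i. i \<in> I \<Longrightarrow> f i \<in> filt (k i)"
  shows "prod f I \<in> filt (sum k I)"
  using assms by (induction I rule: finite_induct) (auto intro!: filt_mult simp: filt_0 subalg_1[OF ring])

lemma filt_ord: "f \<in> K \<Longrightarrow> f \<in> filt (ord R f)"
  by (auto simp: filt_def)

text \<open>Each Leibniz product meets every row and every column once, so the row bounds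
  \<open>b\<close> and column bounds \<open>c\<close> add up to the same total for all permutations.
  In the application the rows are differential operators and the columns are sections.\<close>

lemma det_filt:
  assumes "\<And>i j. i < n \<Longrightarrow> j < n \<Longrightarrow> f (i, j) \<in> filt (b i + c j)"
  shows "det (mat n n f) \<in> filt ((\<Sum>i<n. b i) + (\<Sum>j<n. c j))"
proof -
  have "(\<Prod>i = 0..<n. mat n n f $$ (i, p i)) \<in> filt ((\<Sum>i<n. b i) + (\<Sum>j<n. c j))" if p: "p permutes {0..<n}" for p
  proof -
    have "(\<Prod>i = 0..<n. mat n n f $$ (i, p i)) \<in> filt (\<Sum>i = 0..<n. b i + c (p i))"
      using assms p by (intro filt_prod) (auto simp: permutes_in_image)
    also have "(\<Sum>i = 0..<n. b i + c (p i)) = (\<Sum>i<n. b i) + (\<Sum>j<n. c j)"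
      using sum.permute[OF p, of c] by (simp add: sum.distrib atLeast0LessThan o_def)
    finally show ?thesis .
  qed
  moreover have "signof p * x \<in> filt k" if "x \<in> filt k" for x k and p :: "nat \<Rightarrow> nat"
    using that filt_minus by (auto simp: sign_def)
  ultimately show ?thesis
    by (subst det_def'[of _ n]) (auto intro!: filt_sum)
qed

end

section \<open>Factorial rings and Gauss's lemma\<close>

definition is_subring :: "'b::idom set \<Rightarrow> bool" where
  "is_subring R \<longleftrightarrow> 1 \<in> R \<and> (\<forall>x\<in>R. \<forall>y\<in>R. x - y \<in> R \<and> x * y \<in> R)"

text \<open>Coordinate rings are subsets of a field, where ordinary divisibility is trivial; hence
  divisibility and primality are taken relative to the subset \<open>R\<close>.\<close>

definition divides_in :: "'b::idom set \<Rightarrow> 'b \<Rightarrow> 'b \<Rightarrow> bool" where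
  "divides_in R a b \<longleftrightarrow> (\<exists>c\<in>R. b = a * c)"

definition prime_in :: "'b::idom set \<Rightarrow> 'b \<Rightarrow> bool" where
  "prime_in R p \<longleftrightarrow> p \<in> R \<and> p \<noteq> 0 \<and> \<not> divides_in R p 1 \<and>
     (\<forall>a\<in>R. \<forall>b\<in>R. divides_in R p (a * b) \<longrightarrow> divides_in R p a \<or> divides_in R p b)"

definition factorization :: "'b::idom set \<Rightarrow> 'b \<Rightarrow> 'b \<Rightarrow> 'b list \<Rightarrow> bool" where
  "factorization R a u ps \<longleftrightarrow>
     u \<in> R \<and> divides_in R u 1 \<and> (\<forall>p\<in>set ps. prime_in R p) \<and> a = u * prod_list ps"

text \<open>The factors are prime elements rather than irreducible ones, so uniqueness of
  factorizations does not have to be recorded.\<close>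

definition factorial_in :: "'b::idom set \<Rightarrow> bool" where
  "factorial_in R \<longleftrightarrow> (\<forall>a\<in>R. a \<noteq> 0 \<longrightarrow> (\<exists>u ps. factorization R a u ps))"

context
  fixes R :: "'b::idom set" assumes R: "is_subring R"
begin

lemma subring_1: "1 \<in> R" and subring_diff: "x \<in> R \<Longrightarrow> y \<in> R \<Longrightarrow> x - y \<in> R"
  and subring_mult: "x \<in> R \<Longrightarrow> y \<in> R \<Longrightarrow> x * y \<in> R"
  using R by (auto simp: is_subring_def)

lemma subring_0: "0 \<in> R"
  using subring_diff[OF subring_1 subring_1] by simp

lemma subring_add: "x \<in> R \<Longrightarrow> y \<in> R \<Longrightarrow> x + y \<in> R"
  using subring_diff[of x "0 - y"] subring_diff[OF subring_0] by simp

lemma subring_sum: "(\<And>i. i \<in> I \<Longrightarrow> f i \<in> R) \<Longrightarrow> sum f I \<in> R"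
  by (induction I rule: infinite_finite_induct) (auto intro: subring_0 subring_add)

lemma divides_in_mult: "divides_in R a b \<Longrightarrow> c \<in> R \<Longrightarrow> divides_in R a (b * c)"
  by (auto simp: divides_in_def mult.assoc intro!: bexI[of _ "_ * c"] subring_mult)

lemma divides_in_refl: "divides_in R a a"
  using subring_1 by (auto simp: divides_in_def intro!: bexI[of _ 1])

lemma prime_inD: "prime_in R p \<Longrightarrow> a \<in> R \<Longrightarrow> b \<in> R \<Longrightarrow> divides_in R p (a * b) \<Longrightarrow> divides_in R p a \<or> divides_in R p b"
  by (auto simp: prime_in_def)

lemma factorization_mem:
  assumes "\<forall>p\<in>set ps. prime_in R p" shows "prod_list ps \<in> R"
  using assms by (induction ps) (auto intro: subring_1 subring_mult simp: prime_in_def)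

lemma factorization_mult:
  assumes "factorization R a u ps" "factorization R b w qs"
  shows "factorization R (a * b) (u * w) (ps @ qs)"
proof -
  obtain x y where "x \<in> R" "y \<in> R" "1 = u * x" "1 = w * y"
    using assms by (auto simp: factorization_def divides_in_def)
  then have "divides_in R (u * w) 1"
    by (auto simp: divides_in_def intro!: bexI[of _ "x * y"] subring_mult) (metis mult.assoc mult.left_commute mult_1_left)
  then show ?thesis
    using assms by (auto simp: factorization_def intro: subring_mult)
qed

lemma factorization_prime: "prime_in R p \<Longrightarrow> factorization R p 1 [p]"
  by (auto simp: factorization_def divides_in_refl subring_1)

lemma prime_divides_unit:
  assumes "prime_in R p" "divides_in R u 1" shows "\<not> divides_in R p u"
  using assms by (auto simp: prime_in_def divides_in_def mult.assoc intro: subring_mult)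

lemma prime_divides_prime:
  assumes p: "prime_in R p" and q: "prime_in R q" and "divides_in R p q"
  obtains e where "e \<in> R" "divides_in R e 1" "q = p * e"
proof -
  obtain e where e: "e \<in> R" "q = p * e"
    using assms by (auto simp: divides_in_def)
  have "divides_in R q (p * e)"
    using e divides_in_refl by simp
  then consider "divides_in R q p" | "divides_in R q e"
    using p e prime_inD[OF q] by (auto simp: prime_in_def)
  then have "divides_in R e 1"
  proof cases
    case 1
    then obtain d where "d \<in> R" "p = q * d"
      by (auto simp: divides_in_def)
    then show ?thesis
      using e p by (auto simp: divides_in_def prime_in_def mult.assoc)
  next
    case 2
    then obtain d where "d \<in> R" "e = q * d"
      by (auto simp: divides_in_def)
    then have "1 = p * d"
      using e q by (auto simp: prime_in_def mult.assoc)
    then show ?thesis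
      using \<open>d \<in> R\<close> p by (auto simp: divides_in_def prime_in_def)
  qed
  then show ?thesis
    using e that by blast
qed

text \<open>The prime \<open>p\<close> divides a member of the list, which then equals
  \<open>p\<close> up to a unit; deleting it shortens the list. This drop in length is the induction
  measure of \<open>reduced_fraction\<close> and \<open>primitive_part\<close>.\<close>

lemma prime_divides_factorization:
  assumes "prime_in R p" "factorization R a u ps" "divides_in R p a"
  obtains b w qs where "b \<in> R" "a = p * b" "factorization R b w qs" "length qs < length ps"
proof -
  have "\<exists>b w qs. b \<in> R \<and> a = p * b \<and> factorization R b w qs \<and> length qs < length ps"
    using assms
  proof (induction ps arbitrary: a)
    case Nil
    then show ?case
      using prime_divides_unit by (auto simp: factorization_def)
  next
    case (Cons q ps)
    define c where "c = u * prod_list ps"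
    have c: "factorization R c u ps" "c \<in> R" and q: "prime_in R q" and a: "a = q * c"
      using Cons.prems factorization_mem
      by (auto simp: factorization_def c_def mult.left_commute intro: subring_mult)
    consider "divides_in R p q" | "divides_in R p c"
      using Cons.prems a prime_inD[of p q c] c q by (auto simp: prime_in_def)
    then show ?case
    proof cases
      case 1
      then obtain e where e: "e \<in> R" "divides_in R e 1" "q = p * e"
        using prime_divides_prime Cons.prems q by blast
      then have "factorization R (e * c) (e * u) ([] @ ps)"
        by (intro factorization_mult) (auto simp: factorization_def c[unfolded factorization_def])
      then show ?thesis
        using e c a by (intro exI[of _ "e * c"] exI[of _ "e * u"] exI[of _ ps])
          (auto intro: subring_mult simp: mult.assoc)
    next
      case 2
      then obtain b w qs where b: "b \<in> R" "c = p * b" "factorization R b w qs" "length qs < length ps"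
        using Cons.IH Cons.prems c by blast
      then have "factorization R (q * b) (1 * w) ([q] @ qs)"
        by (intro factorization_mult factorization_prime q)
      then show ?thesis
        using b a q by (intro exI[of _ "q * b"] exI[of _ w] exI[of _ "q # qs"])
          (auto intro: subring_mult simp: prime_in_def mult.left_commute)
    qed
  qed
  then show ?thesis
    using that by blast
qed

text \<open>The multiplicity is finite because each member of the factorization contributes at most
  one power of \<open>p\<close>: members associated with \<open>p\<close> go into the power, all
  others into \<open>b\<close>.\<close>

lemma prime_multiplicity:
  assumes p: "prime_in R p" and "factorization R a u ps"
  obtains e b where "b \<in> R" "a = p ^ e * b" "\<not> divides_in R p b"
proof -
  have "\<exists>e b. b \<in> R \<and> a = p ^ e * b \<and> \<not> divides_in R p b"
    using assms(2)
  proof (induction ps arbitrary: a)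
    case Nil
    then show ?case
      using prime_divides_unit[OF p] by (intro exI[of _ 0] exI[of _ u]) (auto simp: factorization_def)
  next
    case (Cons q ps)
    define c where "c = u * prod_list ps"
    have c: "factorization R c u ps" "c \<in> R" and q: "prime_in R q" "q \<in> R" and a: "a = q * c"
      using Cons.prems factorization_mem
      by (auto simp: factorization_def c_def mult.left_commute prime_in_def intro: subring_mult)
    obtain e b where b: "b \<in> R" "c = p ^ e * b" "\<not> divides_in R p b"
      using Cons.IH c by blast
    show ?case
    proof (cases "divides_in R p q")
      case True
      then obtain x y where x: "x \<in> R" "y \<in> R" "1 = x * y" "q = p * x"
        using prime_divides_prime[OF p q(1)] by (metis divides_in_def)
      have "\<not> divides_in R p (x * b)"
        using b(3) divides_in_mult[of p "x * b" y] x
        by (metis mult.assoc mult.commute mult_1_right)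
      then show ?thesis
        using a b x by (intro exI[of _ "Suc e"] exI[of _ "x * b"]) (auto intro: subring_mult simp: ac_simps)
    next
      case False
      then have "\<not> divides_in R p (q * b)"
        using prime_inD[OF p q(2) b(1)] b by blast
      then show ?thesis
        using a b q by (intro exI[of _ e] exI[of _ "q * b"]) (auto intro: subring_mult simp: ac_simps)
    qed
  qed
  then show ?thesis
    using that by blast
qed

end

text \<open>Serves to transport factoriality from a polynomial ring into the function field by
  evaluation at a transcendental element. That map is injective only on polynomials with
  coefficients in a suitable subring, hence \<open>inj_on\<close>.\<close>

lemma factorial_image:
  fixes \<phi> :: "'b::idom \<Rightarrow> 'c::idom"
  assumes R: "is_subring R" and fac: "factorial_in R" and inj: "inj_on \<phi> R"
    and mult: "\<And>x y. \<phi> (x * y) = \<phi> x * \<phi> y" and one: "\<phi> 1 = 1" and zero: "\<phi> 0 = 0"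
  shows "factorial_in (\<phi> ` R)"
proof -
  have div: "divides_in (\<phi> ` R) (\<phi> a) (\<phi> b) \<longleftrightarrow> divides_in R a b" if "a \<in> R" "b \<in> R" for a b
    using that inj_on_eq_iff[OF inj, of b "a * _"] subring_mult[OF R]
    by (auto simp: divides_in_def simp flip: mult)
  have prime: "prime_in (\<phi> ` R) (\<phi> p)" if "prime_in R p" for p
    using that div subring_1[OF R] subring_mult[OF R] inj_on_eq_iff[OF inj, of p 0] subring_0[OF R]
    unfolding prime_in_def by (auto simp: zero one simp flip: mult) (metis div one subring_1[OF R])+
  have list: "\<phi> (prod_list ps) = prod_list (map \<phi> ps)" for ps
    by (induction ps) (auto simp: mult one)
  have "factorization (\<phi> ` R) (\<phi> a) (\<phi> u) (map \<phi> ps)" if "factorization R a u ps" for a u ps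
    using that prime div[of u 1] subring_1[OF R] by (auto simp: factorization_def mult one list)
  then show ?thesis
    using fac unfolding factorial_in_def by (metis image_iff zero)
qed

text \<open>Polynomials over a subring and over its field of fractions share one type, so passing
  between them needs no coercion.\<close>

definition polys :: "'a::field set \<Rightarrow> 'a poly set" where
  "polys A = {p. \<forall>i. coeff p i \<in> A}"

lemma polys_mono: "A \<subseteq> B \<Longrightarrow> polys A \<subseteq> polys B"
  by (auto simp: polys_def)

context
  fixes A :: "'a::field set" assumes A: "is_subring A"
begin

lemma subring_polys: "is_subring (polys A)"
  unfolding is_subring_def polys_def
  by (auto simp: coeff_mult subring_diff[OF A] subring_1[OF A] subring_0[OF A] coeff_1
      intro!: subring_sum[OF A] subring_mult[OF A])

lemma smult_polys: "c \<in> A \<Longrightarrow> f \<in> polys A \<Longrightarrow> smult c f \<in> polys A"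
  by (auto simp: polys_def intro: subring_mult[OF A])

lemma const_polys: "c \<in> A \<Longrightarrow> [:c:] \<in> polys A"
  using subring_0[OF A] by (auto simp: polys_def coeff_pCons split: nat.split)

lemma divides_in_field_iff: "p \<noteq> 0 \<Longrightarrow> divides_in A p x \<longleftrightarrow> x / p \<in> A"
  by (auto simp: divides_in_def intro!: bexI[of _ "x / p"])

lemma divides_in_polys_const:
  assumes "p \<noteq> 0"
  shows "divides_in (polys A) [:p:] f \<longleftrightarrow> (\<forall>i. divides_in A p (coeff f i))"
proof
  assume "\<forall>i. divides_in A p (coeff f i)"
  then have "smult (inverse p) f \<in> polys A"
    using assms by (auto simp: polys_def divides_in_field_iff field_simps)
  moreover have "f = [:p:] * smult (inverse p) f"
    using assms by simp
  ultimately show "divides_in (polys A) [:p:] f"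
    unfolding divides_in_def by blast
qed (auto simp: divides_in_def polys_def)

lemma prime_in_polys_const:
  assumes p: "prime_in A p"
  shows "prime_in (polys A) [:p:]"
proof -
  have p0: "p \<noteq> 0" "p \<in> A"
    using p by (auto simp: prime_in_def)
  have "divides_in (polys A) [:p:] f \<or> divides_in (polys A) [:p:] g"
    if fg: "f \<in> polys A" "g \<in> polys A" "divides_in (polys A) [:p:] (f * g)" for f g
  proof (rule ccontr)
    assume "\<not> ?thesis"
    then have ex: "\<exists>i. \<not> divides_in A p (coeff f i)" "\<exists>j. \<not> divides_in A p (coeff g j)"
      using divides_in_polys_const[OF p0(1)] by auto
    \<comment> \<open>The lowest coefficients not divisible by \<open>p\<close>. In the coefficient
      of index i + j of the product, every summand other than the product of these two contains a
      divisible factor.\<close>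
    obtain i where i: "\<not> divides_in A p (coeff f i)" "\<And>k. k < i \<Longrightarrow> divides_in A p (coeff f k)"
      using ex(1) exists_least_iff[of "\<lambda>i. \<not> divides_in A p (coeff f i)"] by auto
    obtain j where j: "\<not> divides_in A p (coeff g j)" "\<And>k. k < j \<Longrightarrow> divides_in A p (coeff g k)"
      using ex(2) exists_least_iff[of "\<lambda>i. \<not> divides_in A p (coeff g i)"] by auto
    have mem: "coeff f k \<in> A" "coeff g k \<in> A" for k
      using fg by (auto simp: polys_def)
    have "(\<Sum>k\<in>{..i + j} - {i}. coeff f k * coeff g (i + j - k)) / p \<in> A"
      unfolding sum_divide_distrib
    proof (rule subring_sum[OF A])
      fix k assume k: "k \<in> {..i + j} - {i}"
      then have "k < i \<or> i + j - k < j"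
        by auto
      then have "coeff f k / p \<in> A \<or> coeff g (i + j - k) / p \<in> A"
        using i(2) j(2) divides_in_field_iff[OF p0(1)] by blast
      then show "coeff f k * coeff g (i + j - k) / p \<in> A"
        using subring_mult[OF A, of "coeff f k / p"] subring_mult[OF A, of "coeff f k"] mem by force
    qed
    moreover have "coeff (f * g) (i + j) / p \<in> A"
      using fg divides_in_polys_const[OF p0(1)] divides_in_field_iff[OF p0(1)] by blast
    moreover have "coeff (f * g) (i + j) = coeff f i * coeff g j + (\<Sum>k\<in>{..i + j} - {i}. coeff f k * coeff g (i + j - k))"
      unfolding coeff_mult by (subst sum.remove[of _ i]) auto
    then have "coeff f i * coeff g j / p =
        coeff (f * g) (i + j) / p - (\<Sum>k\<in>{..i + j} - {i}. coeff f k * coeff g (i + j - k)) / p"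
      by (simp add: add_divide_distrib)
    ultimately have "coeff f i * coeff g j / p \<in> A"
      using subring_diff[OF A] by metis
    then show False
      using prime_inD[OF A p, of "coeff f i" "coeff g j"] i(1) j(1) mem divides_in_field_iff[OF p0(1)] by blast
  qed
  moreover have "\<not> divides_in (polys A) [:p:] 1"
    using divides_in_polys_const[OF p0(1), of 1] p by (auto simp: prime_in_def dest!: spec[of _ 0])
  ultimately show ?thesis
    using p0 const_polys by (auto simp: prime_in_def)
qed

lemma factorization_const:
  assumes "factorization A c u ps"
  shows "factorization (polys A) [:c:] [:u:] (map (\<lambda>p. [:p:]) ps)"
proof -
  have "prod_list (map (\<lambda>p. [:p:]) ps) = [:prod_list ps:]" for ps :: "'a list"
    by (induction ps) (auto simp: one_pCons)
  moreover have "divides_in (polys A) [:u:] 1"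
    using assms const_polys unfolding factorization_def divides_in_def
    by (auto simp: one_pCons intro!: bexI[of _ "[:_:]"])
  ultimately show ?thesis
    using assms prime_in_polys_const const_polys by (auto simp: factorization_def)
qed

text \<open>The prime factors of \<open>c\<close> are removed one at a time: each stays prime as a
  constant polynomial, so it divides \<open>g\<close> or \<open>h\<close> and can be divided out
  there. \<open>a\<close> and \<open>b\<close> collect what was removed, including the remaining
  unit.\<close>

lemma gauss_cancel:
  assumes "factorization A c u ps" "c \<in> A" "f \<in> polys A" "f \<noteq> 0" "g \<in> polys A" "h \<in> polys A" "smult c f = g * h"
  shows "\<exists>a b g' h'. a \<in> A \<and> b \<in> A \<and> a \<noteq> 0 \<and> b \<noteq> 0 \<and> g' \<in> polys A \<and> h' \<in> polys A \<and>
    g = smult a g' \<and> h = smult b h' \<and> f = g' * h'"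
  using assms
proof (induction ps arbitrary: c g h)
  case Nil
  then have u: "u \<in> A" "divides_in A u 1" "c = u"
    by (auto simp: factorization_def)
  then have u0: "u \<noteq> 0" "inverse u \<in> A"
    by (auto simp: divides_in_def) (metis inverse_unique)
  have "f = smult (inverse u) g * h"
    using Nil u u0 by (simp flip: Nil.prems(7))
  then show ?case
    using Nil u u0 by (intro exI[of _ u] exI[of _ 1] exI[of _ "smult (inverse u) g"] exI[of _ h])
      (auto intro: smult_polys subring_1[OF A])
next
  case (Cons p ps)
  define c' where "c' = u * prod_list ps"
  have c': "factorization A c' u ps" "c' \<in> A" and p: "prime_in A p" "p \<noteq> 0" "p \<in> A" and c: "c = p * c'"
    using Cons.prems factorization_mem[OF A]
    by (auto simp: factorization_def c'_def mult.left_commute prime_in_def intro: subring_mult[OF A])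
  have smult_inv: "k = smult p (smult (inverse p) k)" for k :: "'a poly"
    using p by simp
  have div: "smult (inverse p) k \<in> polys A" if "divides_in (polys A) [:p:] k" for k
    using that p(2) by (auto simp: divides_in_def)
  have "g * h = [:p:] * smult c' f"
    using c by (simp add: mult.commute flip: Cons.prems(7))
  then have "divides_in (polys A) [:p:] (g * h)"
    using smult_polys c' Cons.prems unfolding divides_in_def by blast
  then consider "divides_in (polys A) [:p:] g" | "divides_in (polys A) [:p:] h"
    using prime_in_polys_const[OF p(1)] Cons.prems by (auto simp: prime_in_def)
  then show ?case
  proof cases
    case 1
    have "smult c' f = smult (inverse p) g * h"
      using p(2) c by (simp add: mult.assoc[symmetric] flip: Cons.prems(7))
    from Cons.IH[OF c' Cons.prems(3,4) div[OF 1] Cons.prems(6) this]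
    obtain a b g' h' where *: "a \<in> A" "b \<in> A" "a \<noteq> 0" "b \<noteq> 0" "g' \<in> polys A" "h' \<in> polys A"
      "smult (inverse p) g = smult a g'" "h = smult b h'" "f = g' * h'"
      by blast
    moreover have "g = smult (p * a) g'"
      using *(7) smult_inv[of g] by (metis smult_smult)
    ultimately show ?thesis
      using p subring_mult[OF A] by (metis mult_eq_0_iff)
  next
    case 2
    have "smult c' f = g * smult (inverse p) h"
      using p(2) c by (simp add: mult.assoc[symmetric] flip: Cons.prems(7))
    from Cons.IH[OF c' Cons.prems(3,4) Cons.prems(5) div[OF 2] this]
    obtain a b g' h' where *: "a \<in> A" "b \<in> A" "a \<noteq> 0" "b \<noteq> 0" "g' \<in> polys A" "h' \<in> polys A"
      "g = smult a g'" "smult (inverse p) h = smult b h'" "f = g' * h'"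
      by blast
    moreover have "h = smult (p * b) h'"
      using *(8) smult_inv[of h] by (metis smult_smult)
    ultimately show ?thesis
      using p subring_mult[OF A] by (metis mult_eq_0_iff)
  qed
qed

lemma divides_content:
  assumes "prime_in A p" "divides_in (polys A) [:p:] f"
  obtains g where "g \<in> polys A" "f = smult p g"
  using assms that by (auto simp: divides_in_def)

text \<open>Primes dividing all coefficients are pulled out repeatedly. This terminates because each
  of them uses up a prime factor of the leading coefficient.\<close>

lemma primitive_part:
  assumes "f \<in> polys A" "f \<noteq> 0" "factorization A (lead_coeff f) u ps"
  shows "\<exists>c g. c \<in> A \<and> c \<noteq> 0 \<and> g \<in> polys A \<and> f = smult c g \<and> (\<forall>p. prime_in A p \<longrightarrow> \<not> divides_in (polys A) [:p:] g)"
  using assms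
proof (induction "length ps" arbitrary: f u ps rule: less_induct)
  case less
  show ?case
  proof (cases "\<exists>p. prime_in A p \<and> divides_in (polys A) [:p:] f")
    case False
    then show ?thesis
      using less.prems subring_1[OF A] by (intro exI[of _ 1] exI[of _ f]) auto
  next
    case True
    then obtain p g where p: "prime_in A p" and g: "g \<in> polys A" "f = smult p g"
      using divides_content by blast
    have p0: "p \<noteq> 0" "p \<in> A"
      using p by (auto simp: prime_in_def)
    have "divides_in A p (lead_coeff f)"
      using g by (auto simp: divides_in_def polys_def intro!: bexI[of _ "lead_coeff g"])
    then obtain b w qs where b: "lead_coeff f = p * b" "factorization A b w qs" "length qs < length ps"
      using prime_divides_factorization[OF A p less.prems(3)] by metis
    then have "b = lead_coeff g"
      using g p0 by simp
    then obtain c h where "c \<in> A" "c \<noteq> 0" "h \<in> polys A" "g = smult c h"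
      "\<forall>p. prime_in A p \<longrightarrow> \<not> divides_in (polys A) [:p:] h"
      using less.hyps[OF b(3) g(1), of w] b g less.prems by auto
    then show ?thesis
      using g p0 by (intro exI[of _ "p * c"] exI[of _ h]) (auto intro: subring_mult[OF A])
  qed
qed

end

context
  fixes K :: "'a::field set"
  assumes K: "is_subring K" and inverse_K: "\<And>x. x \<in> K \<Longrightarrow> inverse x \<in> K"
begin

text \<open>Long division in the type of polynomials over the ambient field, carried out so that
  quotient and remainder keep their coefficients in \<open>K\<close>.\<close>

lemma polys_division:
  assumes "f \<in> polys K" "g \<in> polys K" "g \<noteq> 0"
  shows "\<exists>q r. q \<in> polys K \<and> r \<in> polys K \<and> f = q * g + r \<and> (r = 0 \<or> degree r < degree g)"
  using assms(1)
proof (induction "degree f" arbitrary: f rule: less_induct)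
  case less
  note P = subring_polys[OF K]
  show ?case
  proof (cases "f = 0 \<or> degree f < degree g")
    case True
    then show ?thesis
      using less.prems subring_0[OF P] by (intro exI[of _ 0] exI[of _ f]) auto
  next
    case False
    define c where "c = lead_coeff f / lead_coeff g"
    define s where "s = monom c (degree f - degree g)"
    have c: "c \<in> K" "c \<noteq> 0"
      using less.prems assms False inverse_K subring_mult[OF K] by (auto simp: c_def polys_def divide_inverse)
    have s: "s \<in> polys K"
      using c subring_0[OF K] by (auto simp: s_def polys_def)
    have "lead_coeff s = c"
      unfolding s_def by (rule lead_coeff_monom)
    then have "lead_coeff (s * g) = lead_coeff f"
      using assms by (simp only: lead_coeff_mult) (simp add: c_def)
    moreover have "degree (s * g) = degree f"
    proof -
      have "degree s = degree f - degree g"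
        unfolding s_def by (rule Polynomial.degree_monom_eq[OF c(2)])
      then show ?thesis
        using \<open>lead_coeff s = c\<close> c(2) assms False by (subst degree_mult_eq) auto
    qed
    ultimately have sg: "degree (s * g) = degree f" "lead_coeff (s * g) = lead_coeff f"
      by auto
    show ?thesis
    proof (cases "f - s * g = 0")
      case True
      then show ?thesis
        using s subring_0[OF P] by (intro exI[of _ s] exI[of _ 0]) auto
    next
      case nz: False
      have deg: "degree (f - s * g) < degree f"
      proof (rule ccontr)
        assume "\<not> ?thesis"
        then have "degree (f - s * g) = degree f"
          using degree_diff_le_max[of f "s * g"] sg by auto
        then have "lead_coeff (f - s * g) = lead_coeff f - lead_coeff (s * g)"
          using sg(1) by simp
        then have "lead_coeff (f - s * g) = 0"
          using sg(2) by simp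
        then show False
          using nz leading_coeff_0_iff by blast
      qed
      have "f - s * g \<in> polys K"
        using less.prems s assms by (intro subring_diff[OF P] subring_mult[OF P])
      from less.hyps[OF deg this] obtain q r where
        *: "q \<in> polys K" "r \<in> polys K" "f - s * g = q * g + r" "r = 0 \<or> degree r < degree g"
        by blast
      have "f = (s + q) * g + r"
        using *(3) by (simp add: algebra_simps)
      then show ?thesis
        using * s subring_add[OF P] by metis
    qed
  qed
qed

lemma irreducible_divides_mult:
  assumes f: "f \<in> polys K" "degree f > 0"
    and irr: "\<And>g h. g \<in> polys K \<Longrightarrow> h \<in> polys K \<Longrightarrow> f = g * h \<Longrightarrow> degree g = 0 \<or> degree h = 0"
    and gh: "g \<in> polys K" "h \<in> polys K" "divides_in (polys K) f (g * h)"
  shows "divides_in (polys K) f g \<or> divides_in (polys K) f h"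
proof -
  note P = subring_polys[OF K]
  \<comment> \<open>The ideal generated by \<open>f\<close> and \<open>g\<close>. Its element
    \<open>d\<close> of least degree divides both. By irreducibility of \<open>f\<close>, either
    \<open>d\<close> is constant, which gives a Bezout identity and makes \<open>f\<close> divide
    \<open>h\<close>, or \<open>d\<close> is \<open>f\<close> up to a constant and \<open>f\<close>
    divides \<open>g\<close>.\<close>
  define I where "I = {x * f + y * g | x y. x \<in> polys K \<and> y \<in> polys K}"
  have If: "f \<in> I" and Ig: "g \<in> I"
    unfolding I_def using subring_0[OF P] subring_1[OF P] by force+
  have sub: "p - q * r \<in> I" if pr: "p \<in> I" "r \<in> I" and q: "q \<in> polys K" for p q r
  proof -
    obtain x y x' y' where *: "x \<in> polys K" "y \<in> polys K" "p = x * f + y * g"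
      "x' \<in> polys K" "y' \<in> polys K" "r = x' * f + y' * g"
      using pr unfolding I_def by blast
    then have "p - q * r = (x - q * x') * f + (y - q * y') * g"
      by (simp add: algebra_simps)
    then show ?thesis
      using * q unfolding I_def by (blast intro: subring_diff[OF P] subring_mult[OF P])
  qed
  have IK: "I \<subseteq> polys K"
    using f gh by (auto simp: I_def intro!: subring_add[OF P] subring_mult[OF P])
  obtain d where d: "d \<in> I" "d \<noteq> 0" "\<And>e. e \<in> I \<Longrightarrow> e \<noteq> 0 \<Longrightarrow> degree d \<le> degree e"
    using If f ex_has_least_nat[of "\<lambda>e. e \<in> I \<and> e \<noteq> 0" f degree] by fastforce
  have dvd: "divides_in (polys K) d e" if e: "e \<in> I" for e
  proof -
    obtain q r where *: "q \<in> polys K" "r \<in> polys K" "e = q * d + r" "r = 0 \<or> degree r < degree d"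
      using polys_division[of e d] e d IK by blast
    have "r = e - q * d"
      using * by simp
    then have "r \<in> I"
      using sub[OF e d(1) *(1)] by simp
    then have "r = 0"
      using d(3)[of r] *(4) by linarith
    then show ?thesis
      using * by (auto simp: divides_in_def mult.commute)
  qed
  obtain q where q: "q \<in> polys K" "f = d * q"
    using dvd[OF If] by (auto simp: divides_in_def)
  have "d \<in> polys K"
    using d(1) IK by blast
  from irr[OF this q] consider "degree d = 0" | "degree q = 0"
    by auto
  then show ?thesis
  proof cases
    case 1
    then obtain c where c: "d = [:c:]" "c \<noteq> 0"
      using d(2) degree0_coeffs[of d] by auto
    have "coeff d 0 \<in> K"
      using d(1) IK unfolding polys_def by blast
    then have "c \<in> K"
      using c by simp
    obtain x y where xy: "x \<in> polys K" "y \<in> polys K" "[:c:] = x * f + y * g"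
      using d(1) c by (auto simp: I_def)
    obtain k where k: "k \<in> polys K" "g * h = f * k"
      using gh by (auto simp: divides_in_def)
    have "smult c h = (x * f + y * g) * h"
      by (simp flip: xy(3))
    also have "\<dots> = x * f * h + y * (g * h)"
      by (simp add: algebra_simps)
    also have "\<dots> = f * (x * h + y * k)"
      unfolding k(2) by (simp add: algebra_simps)
    finally have "smult c h = f * (x * h + y * k)" .
    then have "h = f * smult (inverse c) (x * h + y * k)"
      using c by (metis mult_smult_right smult_smult left_inverse smult_1_left)
    moreover have "smult (inverse c) (x * h + y * k) \<in> polys K"
      using \<open>c \<in> K\<close> inverse_K xy k gh by (intro smult_polys[OF K] subring_add[OF P] subring_mult[OF P])
    ultimately show ?thesis
      unfolding divides_in_def by blast
  next
    case 2
    then obtain c where c: "q = [:c:]" "c \<noteq> 0"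
      using q f degree0_coeffs[of q] by fastforce
    have "coeff q 0 \<in> K"
      using q unfolding polys_def by blast
    then have "c \<in> K"
      using c by simp
    obtain k where k: "k \<in> polys K" "g = d * k"
      using dvd[OF Ig] by (auto simp: divides_in_def)
    have "g = f * smult (inverse c) k"
      using q c k by simp
    moreover have "smult (inverse c) k \<in> polys K"
      using \<open>c \<in> K\<close> inverse_K k by (intro smult_polys[OF K])
    ultimately show ?thesis
      unfolding divides_in_def by blast
  qed
qed

end

text \<open>
  An element that does not split into factors of smaller degree is, up to a constant, primitive
  and irreducible over the field of fractions, hence prime.
\<close>

lemma factorial_polys:
  fixes A :: "'a::field set"
  assumes A: "is_subring A" and K: "is_subring (fractions A)"
    and inverse_K: "\<And>x. x \<in> fractions A \<Longrightarrow> inverse x \<in> fractions A"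
    and fac: "factorial_in A"
  shows "factorial_in (polys A)"
proof -
  let ?P = "polys A" and ?K = "fractions A"
  note P = subring_polys[OF A]
  have AK: "A \<subseteq> ?K"
    using subring_1[OF A] by (auto simp: fractions_def) (metis div_by_1 zero_neq_one)
  note PK = polys_mono[OF AK]
  have denominator: "\<exists>c. c \<in> A \<and> c \<noteq> 0 \<and> smult c f \<in> ?P" if f: "f \<in> polys ?K" for f
  proof -
    have "\<exists>c. c \<in> A \<and> c \<noteq> 0 \<and> (\<forall>i<n. c * coeff f i \<in> A)" for n
    proof (induction n)
      case 0
      then show ?case using subring_1[OF A] by auto
    next
      case (Suc n)
      then obtain c where c: "c \<in> A" "c \<noteq> 0" "\<And>i. i < n \<Longrightarrow> c * coeff f i \<in> A"
        by blast
      obtain a b where ab: "a \<in> A" "b \<in> A" "b \<noteq> 0" "coeff f n = a / b"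
        using f unfolding polys_def fractions_def by blast
      have "c * b * coeff f i \<in> A" if "i < Suc n" for i
      proof (cases "i = n")
        case True
        then show ?thesis
          using ab c subring_mult[OF A] by simp
      next
        case False
        then show ?thesis
          using that c(3)[of i] subring_mult[OF A ab(2)] by (simp add: mult.assoc mult.left_commute[of c])
      qed
      then show ?case
        using c ab subring_mult[OF A] by (intro exI[of _ "c * b"]) auto
    qed
    then obtain c where c: "c \<in> A" "c \<noteq> 0" "\<And>i. i < Suc (degree f) \<Longrightarrow> c * coeff f i \<in> A"
      by blast
    have "c * coeff f i \<in> A" for i
      using c(3)[of i] subring_0[OF A] by (cases "i < Suc (degree f)") (auto simp: coeff_eq_0)
    then show ?thesis
      using c by (auto simp: polys_def)
  qed
  have cancel: "\<exists>a b g' h'. a \<in> A \<and> b \<in> A \<and> a \<noteq> 0 \<and> b \<noteq> 0 \<and> g' \<in> ?P \<and> h' \<in> ?P \<and>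
      g = smult a g' \<and> h = smult b h' \<and> f = g' * h'"
    if "c \<in> A" "c \<noteq> 0" "f \<in> ?P" "f \<noteq> 0" "g \<in> ?P" "h \<in> ?P" "smult c f = g * h" for c f g h
    using gauss_cancel[OF A _ that(1,3-7)] fac that(1,2) unfolding factorial_in_def by blast
  have "\<exists>u ps. factorization ?P f u ps" if "f \<in> ?P" "f \<noteq> 0" for f
    using that
  proof (induction "degree f" arbitrary: f rule: less_induct)
    case less
    show ?case
    proof (cases "degree f = 0")
      case True
      then obtain c where "f = [:c:]"
        using degree0_coeffs by blast
      then have "c \<in> A" "c \<noteq> 0" "f = [:c:]"
        using less.prems by (auto simp: polys_def) (metis coeff_pCons_0)
      then show ?thesis
        using fac factorization_const[OF A] by (metis factorial_in_def)
    next
      case deg: False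
      show ?thesis
      proof (cases "\<exists>g\<in>?P. \<exists>h\<in>?P. f = g * h \<and> degree g > 0 \<and> degree h > 0")
        case True
        then obtain g h where gh: "g \<in> ?P" "h \<in> ?P" "f = g * h" "degree g > 0" "degree h > 0"
          by blast
        then have "g \<noteq> 0" "h \<noteq> 0" "degree g < degree f" "degree h < degree f"
          using less.prems by (auto simp: degree_mult_eq)
        then show ?thesis
          using less.hyps gh factorization_mult[OF P] by metis
      next
        case irr: False
        have lead: "lead_coeff f \<in> A" "lead_coeff f \<noteq> 0"
          using less.prems by (auto simp: polys_def)
        then obtain c g where c: "c \<in> A" "c \<noteq> 0" and g: "g \<in> ?P" "f = smult c g"
          and prim: "\<And>p. prime_in A p \<Longrightarrow> \<not> divides_in ?P [:p:] g"
          using primitive_part[OF A less.prems] fac by (metis factorial_in_def)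
        have g0: "g \<noteq> 0" "degree g > 0"
          using less.prems g c deg by auto
        \<comment> \<open>A factorization over the field of fractions is cleared of denominators and
          then reduced by \<open>cancel\<close> to one in \<open>polys A\<close> with the same
          degrees, where two positive degrees are excluded.\<close>
        have irr': "degree x = 0 \<or> degree y = 0" if xy: "x \<in> polys ?K" "y \<in> polys ?K" "g = x * y" for x y
        proof -
          obtain a b where ab: "a \<in> A" "a \<noteq> 0" "smult a x \<in> ?P" "b \<in> A" "b \<noteq> 0" "smult b y \<in> ?P"
            using denominator xy by meson
          then have "smult (a * b) g = smult a x * smult b y"
            using xy by (simp add: mult.commute)
          then obtain a' b' x' y' where *: "a' \<noteq> 0" "b' \<noteq> 0" "x' \<in> ?P" "y' \<in> ?P"
            "smult a x = smult a' x'" "smult b y = smult b' y'" "g = x' * y'"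
            using cancel[of "a * b" g "smult a x" "smult b y"] ab g g0 subring_mult[OF A] by auto
          then have deg_eq: "degree x = degree x'" "degree y = degree y'"
            using ab by (metis degree_smult_eq)+
          have "f = smult c x' * y'" "degree (smult c x') = degree x'"
            using * g c by auto
          then show ?thesis
            using irr * deg_eq smult_polys[OF A c(1)] by (metis gr0I)
        qed
        have "divides_in ?P g x \<or> divides_in ?P g y"
          if xy: "x \<in> ?P" "y \<in> ?P" "divides_in ?P g (x * y)" for x y
        proof -
          have "divides_in (polys ?K) g (x * y)"
            using xy PK by (auto simp: divides_in_def)
          then have "divides_in (polys ?K) g x \<or> divides_in (polys ?K) g y"
            using irreducible_divides_mult[OF K inverse_K _ g0(2) irr'] g xy PK by blast
          moreover have "divides_in ?P g z" if z: "z \<in> ?P" "divides_in (polys ?K) g z" for z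
          proof (cases "z = 0")
            case True
            then show ?thesis
              using subring_0[OF P] by (auto simp: divides_in_def intro!: bexI[of _ 0])
          next
            case False
            obtain q where q: "q \<in> polys ?K" "z = g * q"
              using z by (auto simp: divides_in_def)
            then obtain d where d: "d \<in> A" "d \<noteq> 0" "smult d q \<in> ?P"
              using denominator by blast
            have "smult d z = g * smult d q"
              using q by simp
            then obtain a g' q' where *: "a \<in> A" "a \<noteq> 0" "g' \<in> ?P" "q' \<in> ?P" "g = smult a g'" "z = g' * q'"
              using cancel[OF d(1,2) z(1) False g(1) d(3)] by blast
            obtain u ps where u: "factorization A a u ps"
              using fac * by (metis factorial_in_def)
            \<comment> \<open>A prime factor of the constant \<open>a\<close> would divide all
              coefficients of the primitive polynomial \<open>g\<close>. Hence \<open>a\<close> is a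
              unit, and \<open>g\<close> divides \<open>z\<close> already with coefficients in
              \<open>A\<close>.\<close>
            have "ps = []"
            proof (cases ps)
              case (Cons p qs)
              then have p: "prime_in A p" "a = p * (u * prod_list qs)" "u * prod_list qs \<in> A"
                using u factorization_mem[OF A, of qs] by (auto simp: factorization_def mult.left_commute intro: subring_mult[OF A])
              then have "g = [:p:] * smult (u * prod_list qs) g'"
                using * by (simp add: mult.commute)
              then show ?thesis
                using prim[OF p(1)] smult_polys[OF A p(3) *(3)] unfolding divides_in_def by blast
            qed simp
            then obtain b where b: "b \<in> A" "1 = a * b"
              using u by (auto simp: factorization_def divides_in_def)
            then have "z = g * smult b q'"
              using * by (simp add: mult.commute)
            then show ?thesis
              using smult_polys[OF A b(1) *(4)] unfolding divides_in_def by blast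
          qed
          ultimately show ?thesis
            using xy by blast
        qed
        moreover have "\<not> divides_in ?P g 1"
          using g0 by (auto simp: divides_in_def) (metis degree_1 degree_mult_eq add_is_0 less_irrefl mult_zero_right zero_neq_one)
        ultimately have "prime_in ?P g"
          using g g0 by (auto simp: prime_in_def)
        moreover obtain u ps where "factorization A c u ps"
          using fac c by (metis factorial_in_def)
        ultimately have "factorization ?P ([:c:] * g) ([:u:] * 1) (map (\<lambda>p. [:p:]) ps @ [g])"
          by (intro factorization_mult[OF P] factorization_prime[OF P] factorization_const[OF A])
        then show ?thesis
          using g by auto
      qed
    qed
  qed
  then show ?thesis
    by (auto simp: factorial_in_def)
qed

section \<open>Localizations of factorial rings at prime elements\<close>

definition principal :: "'a::field set \<Rightarrow> 'a \<Rightarrow> 'a set" where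
  "principal A p = {a \<in> A. divides_in A p a}"

context constants
begin

lemma is_subring_subalgebra: "subalgebra \<iota> A \<Longrightarrow> is_subring A"
  by (auto simp: is_subring_def intro: subalg_1 subalg_diff subalg_mult)

context
  fixes A p assumes A: "subalgebra \<iota> A" and p: "prime_in A p"
begin

lemma prime_ideal_principal: "prime_ideal A (principal A p)"
proof -
  note R = is_subring_subalgebra[OF A]
  have "divides_in A p (a + b)" if "divides_in A p a" "divides_in A p b" for a b
    using that subalg_add[OF A] by (auto simp: divides_in_def) (metis distrib_left)
  moreover have "divides_in A p (a * b)" if "divides_in A p b" "a \<in> A" for a b
    using divides_in_mult[OF R that] by (simp add: mult.commute)
  ultimately show ?thesis
    using p by (auto simp: prime_ideal_def principal_def subalg_0[OF A] subalg_add[OF A] subalg_mult[OF A]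
        prime_in_def divides_in_def[of A p 0] intro: bexI[of _ 0])
qed

text \<open>Splitting the exact power of \<open>p\<close> off the numerator leaves an element
  outside the principal ideal, hence a unit at \<open>p\<close>. Every prime element of a chart ring
  thereby yields a prime divisor.\<close>

lemma uniformizer_principal:
  assumes "factorial_in A"
  shows "uniformizer (localization A (principal A p)) p"
proof -
  note R = is_subring_subalgebra[OF A] and P = prime_ideal_principal
  let ?R = "localization A (principal A p)"
  have pA: "p \<in> A" "p \<noteq> 0" "p \<in> principal A p"
    using p divides_in_refl[OF R] by (auto simp: prime_in_def principal_def)
  have "\<exists>e. \<exists>u\<in>?R - nonunits ?R. f = u * p ^ e" if f: "f \<in> ?R" "f \<noteq> 0" for f
  proof -
    obtain a b where ab: "a \<in> A" "b \<in> A" "b \<notin> principal A p" "b \<noteq> 0" "f = a / b"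
      using f localizationE[OF A P] by metis
    then obtain u ps where "factorization A a u ps"
      using assms f by (auto simp: factorial_in_def)
    then obtain e c where c: "c \<in> A" "a = p ^ e * c" "\<not> divides_in A p c"
      using prime_multiplicity[OF R p] by metis
    then have "c \<notin> principal A p"
      by (simp add: principal_def)
    then have "c / b \<in> ?R - nonunits ?R"
      using nonunit_localization_iff[OF A P c(1) ab(2,3)] localizationI[OF A P c(1) ab(2,3)] by blast
    then show ?thesis
      using ab c by (intro exI[of _ e] bexI[of _ "c / b"]) auto
  qed
  then show ?thesis
    using pA nonunit_localization_iff'[OF A P pA(1)] by (auto simp: uniformizer_def)
qed

end

context
  fixes A assumes A: "subalgebra \<iota> A" and fac: "factorial_in A"
begin

text \<open>Common primes are cancelled until none is left; each cancellation shortens the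
  factorization of the denominator.\<close>

lemma reduced_fraction:
  assumes "a \<in> A" "b \<in> A" "factorization A b u ps"
  shows "\<exists>c d w qs. c \<in> A \<and> d \<in> A \<and> a * d = b * c \<and> factorization A d w qs \<and>
    (\<forall>p. prime_in A p \<longrightarrow> \<not> (divides_in A p c \<and> divides_in A p d))"
  using assms
proof (induction "length ps" arbitrary: a b u ps rule: less_induct)
  case less
  note R = is_subring_subalgebra[OF A]
  show ?case
  proof (cases "\<exists>p. prime_in A p \<and> divides_in A p a \<and> divides_in A p b")
    case True
    then obtain p a' where p: "prime_in A p" "divides_in A p b" and a: "a' \<in> A" "a = p * a'"
      by (auto simp: divides_in_def)
    obtain b' w qs where b: "b' \<in> A" "b = p * b'" "factorization A b' w qs" "length qs < length ps"
      using prime_divides_factorization[OF R p(1) less.prems(3) p(2)] by metis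
    from less.hyps[OF b(4) a(1) b(1,3)] show ?thesis
      using a b by (metis mult.assoc)
  next
    case False
    then show ?thesis
      using less.prems by (metis mult.commute)
  qed
qed

lemma not_mem_localization_principal:
  assumes "c \<in> A" "d \<in> A" "d \<noteq> 0" "prime_in A p" "divides_in A p d" "\<not> divides_in A p c"
  shows "c / d \<notin> localization A (principal A p)"
proof
  note R = is_subring_subalgebra[OF A] and P = prime_ideal_principal[OF A assms(4)]
  assume "c / d \<in> localization A (principal A p)"
  then obtain x z where x: "x \<in> A" "z \<in> A" "z \<notin> principal A p" "z \<noteq> 0" "c / d = x / z"
    using localizationE[OF A P] by metis
  then have "c * z = d * x"
    using assms by (simp add: field_simps)
  then have "divides_in A p (c * z)"
    using divides_in_mult[OF R assms(5) x(1)] by simp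
  then have "divides_in A p z"
    using prime_inD[OF R assms(4,1) x(2)] assms by blast
  then show False
    using x by (simp add: principal_def)
qed

text \<open>In lowest terms every prime factor of the denominator is a pole, since it does not
  divide the numerator. The two criteria for regularity that follow are read off from this
  denominator.\<close>

lemma denominator_prime:
  assumes "f \<in> fractions A"
  obtains c d w ps where "c \<in> A" "d \<in> A" "d \<noteq> 0" "f = c / d" "factorization A d w ps"
    "\<And>p. p \<in> set ps \<Longrightarrow> prime_in A p \<and> f \<notin> localization A (principal A p)"
proof -
  note R = is_subring_subalgebra[OF A]
  obtain a b where ab: "a \<in> A" "b \<in> A" "b \<noteq> 0" "f = a / b"
    using assms unfolding fractions_def by blast
  then obtain u ps where "factorization A b u ps"
    using fac by (auto simp: factorial_in_def)
  from reduced_fraction[OF ab(1,2) this] obtain c d w qs where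
    *: "c \<in> A" "d \<in> A" "a * d = b * c" "factorization A d w qs"
      "\<And>p. prime_in A p \<Longrightarrow> \<not> (divides_in A p c \<and> divides_in A p d)"
    by blast
  have d: "d \<noteq> 0"
    using *(4) by (auto simp: factorization_def divides_in_def prime_in_def prod_list_zero_iff)
  have f: "f = c / d"
    using ab(3) d *(3) unfolding ab(4) by (simp add: field_simps)
  have "prime_in A p \<and> f \<notin> localization A (principal A p)" if pq: "p \<in> set qs" for p
  proof -
    have p: "prime_in A p"
      using pq *(4) by (auto simp: factorization_def)
    obtain xs zs where "qs = xs @ p # zs"
      using split_list[OF pq] by blast
    then have "d = p * (w * prod_list xs * prod_list zs)" "w * prod_list xs * prod_list zs \<in> A"
      using *(4) factorization_mem[OF R, of xs] factorization_mem[OF R, of zs]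
      by (auto simp: factorization_def ac_simps intro!: subalg_mult[OF A])
    then have "divides_in A p d"
      unfolding divides_in_def by blast
    then show ?thesis
      using not_mem_localization_principal[OF *(1,2) d p] *(5) f p by blast
  qed
  then show ?thesis
    using that * d f by blast
qed

text \<open>Algebraic Hartogs principle: without poles in codimension one, the reduced denominator
  has no prime factors and is a unit.\<close>

lemma mem_if_mem_localizations:
  assumes f: "f \<in> fractions A" and loc: "\<And>p. prime_in A p \<Longrightarrow> f \<in> localization A (principal A p)"
  shows "f \<in> A"
proof -
  obtain c d w ps where *: "c \<in> A" "d \<in> A" "d \<noteq> 0" "f = c / d" "factorization A d w ps"
    "\<And>p. p \<in> set ps \<Longrightarrow> prime_in A p \<and> f \<notin> localization A (principal A p)"
    using denominator_prime[OF f] by metis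
  then have "ps = []"
    using loc by (cases ps) auto
  then obtain e where "e \<in> A" "1 = d * e"
    using *(5) by (auto simp: factorization_def divides_in_def)
  then have "f = c * e"
    using *(3) unfolding *(4) by (simp add: field_simps)
  then show ?thesis
    using * \<open>e \<in> A\<close> subalg_mult[OF A] by simp
qed

text \<open>The same principle at a point: a reduced denominator lying in \<open>P\<close> has a
  prime factor in \<open>P\<close>, which would be a pole through that point.\<close>

lemma mem_localization_if_mem_localizations:
  assumes f: "f \<in> fractions A" and P: "prime_ideal A P"
    and loc: "\<And>p. prime_in A p \<Longrightarrow> p \<in> P \<Longrightarrow> f \<in> localization A (principal A p)"
  shows "f \<in> localization A P"
proof (rule ccontr)
  assume nf: "f \<notin> localization A P"
  obtain c d w ps where *: "c \<in> A" "d \<in> A" "d \<noteq> 0" "f = c / d" "factorization A d w ps"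
    "\<And>p. p \<in> set ps \<Longrightarrow> prime_in A p \<and> f \<notin> localization A (principal A p)"
    using denominator_prime[OF f] by metis
  then have d: "d \<in> P"
    using nf localizationI[OF A P] by blast
  have "\<exists>p\<in>set ps. p \<in> P" if "u \<in> A" "u \<notin> P" "\<forall>p\<in>set ps. p \<in> A" "u * prod_list ps \<in> P" for u and ps :: "'a list"
    using that
  proof (induction ps arbitrary: u)
    case (Cons q ps)
    show ?case
    proof (cases "q \<in> P")
      case False
      then have "u * q \<notin> P"
        using Cons.prems prime_idealD(7)[OF A P] by simp
      then show ?thesis
        using Cons.IH[of "u * q"] Cons.prems subalg_mult[OF A] by (auto simp: mult.assoc)
    qed auto
  qed auto
  moreover have "w \<notin> P"
    using *(5) prime_idealD(3)[OF A P] prime_idealD(6)[OF A P] unfolding factorization_def divides_in_def by metis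
  moreover have "w \<in> A" "\<forall>p\<in>set ps. p \<in> A" "w * prod_list ps \<in> P"
    using *(5) d by (auto simp: factorization_def prime_in_def)
  ultimately obtain p where "p \<in> set ps" "p \<in> P"
    by metis
  then show False
    using *(6) loc by blast
qed

lemma principal_subset:
  assumes "prime_ideal A P" "p \<in> P"
  shows "principal A p \<subseteq> P"
  using prime_idealD(6)[OF A assms(1)] assms(2) by (auto simp: principal_def divides_in_def)

lemma localization_principal_superset:
  assumes "prime_ideal A P" "p \<in> P"
  shows "localization A P \<subseteq> localization A (principal A p)"
  using principal_subset[OF assms] by (auto simp: localization_def)

end

end

section \<open>Derivations\<close>

context constants
begin

context
  fixes K D assumes K: "subfield K" and D: "derivation \<iota> K D"
begin

lemma deriv_mem: "x \<in> K \<Longrightarrow> D x \<in> K" and deriv_const: "D (\<iota> c) = 0"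
  and deriv_add: "x \<in> K \<Longrightarrow> z \<in> K \<Longrightarrow> D (x + z) = D x + D z"
  and deriv_mult: "x \<in> K \<Longrightarrow> z \<in> K \<Longrightarrow> D (x * z) = D x * z + x * D z"
  using D by (auto simp: derivation_def)

lemma deriv_0: "D 0 = 0" and deriv_1: "D 1 = 0"
  using deriv_const[of 0] deriv_const[of 1] by auto

lemma deriv_sum: "(\<And>i. i \<in> I \<Longrightarrow> f i \<in> K) \<Longrightarrow> D (sum f I) = (\<Sum>i\<in>I. D (f i))"
  by (induction I rule: infinite_finite_induct)
     (auto simp: deriv_0 deriv_add subalg_sum[OF subfieldD[OF K]])

lemma deriv_const_mult: "x \<in> K \<Longrightarrow> D (\<iota> c * x) = \<iota> c * D x"
  by (simp add: deriv_mult subalg_const[OF subfieldD[OF K]] deriv_const)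

lemma deriv_inverse:
  assumes "x \<in> K" "x \<noteq> 0"
  shows "D (inverse x) = - D x / x\<^sup>2"
proof -
  have "D (x * inverse x) = D x * inverse x + x * D (inverse x)"
    using assms subfield_inverse[OF K] by (intro deriv_mult)
  then have "x * D (inverse x) = - D x / x"
    using assms deriv_1 by (simp add: divide_inverse eq_neg_iff_add_eq_0 add.commute)
  then show ?thesis
    using assms by (simp add: power2_eq_square field_simps)
qed

lemma deriv_divide:
  assumes "x \<in> K" "z \<in> K" "z \<noteq> 0"
  shows "D (x / z) = (D x * z - x * D z) / z\<^sup>2"
  using assms deriv_mult[of x "inverse z"] deriv_inverse[of z] subfield_inverse[OF K]
  by (simp add: divide_inverse power2_eq_square algebra_simps)

lemma deriv_power: "x \<in> K \<Longrightarrow> D (x ^ k) = of_nat k * x ^ (k - 1) * D x"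
proof (induction k)
  case (Suc k)
  then show ?case
    by (cases k) (auto simp: deriv_mult subalg_power[OF subfieldD[OF K]] subalg_mult[OF subfieldD[OF K]] algebra_simps)
qed (simp add: deriv_1)

lemma deriv_localization_closed:
  assumes A: "subalgebra \<iota> A" and P: "prime_ideal A P" and AK: "A \<subseteq> K"
    and DA: "\<And>a. a \<in> A \<Longrightarrow> D a \<in> localization A P" and x: "x \<in> localization A P"
  shows "D x \<in> localization A P"
proof -
  note R = subalgebra_localization[OF A P] and sub = subset_localization[OF A P]
  obtain a b where ab: "a \<in> A" "b \<in> A" "b \<notin> P" "b \<noteq> 0" "x = a / b"
    using x localizationE[OF A P] by metis
  have inv: "1 / b \<in> localization A P"
    using localizationI[OF A P subalg_1[OF A]] ab by blast
  have "D x = (D a * b - a * D b) * (1 / b) * (1 / b)"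
    using ab AK deriv_divide[of a b] by (auto simp: power2_eq_square)
  moreover have "(D a * b - a * D b) * (1 / b) * (1 / b) \<in> localization A P"
    using ab DA inv sub by (intro subalg_mult[OF R] subalg_diff[OF R]) auto
  ultimately show ?thesis
    by simp
qed

lemma deriv_poly:
  assumes "p \<in> polys K" "\<And>i. D (coeff p i) = 0" "x \<in> K"
  shows "D (poly p x) = poly (pderiv p) x * D x"
  using assms(1,2)
proof (induction p)
  case 0
  then show ?case by (simp add: deriv_0)
next
  case (pCons a p)
  have a: "a \<in> K" "D a = 0"
    using pCons.prems(1) pCons.prems(2)[of 0] unfolding polys_def by (auto dest: spec[of _ 0])
  have p: "p \<in> polys K" "\<And>i. D (coeff p i) = 0"
    using pCons.prems(1) pCons.prems(2)[of "Suc _"] unfolding polys_def by (auto dest: spec[of _ "Suc _"])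
  have "poly p x \<in> K"
    using p assms(3) unfolding poly_altdef polys_def
    by (intro subalg_sum[OF subfieldD[OF K]] subalg_mult[OF subfieldD[OF K]] subalg_power[OF subfieldD[OF K]]) auto
  then show ?case
    using a pCons.IH[OF p] assms(3)
    by (simp add: deriv_add deriv_mult subalg_mult[OF subfieldD[OF K]] pderiv_pCons algebra_simps)
qed

end

text \<open>The elements on which two derivations agree form a subfield containing the constants, so
  agreement on generators suffices.\<close>

lemma derivation_eqI:
  assumes D: "derivation \<iota> (fractions (adjoin \<iota> S)) D" and D': "derivation \<iota> (fractions (adjoin \<iota> S)) D'"
    and eq: "\<And>x. x \<in> S \<Longrightarrow> D x = D' x" and x: "x \<in> fractions (adjoin \<iota> S)"
  shows "D x = D' x"
proof -
  let ?K = "fractions (adjoin \<iota> S)"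
  note K = subfield_fractions[OF subalgebra_adjoin]
  note KA = subfieldD[OF K]
  let ?E = "{x \<in> ?K. D x = D' x}"
  have "D (inverse x) = D' (inverse x)" if "x \<in> ?E" for x
    using that deriv_inverse[OF K D] deriv_inverse[OF K D'] deriv_0[OF K D] deriv_0[OF K D'] by (cases "x = 0") auto
  then have E: "subfield ?E"
    by (auto simp: subfield_def subalgebra_def subalg_const[OF KA] subalg_add[OF KA] subalg_mult[OF KA]
        deriv_const[OF K D] deriv_const[OF K D'] deriv_add[OF K D] deriv_add[OF K D']
        deriv_mult[OF K D] deriv_mult[OF K D'] subfield_inverse[OF K])
  have "S \<subseteq> ?E"
    using adjoin_superset subset_fractions[OF subalgebra_adjoin] eq by blast
  then have "?K \<subseteq> ?E"
    by (intro fractions_least adjoin_least E subfieldD[OF E])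
  then show ?thesis
    using x by blast
qed

lemma subfield_UNIV: "subfield UNIV"
  by (auto simp: subfield_def subalgebra_def)

lemma derivation_restrict:
  assumes D: "derivation \<iota> UNIV D" and S: "\<And>x. x \<in> S \<Longrightarrow> D x \<in> fractions (adjoin \<iota> S)"
  shows "derivation \<iota> (fractions (adjoin \<iota> S)) D"
proof -
  let ?K = "fractions (adjoin \<iota> S)"
  note K = subfield_fractions[OF subalgebra_adjoin]
  note KA = subfieldD[OF K] and UD = subfield_UNIV D
  let ?E = "{x \<in> ?K. D x \<in> ?K}"
  have "D (inverse x) \<in> ?K" if "x \<in> ?E" for x
    using that deriv_inverse[OF UD, of x] deriv_0[OF UD] subalg_0[OF KA]
    by (cases "x = 0") (auto intro!: subfield_divide[OF K] subalg_minus[OF KA] subalg_power[OF KA])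
  then have E: "subfield ?E"
    by (auto simp: subfield_def subalgebra_def subalg_const[OF KA] subalg_add[OF KA] subalg_mult[OF KA] subalg_0[OF KA]
        deriv_const[OF UD] deriv_add[OF UD] deriv_mult[OF UD] subfield_inverse[OF K])
  have "S \<subseteq> ?E"
    using adjoin_superset subset_fractions[OF subalgebra_adjoin] S by blast
  then have "?K \<subseteq> ?E"
    by (intro fractions_least adjoin_least E subfieldD[OF E])
  then show ?thesis
    using D by (auto simp: derivation_def)
qed

end

section \<open>Affine charts\<close>

text \<open>The dual derivations stand in for algebraic independence of the \<open>y j\<close>:
  transcendence, factoriality of the chart ring and independence of the monomials are derived from
  them. They live on the whole ambient field and restrict to the subfields generated by the first
  few coordinates.\<close>

locale chart = constants \<iota> for \<iota> :: "complex \<Rightarrow> 'a::field" +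
  fixes n :: nat and y :: "nat \<Rightarrow> 'a" and \<delta> :: "nat \<Rightarrow> 'a \<Rightarrow> 'a"
  assumes derivation_UNIV: "i < n \<Longrightarrow> derivation \<iota> UNIV (\<delta> i)"
    and dual: "i < n \<Longrightarrow> j < n \<Longrightarrow> \<delta> i (y j) = (if i = j then 1 else 0)"
begin

abbreviation A where "A \<equiv> adjoin \<iota> (y ` {..<n})"
abbreviation K where "K \<equiv> fractions A"

lemma A: "subalgebra \<iota> A"
  by (rule subalgebra_adjoin)

lemma K: "subfield K" "subalgebra \<iota> K"
  using subfield_fractions[OF A] subfieldD by auto

lemma A_subset_K: "A \<subseteq> K"
  by (rule subset_fractions[OF A])

lemma y_mem_A: "j < n \<Longrightarrow> y j \<in> A"
  using adjoin_superset[of "y ` {..<n}"] by auto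

lemma y_mem_K: "j < n \<Longrightarrow> y j \<in> K"
  using y_mem_A A_subset_K by auto

lemma y_nonzero: "j < n \<Longrightarrow> y j \<noteq> 0"
  using dual[of j j] deriv_0[OF subfield_UNIV derivation_UNIV] by auto

lemma derivation_K: "i < n \<Longrightarrow> derivation \<iota> K (\<delta> i)"
  using dual subalg_0[OF K(2)] subalg_1[OF K(2)] by (intro derivation_restrict derivation_UNIV) auto

lemma deriv_A: 
  assumes "i < n" "a \<in> A" shows "\<delta> i a \<in> A"
proof -
  note UD = subfield_UNIV derivation_UNIV[OF assms(1)]
  have "subalgebra \<iota> {a \<in> A. \<delta> i a \<in> A}"
    by (auto simp: subalgebra_def subalg_const[OF A] subalg_add[OF A] subalg_mult[OF A] deriv_const[OF UD]
        deriv_add[OF UD] deriv_mult[OF UD] subalg_0[OF A])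
  moreover have "y ` {..<n} \<subseteq> {a \<in> A. \<delta> i a \<in> A}"
    using y_mem_A dual[OF assms(1)] subalg_0[OF A] subalg_1[OF A] by auto
  ultimately show ?thesis
    using adjoin_least assms(2) by blast
qed

abbreviation tower where "tower k \<equiv> adjoin \<iota> (y ` {..<k})"

lemma deriv_tower:
  assumes "k < n" "x \<in> fractions (tower k)"
  shows "\<delta> k x = 0"
proof -
  note UD = subfield_UNIV derivation_UNIV[OF assms(1)]
  have D: "derivation \<iota> (fractions (tower k)) (\<delta> k)"
    using dual assms(1) subalg_0[OF subfieldD[OF subfield_fractions[OF subalgebra_adjoin]]]
    by (intro derivation_restrict UD) auto
  have D': "derivation \<iota> (fractions (tower k)) (\<lambda>x. 0)"
    using subalg_0[OF subfieldD[OF subfield_fractions[OF subalgebra_adjoin]]] by (auto simp: derivation_def)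
  show ?thesis
    using derivation_eqI[OF D D' _ assms(2)] dual assms(1) by fastforce
qed

text \<open>By \<open>deriv_tower\<close> the coefficients are constants for
  \<open>\<delta> k\<close>, so differentiating the relation gives the same relation for the formal
  derivative. That has smaller degree, and in characteristic zero it vanishes only if
  \<open>p\<close> is constant.\<close>

lemma transcendental:
  assumes "k < n" "p \<in> polys (fractions (tower k))" "poly p (y k) = 0"
  shows "p = 0"
  using assms(2,3)
proof (induction "degree p" arbitrary: p rule: less_induct)
  case less
  let ?K = "fractions (tower k)"
  note UD = subfield_UNIV derivation_UNIV[OF assms(1)]
  have K: "subalgebra \<iota> ?K"
    by (intro subfieldD subfield_fractions subalgebra_adjoin)
  have "\<delta> k (poly p (y k)) = poly (pderiv p) (y k) * \<delta> k (y k)"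
    using deriv_tower[OF assms(1)] less.prems by (intro deriv_poly[OF UD]) (auto simp: polys_def)
  then have 0: "poly (pderiv p) (y k) = 0"
    using less.prems dual[OF assms(1) assms(1)] deriv_0[OF UD] by simp
  have deg: "degree p = 0"
  proof (rule ccontr)
    assume "degree p \<noteq> 0"
    then obtain d where d: "degree p = Suc d"
      by (cases "degree p") auto
    have "pderiv p \<in> polys ?K"
      using less.prems by (auto simp: polys_def coeff_pderiv simp del: of_nat_Suc intro!: subalg_mult[OF K] subalg_of_nat[OF K])
    moreover have "degree (pderiv p) < degree p"
      using d degree_le[of d "pderiv p"] by (auto simp: coeff_pderiv coeff_eq_0)
    ultimately have "pderiv p = 0"
      using less.hyps 0 by blast
    then have "coeff (pderiv p) d = 0"
      by simp
    then have "coeff p (Suc d) = 0"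
      using of_nat_field_eq_0_iff[of "Suc d"] by (auto simp: coeff_pderiv simp del: of_nat_Suc)
    then show False
      using d by (metis leading_coeff_0_iff degree_0 nat.distinct(1))
  qed
  then obtain c where "p = [:c:]"
    using degree0_coeffs by blast
  then show ?case
    using less.prems by simp
qed

lemma tower_Suc: "tower (Suc k) = (\<lambda>p. poly p (y k)) ` polys (tower k)"
proof
  let ?P = "(\<lambda>p. poly p (y k)) ` polys (tower k)"
  note T = subalgebra_adjoin[of "y ` {..<k}"] and T' = subalgebra_adjoin[of "y ` {..<Suc k}"]
  note R = is_subring_subalgebra[OF T]
  note P = subring_polys[OF R]
  have const: "c \<in> ?P" if "c \<in> tower k" for c
    using const_polys[OF R that] by (force intro: image_eqI[of _ _ "[:c:]"])
  have "subalgebra \<iota> ?P"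
    using const subalg_const[OF T] subring_add[OF P] subring_mult[OF P]
    by (auto simp: subalgebra_def simp flip: poly_add poly_mult)
  moreover have "y k \<in> ?P"
    using subalg_0[OF T] subalg_1[OF T]
    by (intro image_eqI[of _ _ "[:0, 1:]"]) (auto simp: polys_def coeff_pCons split: nat.split)
  moreover have "y ` {..<k} \<subseteq> ?P"
    by (rule subsetI) (rule const, rule subsetD[OF adjoin_superset])
  ultimately show "tower (Suc k) \<subseteq> ?P"
    unfolding lessThan_Suc image_insert by (intro adjoin_least insert_subsetI)
  have "tower k \<subseteq> tower (Suc k)"
    by (intro adjoin_mono) auto
  moreover have "y k \<in> tower (Suc k)"
    using adjoin_superset[of "y ` {..<Suc k}"] by auto
  ultimately show "?P \<subseteq> tower (Suc k)"
    unfolding poly_altdef polys_def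
    by (auto intro!: subalg_sum[OF T'] subalg_mult[OF T'] subalg_power[OF T'])
qed

text \<open>Gauss's theorem along the tower: evaluation at the transcendental element
  \<open>y k\<close> identifies the polynomials over one ring with the next ring. The tower starts
  with the constants, where every nonzero element is a unit.\<close>

lemma factorial_tower: "k \<le> n \<Longrightarrow> factorial_in (tower k)"
proof (induction k)
  case 0
  have "adjoin \<iota> {} = range \<iota>"
  proof
    have "subalgebra \<iota> (range \<iota>)"
      by (auto simp: subalgebra_def simp flip: const_add const_mult)
    then show "adjoin \<iota> {} \<subseteq> range \<iota>"
      by (intro adjoin_least) auto
  qed (auto intro: subalg_const[OF subalgebra_adjoin])
  moreover have "factorization (range \<iota>) (\<iota> c) (\<iota> c) []" if "\<iota> c \<noteq> 0" for c
    using that const_inverse[of c] by (auto simp: factorization_def divides_in_def intro!: exI[of _ "inverse c"])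
  ultimately show ?case
    by (auto simp: factorial_in_def intro!: exI[of _ "[]"] exI[of _ "\<iota> _"])
next
  case (Suc k)
  note T = subalgebra_adjoin[of "y ` {..<k}"]
  note R = is_subring_subalgebra[OF T]
  note F = subfield_fractions[OF T]
  have "factorial_in (polys (tower k))"
    using Suc by (intro factorial_polys[OF R is_subring_subalgebra[OF subfieldD[OF F]] subfield_inverse[OF F]]) auto
  moreover have "inj_on (\<lambda>p. poly p (y k)) (polys (tower k))"
  proof (rule inj_onI)
    fix p q assume "p \<in> polys (tower k)" "q \<in> polys (tower k)" "poly p (y k) = poly q (y k)"
    then have "p - q \<in> polys (tower k)" "poly (p - q) (y k) = 0"
      using subring_diff[OF subring_polys[OF R]] by auto
    then show "p = q"
      using transcendental[of k "p - q"] Suc.prems polys_mono[OF subset_fractions[OF T]] by auto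
  qed
  ultimately show ?case
    unfolding tower_Suc by (intro factorial_image[OF subring_polys[OF R]]) auto
qed

lemma factorial_A: "factorial_in A"
  by (rule factorial_tower) simp

text \<open>An inverse of the last coordinate would be a polynomial p in it, making the coordinate a
  root of X p - 1. This later provides a prime factor of the coordinate, and with it a prime
  divisor.\<close>

lemma y_not_unit:
  assumes "0 < n" shows "inverse (y (n - 1)) \<notin> A"
proof
  define k where "k = n - 1"
  have n: "n = Suc k"
    using assms by (simp add: k_def)
  note T = subalgebra_adjoin[of "y ` {..<k}"]
  note R = is_subring_subalgebra[OF T]
  assume "inverse (y (n - 1)) \<in> A"
  then obtain p where p: "p \<in> polys (tower k)" "inverse (y k) = poly p (y k)"
    using tower_Suc[of k] by (auto simp: n)
  have "poly (pCons (- 1) p) (y k) = 0"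
    using p(2) y_nonzero[of k] by (simp flip: p(2) add: n)
  moreover have "pCons (- 1) p \<in> polys (fractions (tower k))"
    using polys_mono[OF subset_fractions[OF T]] p(1) subset_fractions[OF T] subalg_minus[OF T subalg_1[OF T]]
    by (auto simp: polys_def coeff_pCons split: nat.split)
  ultimately show False
    using transcendental[of k "pCons (- 1) p"] by (simp add: n)
qed

end

section \<open>Determinants and lattices\<close>

text \<open>A permutation with nonzero Leibniz product can only lower the weight of an index,
  strictly if the index moves; since the total weight is invariant, nothing moves. Using a weight
  instead of the order of the indices spares sorting the rows when they are enumerated
  multi-indices.\<close>

lemma det_triangular_weight:
  fixes f :: "nat \<times> nat \<Rightarrow> 'a::comm_ring_1" and w :: "nat \<Rightarrow> int"
  assumes tri: "\<And>i j. i < n \<Longrightarrow> j < n \<Longrightarrow> f (i, j) \<noteq> 0 \<Longrightarrow> i = j \<or> w j < w i"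
  shows "det (mat n n f) = (\<Prod>i<n. f (i, i))"
proof -
  have zero: "(\<Prod>i = 0..<n. f (i, p i)) = 0" if p: "p permutes {0..<n}" "p \<noteq> id" for p
  proof (rule ccontr)
    assume nz: "(\<Prod>i = 0..<n. f (i, p i)) \<noteq> 0"
    have step: "p i = i \<or> w (p i) < w i" if "i < n" for i
    proof -
      have "f (i, p i) \<noteq> 0"
      proof
        assume "f (i, p i) = 0"
        then have "(\<Prod>i = 0..<n. f (i, p i)) = 0"
          using that by (subst prod.remove[of _ i]) auto
        then show False
          using nz by simp
      qed
      then show ?thesis
        using tri[of i "p i"] that permutes_in_image[OF p(1), of i] by auto
    qed
    obtain i where i: "p i \<noteq> i"
      using p(2) by (auto simp: fun_eq_iff)
    then have "i < n"
      using permutes_not_in[OF p(1), of i] by auto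
    then have "(\<Sum>i = 0..<n. w (p i)) < (\<Sum>i = 0..<n. w i)"
      using step i by (intro sum_strict_mono_ex1) force+
    moreover have "(\<Sum>i = 0..<n. w (p i)) = (\<Sum>i = 0..<n. w i)"
      using sum.permute[OF p(1), of w] by (simp add: o_def)
    ultimately show False
      by simp
  qed
  have "det (mat n n f) = (\<Sum>p\<in>{p. p permutes {0..<n}}. signof p * (\<Prod>i = 0..<n. f (i, p i)))"
    by (subst det_def'[of _ n]) (auto intro!: sum.cong prod.cong simp: permutes_in_image)
  also have "\<dots> = (\<Sum>p\<in>{id}. signof p * (\<Prod>i = 0..<n. f (i, p i)))"
    using zero by (intro sum.mono_neutral_right) (auto simp: finite_permutations permutes_id)
  finally show ?thesis
    by (simp add: atLeast0LessThan)
qed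

lemma det_mat_mult:
  fixes f g :: "nat \<times> nat \<Rightarrow> 'a::comm_ring_1"
  shows "det (mat n n (\<lambda>(i, j). \<Sum>k<n. f (i, k) * g (k, j))) = det (mat n n f) * det (mat n n g)"
proof -
  have "mat n n (\<lambda>(i, j). \<Sum>k<n. f (i, k) * g (k, j)) = mat n n f * mat n n g"
    by (rule eq_matI) (auto simp: scalar_prod_def atLeast0LessThan)
  then show ?thesis
    by (simp add: det_mult[of _ n])
qed

lemma det_mat_transpose:
  fixes f :: "nat \<times> nat \<Rightarrow> 'a::comm_ring_1"
  shows "det (mat n n (\<lambda>(i, j). f (j, i))) = det (mat n n f)"
proof -
  have "mat n n (\<lambda>(i, j). f (j, i)) = transpose_mat (mat n n f)"
    by (rule eq_matI) auto
  then show ?thesis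
    by (simp add: det_transpose[of _ n])
qed

text \<open>Row operations with the pivot \<open>N n n\<close> leave a Schur complement. They are
  encoded as left multiplication by \<open>E\<close>, which is triangular with unit diagonal once
  index \<open>n\<close> is given the lowest weight.\<close>

lemma det_clear_last_column:
  fixes N :: "nat \<Rightarrow> nat \<Rightarrow> 'a::field"
  assumes nz: "N n n \<noteq> 0"
  shows "det (mat (Suc n) (Suc n) (\<lambda>(i, j). N i j)) =
    N n n * det (mat n n (\<lambda>(i, j). N i j - N i n / N n n * N n j))"
proof -
  define E where "E = (\<lambda>(i, k). if i = k then 1 else if k = n then - N i n / N n n else 0)"
  define Q where "Q = (\<lambda>(i, j). if i = n then N n j else N i j - N i n / N n n * N n j)"
  have "det (mat (Suc n) (Suc n) E) = (\<Prod>i<Suc n. E (i, i))"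
    by (rule det_triangular_weight[where w = "\<lambda>i. if i = n then 0 else 1"]) (auto simp: E_def split: if_splits)
  then have detE: "det (mat (Suc n) (Suc n) E) = 1"
    by (simp add: E_def)
  have "(\<Sum>k<Suc n. E (i, k) * N k j) = Q (i, j)" if "i < Suc n" for i j
  proof (cases "i = n")
    case True
    then have "(\<Sum>k<Suc n. E (i, k) * N k j) = (\<Sum>k<Suc n. if k = i then N k j else 0)"
      by (intro sum.cong) (auto simp: E_def)
    then show ?thesis
      using True by (simp add: Q_def)
  next
    case False
    then have "(\<Sum>k<n. E (i, k) * N k j) = (\<Sum>k<n. if k = i then N k j else 0)"
      by (intro sum.cong) (auto simp: E_def)
    then show ?thesis
      using False that by (simp add: Q_def E_def)
  qed
  then have "mat (Suc n) (Suc n) (\<lambda>(i, j). \<Sum>k<Suc n. E (i, k) * (\<lambda>(i, j). N i j) (k, j)) = mat (Suc n) (Suc n) Q"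
    by (intro eq_matI) auto
  then have "det (mat (Suc n) (Suc n) (\<lambda>(i, j). N i j)) = det (mat (Suc n) (Suc n) Q)"
    using det_mat_mult[of "Suc n" E "\<lambda>(i, j). N i j"] detE by simp
  also have "\<dots> = (\<Sum>i<Suc n. mat (Suc n) (Suc n) Q $$ (i, n) * cofactor (mat (Suc n) (Suc n) Q) i n)"
    by (rule laplace_expansion_column) auto
  also have "\<dots> = (\<Sum>i\<in>{n}. mat (Suc n) (Suc n) Q $$ (i, n) * cofactor (mat (Suc n) (Suc n) Q) i n)"
    using nz by (intro sum.mono_neutral_right) (auto simp: Q_def)
  also have "\<dots> = N n n * det (mat_delete (mat (Suc n) (Suc n) Q) n n)"
    by (simp add: Q_def cofactor_def)
  also have "mat_delete (mat (Suc n) (Suc n) Q) n n = mat n n (\<lambda>(i, j). N i j - N i n / N n n * N n j)"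
    by (intro eq_matI) (auto simp: mat_delete_def Q_def)
  finally show ?thesis .
qed

text \<open>Hermite normal form over a discrete valuation ring. The lattice \<open>\<Lambda>\<close>
  is known only by closure under adding \<open>R\<close>-multiples, which is all that elimination
  uses. The last conclusion says that the orders of the pivots add up to at most the order of the
  determinant of \<open>M\<close>.\<close>

lemma (in dvr) lattice_triangular:
  assumes "\<And>i. i < n \<Longrightarrow> M i \<in> \<Lambda>" and "det (mat n n (\<lambda>(i, j). M i j)) \<noteq> 0"
    and "\<And>x z c. x \<in> \<Lambda> \<Longrightarrow> z \<in> \<Lambda> \<Longrightarrow> c \<in> R \<Longrightarrow> (\<lambda>i. x i + c * z i) \<in> \<Lambda>"
    and "\<And>x i. x \<in> \<Lambda> \<Longrightarrow> i < n \<Longrightarrow> x i \<in> K"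
  shows "\<exists>T. (\<forall>j<n. T j \<in> \<Lambda> \<and> T j j \<noteq> 0 \<and> (\<forall>i<n. j < i \<longrightarrow> T j i = 0)) \<and>
    det (mat n n (\<lambda>(i, j). M i j)) / (\<Prod>j<n. T j j) \<in> R"
  using assms
proof (induction n arbitrary: M \<Lambda>)
  case 0
  then show ?case
    using subalg_1[OF ring] by (auto simp: det_dim_zero[of "mat 0 0 _"])
next
  case (Suc n)
  note M = Suc.prems(1) and nz = Suc.prems(2) and lin = Suc.prems(3) and inK = Suc.prems(4)
  let ?S = "{i. i < Suc n \<and> M i n \<noteq> 0}"
  have "?S \<noteq> {}"
  proof
    assume "?S = {}"
    then have "det (mat (Suc n) (Suc n) (\<lambda>(i, j). M i j)) = 0"
      by (subst laplace_expansion_column[of _ "Suc n" n]) (auto intro!: sum.neutral)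
    then show False
      using nz by simp
  qed
  moreover have "finite ?S"
    by simp
  \<comment> \<open>A pivot of least order in the last column divides the rest of that column inside
    \<open>R\<close>, so clearing the column stays in the lattice. The induction continues in the
    sublattice with vanishing last coordinate.\<close>
  ultimately obtain i0 where "i0 \<in> ?S" and min0: "\<not> (\<exists>i\<in>?S. ord R (M i n) < ord R (M i0 n))"
    using arg_min_if_finite[of ?S "\<lambda>i. ord R (M i n)"] by blast
  then have i0: "i0 < Suc n" "M i0 n \<noteq> 0"
    by auto
  have min: "ord R (M i0 n) \<le> ord R (M i n)" if "i < Suc n" "M i n \<noteq> 0" for i
  proof (rule ccontr)
    assume "\<not> ord R (M i0 n) \<le> ord R (M i n)"
    then have "\<exists>i\<in>?S. ord R (M i n) < ord R (M i0 n)"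
      using that by (intro bexI[of _ i]) auto
    then show False
      using min0 by contradiction
  qed
  have ratio: "M i n / M i0 n \<in> R" if "i < Suc n" for i
  proof (cases "M i n = 0")
    case False
    have "M i n \<in> K" "M i0 n \<in> K"
      using inK M that i0 by auto
    then show ?thesis
      using mem_iff_ord[of "M i n / M i0 n"] ord_divide min[OF that False] False i0
        subfield_divide[OF K(1)] by auto
  qed (use subalg_0[OF ring] in auto)
  define p where "p = Transposition.transpose i0 n"
  have p: "p permutes {0..<Suc n}" "p n = i0" and pn: "\<And>i. i < Suc n \<Longrightarrow> p i < Suc n"
    using i0 by (auto simp: p_def Transposition.transpose_def intro: permutes_swap_id)
  define N where "N = (\<lambda>i. M (p i))"
  define M' where "M' = (\<lambda>i j. N i j - N i n / N n n * N n j)"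
  let ?L = "{x \<in> \<Lambda>. x n = 0}"
  have N: "N i \<in> \<Lambda>" "N i n / N n n \<in> R" if "i < Suc n" for i
    using M pn[OF that] ratio p by (auto simp: N_def)
  have Nn: "N n n \<noteq> 0"
    using i0 p by (simp add: N_def)
  have "det (mat (Suc n) (Suc n) (\<lambda>(i, j). N i j)) =
      det (mat (Suc n) (Suc n) (\<lambda>(i, j). mat (Suc n) (Suc n) (\<lambda>(i, j). M i j) $$ (p i, j)))"
    using pn by (intro arg_cong[of _ _ det] eq_matI) (auto simp: N_def)
  also have "\<dots> = signof p * det (mat (Suc n) (Suc n) (\<lambda>(i, j). M i j))"
    by (rule det_permute_rows[OF _ p(1)]) auto
  finally have "signof p * det (mat (Suc n) (Suc n) (\<lambda>(i, j). M i j)) = N n n * det (mat n n (\<lambda>(i, j). M' i j))"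
    using det_clear_last_column[of N n, OF Nn] by (simp add: M'_def)
  moreover have "x = signof p * z" if "signof p * x = z" for x z :: 'a
    using that by (auto simp: sign_def split: if_splits)
  ultimately have detM: "det (mat (Suc n) (Suc n) (\<lambda>(i, j). M i j)) = signof p * (N n n * det (mat n n (\<lambda>(i, j). M' i j)))"
    by blast
  have M': "M' i \<in> ?L" if "i < n" for i
  proof -
    have "(\<lambda>j. N i j + (- (N i n / N n n)) * N n j) \<in> \<Lambda>"
      using N[of i] N[of n] that by (intro lin subalg_minus[OF ring]) auto
    then show ?thesis
      using Nn by (simp add: M'_def)
  qed
  have nz': "det (mat n n (\<lambda>(i, j). M' i j)) \<noteq> 0"
    using nz detM by auto
  have "\<exists>T. (\<forall>j<n. T j \<in> ?L \<and> T j j \<noteq> 0 \<and> (\<forall>i<n. j < i \<longrightarrow> T j i = 0)) \<and>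
      det (mat n n (\<lambda>(i, j). M' i j)) / (\<Prod>j<n. T j j) \<in> R"
  proof (rule Suc.IH[OF M' nz'])
    show "(\<lambda>i. x i + c * z i) \<in> ?L" if "x \<in> ?L" "z \<in> ?L" "c \<in> R" for x z c
      using that lin by simp
  qed (use inK in auto)
  then obtain T where T: "\<And>j. j < n \<Longrightarrow> T j \<in> ?L \<and> T j j \<noteq> 0 \<and> (\<forall>i<n. j < i \<longrightarrow> T j i = 0)"
    and detT: "det (mat n n (\<lambda>(i, j). M' i j)) / (\<Prod>j<n. T j j) \<in> R"
    by blast
  define T' where "T' = T(n := N n)"
  have T': "T' j \<in> \<Lambda> \<and> T' j j \<noteq> 0 \<and> (\<forall>i<Suc n. j < i \<longrightarrow> T' j i = 0)" if "j < Suc n" for j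
  proof (cases "j = n")
    case False
    then have "T j \<in> ?L \<and> T j j \<noteq> 0 \<and> (\<forall>i<n. j < i \<longrightarrow> T j i = 0)"
      using T that by simp
    then show ?thesis
      using False by (simp add: T'_def less_Suc_eq)
  qed (use N(1)[of n] Nn in \<open>simp add: T'_def\<close>)
  have "(\<Prod>j<Suc n. T' j j) = N n n * (\<Prod>j<n. T j j)"
    by (simp add: T'_def)
  then have "det (mat (Suc n) (Suc n) (\<lambda>(i, j). M i j)) / (\<Prod>j<Suc n. T' j j) =
      signof p * (det (mat n n (\<lambda>(i, j). M' i j)) / (\<Prod>j<n. T j j))"
    using Nn by (simp add: detM)
  then have "det (mat (Suc n) (Suc n) (\<lambda>(i, j). M i j)) / (\<Prod>j<Suc n. T' j j) \<in> R"
    using subalg_mult[OF ring subalg_signof[OF ring] detT] by simp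
  then show ?case
    using T' by blast
qed

section \<open>Differential forms on a chart\<close>

context chart
begin

lemma frames_iff: "\<theta> \<in> frames \<iota> K n \<longleftrightarrow> (\<forall>j<n. derivation \<iota> K (\<theta> j))"
  by (simp add: frames_def)

lemma coordinate_frame: "\<delta> \<in> frames \<iota> K n"
  using derivation_K by (simp add: frames_iff)

text \<open>The vector field with coefficients \<open>c\<close>. By
  \<open>derivation_expansion\<close> every derivation of \<open>K\<close> has this form, with its
  values at the coordinates as coefficients.\<close>

definition apply_field :: "(nat \<Rightarrow> 'a) \<Rightarrow> 'a \<Rightarrow> 'a" where
  "apply_field c f = (\<Sum>l<n. c l * \<delta> l f)"

lemma derivation_apply_field:
  assumes "\<And>l. l < n \<Longrightarrow> c l \<in> K"
  shows "derivation \<iota> K (apply_field c)"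
  unfolding derivation_def
proof (intro conjI ballI allI)
  show "apply_field c x \<in> K" if "x \<in> K" for x
    using assms that deriv_mem[OF K(1) derivation_K]
    by (auto simp: apply_field_def intro!: subalg_sum[OF K(2)] subalg_mult[OF K(2)])
  show "apply_field c (\<iota> x) = 0" for x
    by (simp add: apply_field_def deriv_const[OF K(1) derivation_K])
  fix x z assume xz: "x \<in> K" "z \<in> K"
  have "apply_field c (x + z) = (\<Sum>l<n. c l * \<delta> l x + c l * \<delta> l z)"
    unfolding apply_field_def using xz
    by (intro sum.cong) (auto simp: deriv_add[OF K(1) derivation_K] distrib_left)
  then show "apply_field c (x + z) = apply_field c x + apply_field c z"
    by (simp add: apply_field_def sum.distrib)
  have "apply_field c (x * z) = (\<Sum>l<n. c l * \<delta> l x * z + x * (c l * \<delta> l z))"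
    unfolding apply_field_def using xz
    by (intro sum.cong) (auto simp: deriv_mult[OF K(1) derivation_K] algebra_simps)
  then show "apply_field c (x * z) = apply_field c x * z + x * apply_field c z"
    by (simp add: apply_field_def sum.distrib sum_distrib_left sum_distrib_right)
qed

lemma apply_field_y: "j < n \<Longrightarrow> apply_field c (y j) = c j"
  using dual by (simp add: apply_field_def if_distrib[of "(*) _"] cong: if_cong)

lemma derivation_expansion:
  assumes "derivation \<iota> K D" "f \<in> K"
  shows "D f = apply_field (\<lambda>l. D (y l)) f"
proof -
  have D': "derivation \<iota> K (apply_field (\<lambda>l. D (y l)))"
    by (rule derivation_apply_field) (simp add: deriv_mem[OF K(1) assms(1)] y_mem_K)
  show ?thesis
    by (rule derivation_eqI[OF assms(1) D' _ assms(2)]) (auto simp: apply_field_y)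
qed

lemma wedge_coordinate: "wedge n y \<delta> = 1"
proof -
  have "det (mat n n (\<lambda>(i, j). \<delta> j (y i))) = (\<Prod>i<n. (\<lambda>(i, j). \<delta> j (y i)) (i, i))"
    using dual by (intro det_triangular_weight[where w = "\<lambda>_. 0"]) (auto split: if_splits)
  then show ?thesis
    using dual by (simp add: wedge_def)
qed

text \<open>Expanding the derivations in the coordinate frame factors the matrix, and the
  determinant is multiplicative. Hence a top form is determined by its value on
  \<open>\<delta>\<close>.\<close>

lemma wedge_chain_rule:
  assumes "\<theta> \<in> frames \<iota> K n" "\<And>i. i < n \<Longrightarrow> x i \<in> K"
  shows "wedge n x \<theta> = wedge n x \<delta> * wedge n y \<theta>"
proof -
  have "wedge n x \<theta> = det (mat n n (\<lambda>(i, j). \<Sum>l<n. (\<lambda>(i, j). \<delta> j (x i)) (i, l) * (\<lambda>(i, j). \<theta> j (y i)) (l, j)))"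
    unfolding wedge_def using assms
    by (intro arg_cong[of _ _ det] eq_matI)
       (auto simp: frames_iff derivation_expansion[of "\<theta> _" "x _"] apply_field_def mult.commute)
  then show ?thesis
    unfolding det_mat_mult by (simp add: wedge_def)
qed

lemma nonzero_top_formE:
  assumes "nonzero_top_form \<iota> n K \<omega>"
  shows "\<omega> \<delta> \<in> K" "\<omega> \<delta> \<noteq> 0" "\<And>\<theta>. \<theta> \<in> frames \<iota> K n \<Longrightarrow> \<omega> \<theta> = \<omega> \<delta> * wedge n y \<theta>"
proof -
  obtain f x where f: "f \<in> K" and x: "\<And>i. i < n \<Longrightarrow> x i \<in> K"
    and \<omega>: "\<And>\<theta>. \<theta> \<in> frames \<iota> K n \<Longrightarrow> \<omega> \<theta> = f * wedge n x \<theta>"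
    using assms by (auto simp: nonzero_top_form_def)
  have "\<omega> \<delta> = f * wedge n x \<delta>"
    using \<omega> coordinate_frame by simp
  moreover have "wedge n x \<delta> \<in> K"
    unfolding wedge_def using x deriv_mem[OF K(1) derivation_K] by (intro subalg_det[OF K(2)]) auto
  ultimately show "\<omega> \<delta> \<in> K"
    using f subalg_mult[OF K(2)] by simp
  show *: "\<omega> \<theta> = \<omega> \<delta> * wedge n y \<theta>" if "\<theta> \<in> frames \<iota> K n" for \<theta>
    using \<omega>[OF that] \<open>\<omega> \<delta> = f * wedge n x \<delta>\<close> wedge_chain_rule[OF that x] by simp
  show "\<omega> \<delta> \<noteq> 0"
    using assms * by (auto simp: nonzero_top_form_def)
qed

lemma nonzero_top_form_coordinate: "nonzero_top_form \<iota> n K (wedge n y)"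
  unfolding nonzero_top_form_def
proof (intro conjI)
  show "\<exists>f\<in>K. \<exists>x. (\<forall>i<n. x i \<in> K) \<and> (\<forall>\<theta>\<in>frames \<iota> K n. wedge n y \<theta> = f * wedge n x \<theta>)"
    using subalg_1[OF K(2)] y_mem_K by (intro bexI[of _ 1] exI[of _ y]) auto
  show "\<exists>\<theta>\<in>frames \<iota> K n. wedge n y \<theta> \<noteq> 0"
    using coordinate_frame wedge_coordinate by (intro bexI[of _ \<delta>]) auto
qed

end

text \<open>The valuation ring of a divisor whose centre lies in the chart: the coordinate functions
  are regular along it.\<close>

locale chart_dvr = chart \<iota> n y \<delta> + V: dvr \<iota> R t
  for \<iota> :: "complex \<Rightarrow> 'a::field" and n y \<delta> and R t +
  assumes fractions_R: "fractions R = K" and y_mem_R: "j < n \<Longrightarrow> y j \<in> R"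
begin

lemma R_subset_K: "R \<subseteq> K"
  using V.R_subset_K fractions_R by simp

lemma wedge_chain_rule_R:
  assumes "\<theta> \<in> frames \<iota> K n" "\<And>i. i < n \<Longrightarrow> x i \<in> R"
  shows "wedge n x \<theta> = wedge n x \<delta> * wedge n y \<theta>"
  using assms R_subset_K by (intro wedge_chain_rule) auto

abbreviation jacobian where "jacobian r \<equiv> wedge n r \<delta>"

text \<open>Evaluation on the coordinate frame turns a condition on forms into one on Jacobians: the
  Jacobian of a generator is nonzero and divides all others in \<open>R\<close>. The converse is
  \<open>canonical_generatorI\<close>.\<close>

lemma canonical_generatorD:
  assumes "canonical_generator \<iota> n R r"
  shows "\<And>i. i < n \<Longrightarrow> r i \<in> R" "jacobian r \<in> K" "jacobian r \<noteq> 0"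
    "\<And>s. (\<And>i. i < n \<Longrightarrow> s i \<in> R) \<Longrightarrow> jacobian s / jacobian r \<in> R"
proof -
  show r: "r i \<in> R" if "i < n" for i
    using assms that by (simp add: canonical_generator_def)
  then show "jacobian r \<in> K"
    unfolding wedge_def using deriv_mem[OF K(1) derivation_K] R_subset_K by (intro subalg_det[OF K(2)]) auto
  obtain \<theta> where "\<theta> \<in> frames \<iota> K n" "wedge n r \<theta> \<noteq> 0"
    using assms by (auto simp: canonical_generator_def fractions_R)
  then show nz: "jacobian r \<noteq> 0"
    using wedge_chain_rule_R[of \<theta> r] r by auto
  show "jacobian s / jacobian r \<in> R" if s: "\<And>i. i < n \<Longrightarrow> s i \<in> R" for s
  proof -
    have "\<forall>s. (\<forall>i<n. s i \<in> R) \<longrightarrow> (\<exists>a\<in>R. \<forall>\<theta>\<in>frames \<iota> K n. wedge n s \<theta> = a * wedge n r \<theta>)"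
      using assms by (simp add: canonical_generator_def fractions_R)
    then obtain a where a: "a \<in> R" "\<forall>\<theta>\<in>frames \<iota> K n. wedge n s \<theta> = a * wedge n r \<theta>"
      using s by blast
    then have "jacobian s = a * jacobian r"
      using coordinate_frame by simp
    with a(1) show ?thesis
      using nz by simp
  qed
qed

lemma canonical_generatorI:
  assumes r: "\<And>i. i < n \<Longrightarrow> r i \<in> R" and nz: "jacobian r \<noteq> 0"
    and gen: "\<And>s. (\<And>i. i < n \<Longrightarrow> s i \<in> R) \<Longrightarrow> jacobian s / jacobian r \<in> R"
  shows "canonical_generator \<iota> n R r"
  unfolding canonical_generator_def fractions_R
proof (intro conjI allI impI bexI[of _ \<delta>])
  fix s assume s: "\<forall>i<n. s i \<in> R"
  have "wedge n s \<theta> = jacobian s / jacobian r * wedge n r \<theta>" if "\<theta> \<in> frames \<iota> K n" for \<theta>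
    using wedge_chain_rule_R[OF that, of s] wedge_chain_rule_R[OF that, of r] s r nz by simp
  then show "\<exists>a\<in>R. \<forall>\<theta>\<in>frames \<iota> K n. wedge n s \<theta> = a * wedge n r \<theta>"
    using gen s by blast
qed (use r nz coordinate_frame in auto)

text \<open>The Jacobians of two generators divide each other in \<open>R\<close> and thus have
  equal order, which makes the definite description in \<open>ord_form\<close> well defined.\<close>

lemma ord_form_eq:
  assumes r: "canonical_generator \<iota> n R r" and \<omega>: "nonzero_top_form \<iota> n K \<omega>"
  shows "ord_form \<iota> n R \<omega> = ord R (\<omega> \<delta>) - ord R (jacobian r)"
  unfolding ord_form_def fractions_R
proof (rule the_equality)
  note \<omega>' = nonzero_top_formE[OF \<omega>]
  have "\<omega> \<theta> = \<omega> \<delta> / jacobian r * wedge n r \<theta>" if "\<theta> \<in> frames \<iota> K n" for \<theta>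
    using \<omega>'(3)[OF that] wedge_chain_rule_R[OF that, of r] canonical_generatorD[OF r] by simp
  moreover have "\<omega> \<delta> / jacobian r \<in> K"
    using \<omega>' canonical_generatorD[OF r] subfield_divide[OF K(1)] by simp
  moreover have "ord R (\<omega> \<delta>) - ord R (jacobian r) = ord R (\<omega> \<delta> / jacobian r)"
    using V.ord_divide[of "\<omega> \<delta>" "jacobian r"] \<omega>' canonical_generatorD[OF r] fractions_R by simp
  ultimately show "\<exists>s. \<exists>f\<in>K. canonical_generator \<iota> n R s \<and> (\<forall>\<theta>\<in>frames \<iota> K n. \<omega> \<theta> = f * wedge n s \<theta>) \<and>
      ord R (\<omega> \<delta>) - ord R (jacobian r) = ord R f"
    using r by blast
  fix e assume "\<exists>r. \<exists>f\<in>K. canonical_generator \<iota> n R r \<and> (\<forall>\<theta>\<in>frames \<iota> K n. \<omega> \<theta> = f * wedge n r \<theta>) \<and> e = ord R f"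
  then obtain s f where s: "canonical_generator \<iota> n R s" and f: "f \<in> K" "\<omega> \<delta> = f * jacobian s" "e = ord R f"
    using coordinate_frame by blast
  note r' = canonical_generatorD[OF r] and s' = canonical_generatorD[OF s]
  have "jacobian s / jacobian r \<in> R" "jacobian r / jacobian s \<in> R"
    using r' s' by blast+
  then have "ord R (jacobian s) = ord R (jacobian r)"
    using V.mem_iff_ord[of "jacobian s / jacobian r"] V.mem_iff_ord[of "jacobian r / jacobian s"]
      V.ord_divide r'(2,3) s'(2,3) fractions_R subfield_divide[OF K(1)] by auto
  moreover have "ord R (\<omega> \<delta>) = e + ord R (jacobian s)"
    using V.ord_mult[of f "jacobian s"] f s' \<omega>'(2) fractions_R by auto
  ultimately show "e = ord R (\<omega> \<delta>) - ord R (jacobian r)"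
    by simp
qed

lemma canonical_generator_coordinate:
  assumes "\<And>i f. i < n \<Longrightarrow> f \<in> R \<Longrightarrow> \<delta> i f \<in> R"
  shows "canonical_generator \<iota> n R y"
proof (rule canonical_generatorI)
  show "jacobian s / jacobian y \<in> R" if "\<And>i. i < n \<Longrightarrow> s i \<in> R" for s
    unfolding wedge_coordinate using assms that by (auto simp: wedge_def intro!: subalg_det[OF V.ring])
qed (auto simp: wedge_coordinate y_mem_R)

text \<open>The coordinates lie in \<open>R\<close> and have Jacobian 1, which the Jacobian of a
  generator must divide. Geometrically: discrepancies over a smooth chart are nonnegative.\<close>

lemma ord_jacobian_nonpos:
  assumes "canonical_generator \<iota> n R r"
  shows "ord R (jacobian r) \<le> 0"
proof -
  note r = canonical_generatorD[OF assms]
  have "1 / jacobian r \<in> R"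
    using r(4)[of y] y_mem_R wedge_coordinate by simp
  then show ?thesis
    using V.mem_iff_ord[of "inverse (jacobian r)"] V.ord_inverse r fractions_R subfield_inverse[OF K(1)]
    by (simp add: divide_inverse)
qed

text \<open>
  The orders of Jacobians are bounded below because \<open>R\<close> is essentially of finite type; a
  Jacobian of minimal order provides a generator.
\<close>

lemma canonical_generator_exists:
  assumes fin: "finite G" and P: "prime_ideal (adjoin \<iota> G) P" and R: "R = localization (adjoin \<iota> G) P"
  shows "\<exists>r. canonical_generator \<iota> n R r"
proof -
  let ?B = "adjoin \<iota> G"
  note B = subalgebra_adjoin[of G]
  have BR: "?B \<subseteq> R"
    unfolding R by (rule subset_localization[OF B P])
  have tk: "t ^ k \<in> R" "t ^ k \<noteq> 0" "t ^ k \<in> K" for k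
    using subalg_power[OF V.ring V.t(2)] V.t(1) R_subset_K by auto
  have "\<exists>k::nat. t ^ k * f \<in> R" if f: "f \<in> K" for f
  proof (cases "f = 0")
    case False
    have "ord R (t ^ k) = int k" for k
      using V.ord_power[of t k] V.ord_uniformizer V.t by simp
    then have "ord R (t ^ nat (- ord R f) * f) \<ge> 0"
      using V.ord_mult[of "t ^ nat (- ord R f)" f] f False tk fractions_R V.t(1) by auto
    moreover have "t ^ nat (- ord R f) * f \<in> K" "t ^ nat (- ord R f) * f \<noteq> 0"
      using f False tk subalg_mult[OF K(2)] by auto
    ultimately have "t ^ nat (- ord R f) * f \<in> R"
      using V.mem_iff_ord[of "t ^ nat (- ord R f) * f"] fractions_R by simp
    then show ?thesis
      by blast
  qed (use subalg_0[OF V.ring] in auto)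
  then obtain e :: "'a \<Rightarrow> nat" where e: "\<And>f. f \<in> K \<Longrightarrow> t ^ e f * f \<in> R"
    by metis
  \<comment> \<open>An exponent for which the power of \<open>t\<close> clears the poles of all
    partial derivatives of the finitely many generators; inserting 0 keeps the set nonempty.\<close>
  define k where "k = Max (insert 0 ((\<lambda>(i, g). e (\<delta> i g)) ` ({..<n} \<times> G)))"
  have gen: "t ^ k * \<delta> i g \<in> R" if "i < n" "g \<in> G" for i g
  proof -
    have "e (\<delta> i g) \<le> k"
      unfolding k_def using fin that by (intro Max_ge) auto
    then have "t ^ k = t ^ (k - e (\<delta> i g)) * t ^ e (\<delta> i g)"
      by (subst power_add[symmetric]) simp
    then have "t ^ k * \<delta> i g = t ^ (k - e (\<delta> i g)) * (t ^ e (\<delta> i g) * \<delta> i g)"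
      by (simp only: mult.assoc)
    moreover have "\<delta> i g \<in> K"
      using that BR adjoin_superset[of G] R_subset_K deriv_mem[OF K(1) derivation_K] by blast
    ultimately show ?thesis
      using e[of "\<delta> i g"] tk(1) subalg_mult[OF V.ring] by metis
  qed
  have closed: "t ^ k * \<delta> i f \<in> R" if i: "i < n" and f: "f \<in> R" for i f
  proof -
    \<comment> \<open>The rescaled derivation maps the generators into \<open>R\<close>; by the
      product and quotient rules it then preserves all of \<open>R\<close>.\<close>
    define D where "D = (\<lambda>f. t ^ k * \<delta> i f)"
    note d = derivation_K[OF i]
    have D: "derivation \<iota> K D"
      using d tk(3) subalg_mult[OF K(2)] by (auto simp: derivation_def D_def algebra_simps)
    have "subalgebra \<iota> {f \<in> R. D f \<in> R}"
      using R_subset_K by (auto simp: subalgebra_def subalg_const[OF V.ring] subalg_0[OF V.ring] deriv_const[OF K(1) D]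
          deriv_add[OF K(1) D] deriv_mult[OF K(1) D] subsetD intro!: subalg_add[OF V.ring] subalg_mult[OF V.ring])
    moreover have "G \<subseteq> {f \<in> R. D f \<in> R}"
      using gen i BR adjoin_superset[of G] by (auto simp: D_def)
    ultimately have "?B \<subseteq> {f \<in> R. D f \<in> R}"
      by (rule adjoin_least)
    then have DB: "D a \<in> R" if "a \<in> ?B" for a
      using that by blast
    have "D f \<in> R"
      using deriv_localization_closed[OF K(1) D B P subset_trans[OF BR R_subset_K] DB[unfolded R] f[unfolded R]]
      unfolding R .
    then show ?thesis
      by (simp add: D_def)
  qed
  have bound: "(t ^ k) ^ n * jacobian s \<in> R" if "\<And>i. i < n \<Longrightarrow> s i \<in> R" for s
  proof -
    have "(t ^ k) ^ n * jacobian s = det (t ^ k \<cdot>\<^sub>m mat n n (\<lambda>(i, j). \<delta> j (s i)))"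
      by (simp add: wedge_def)
    also have "t ^ k \<cdot>\<^sub>m mat n n (\<lambda>(i, j). \<delta> j (s i)) = mat n n (\<lambda>(i, j). t ^ k * \<delta> j (s i))"
      by (intro eq_matI) auto
    also have "det \<dots> \<in> R"
      using closed that by (intro subalg_det[OF V.ring]) auto
    finally show ?thesis .
  qed
  define S where "S = {r. (\<forall>i<n. r i \<in> R) \<and> jacobian r \<noteq> 0}"
  have yS: "y \<in> S"
    by (simp add: S_def y_mem_R wedge_coordinate)
  have inK: "jacobian s \<in> K" if "\<And>i. i < n \<Longrightarrow> s i \<in> R" for s
    unfolding wedge_def using deriv_mem[OF K(1) derivation_K] R_subset_K that by (intro subalg_det[OF K(2)]) auto
  have nonneg: "ord R ((t ^ k) ^ n * jacobian s) \<ge> 0" if "s \<in> S" for s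
    using V.mem_iff_ord[of "(t ^ k) ^ n * jacobian s"] bound[of s] inK[of s] that fractions_R
    by (auto simp: S_def V.t intro: subsetD[OF R_subset_K])
  \<comment> \<open>The rescaled Jacobians have nonnegative orders, so a least order can be found
    among natural numbers.\<close>
  obtain r where r: "r \<in> S"
    and min: "\<And>s. s \<in> S \<Longrightarrow> nat (ord R ((t ^ k) ^ n * jacobian r)) \<le> nat (ord R ((t ^ k) ^ n * jacobian s))"
    using ex_has_least_nat[of "\<lambda>r. r \<in> S" y "\<lambda>r. nat (ord R ((t ^ k) ^ n * jacobian r))"] yS by auto
  have ordS: "ord R ((t ^ k) ^ n * jacobian s) = ord R ((t ^ k) ^ n) + ord R (jacobian s)" if "s \<in> S" for s
    using V.ord_mult[of "(t ^ k) ^ n" "jacobian s"] that inK[of s] fractions_R tk subalg_power[OF K(2)] V.t(1)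
    by (auto simp: S_def)
  have "canonical_generator \<iota> n R r"
  proof (rule canonical_generatorI)
    show "jacobian s / jacobian r \<in> R" if s: "\<And>i. i < n \<Longrightarrow> s i \<in> R" for s
    proof (cases "jacobian s = 0")
      case False
      then have "s \<in> S"
        using s by (simp add: S_def)
      then have "ord R (jacobian r) \<le> ord R (jacobian s)"
        using min[of s] nonneg[of s] nonneg[OF r] ordS[of s] ordS[OF r] by simp
      then show ?thesis
        using V.mem_iff_ord[of "jacobian s / jacobian r"] V.ord_divide[of "jacobian s" "jacobian r"] False r inK s
          fractions_R subfield_divide[OF K(1)] by (auto simp: S_def)
    qed (use subalg_0[OF V.ring] in auto)
  qed (use r in \<open>auto simp: S_def\<close>)
  then show ?thesis
    by blast
qed

end

section \<open>Multi-indices\<close>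

text \<open>Indices vanish from \<open>n\<close> on, so that equality of functions is equality of
  multi-indices.\<close>

definition multi :: "nat \<Rightarrow> nat \<Rightarrow> (nat \<Rightarrow> nat) set" where
  "multi n N = {\<beta>. (\<forall>i\<ge>n. \<beta> i = 0) \<and> (\<Sum>i<n. \<beta> i) \<le> N}"

lemma finite_multi: "finite (multi n N)"
proof (rule finite_subset)
  have "\<beta> i \<le> N" if "\<beta> \<in> multi n N" "i < n" for \<beta> i
    using member_le_sum[of i "{..<n}" \<beta>] that by (auto simp: multi_def)
  then show "multi n N \<subseteq> {\<beta>. \<forall>i. (i \<in> {..<n} \<longrightarrow> \<beta> i \<in> {..N}) \<and> (i \<notin> {..<n} \<longrightarrow> \<beta> i = 0)}"
    by (auto simp: multi_def)
  show "finite {\<beta>. \<forall>i. (i \<in> {..<n} \<longrightarrow> \<beta> i \<in> {..N}) \<and> (i \<notin> {..<n} \<longrightarrow> \<beta> i = (0::nat))}"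
    by (rule finite_set_of_finite_funs) auto
qed

lemma zero_multi: "(\<lambda>_. 0) \<in> multi n N"
  by (simp add: multi_def)

lemma multi_mono: "N \<le> N' \<Longrightarrow> multi n N \<subseteq> multi n N'"
  by (auto simp: multi_def)

text \<open>The general coefficients serve two purposes: all equal to 1 for the degree of a
  multi-index, \<open>Suc i\<close> for its \<open>weight\<close>.\<close>

lemma sum_fun_upd_Suc:
  fixes j n :: nat
  assumes "j < n"
  shows "(\<Sum>i<n. c i * (\<beta>(j := Suc (\<beta> j))) i) = (\<Sum>i<n. c i * \<beta> i) + (c j :: nat)"
proof -
  have "(\<Sum>i<n. c i * (\<beta>(j := Suc (\<beta> j))) i) = (\<Sum>i<n. c i * \<beta> i + (if i = j then c i else 0))"
    by (intro sum.cong) auto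
  then show ?thesis
    using assms by (simp add: sum.distrib)
qed

lemma multi_Suc:
  assumes "\<beta> \<in> multi n N" "j < n"
  shows "\<beta>(j := Suc (\<beta> j)) \<in> multi n (Suc N)"
  using assms sum_fun_upd_Suc[OF assms(2), of "\<lambda>_. 1" \<beta>] by (auto simp: multi_def)

text \<open>
  Adding the slack variable \<open>N - |\<beta>|\<close> turns multi-indices of degree at most \<open>N\<close> into those of
  degree \<open>N\<close> in one more variable, which makes the symmetry visible.
\<close>

lemma sum_multi:
  assumes "j < n"
  shows "(n + 1) * (\<Sum>\<beta>\<in>multi n N. \<beta> j) = N * card (multi n N)"
proof -
  define H where "H = {\<alpha>::nat \<Rightarrow> nat. (\<forall>i>n. \<alpha> i = 0) \<and> (\<Sum>i\<le>n. \<alpha> i) = N}"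
  define h where "h = (\<lambda>\<beta>::nat \<Rightarrow> nat. \<beta>(n := N - (\<Sum>i<n. \<beta> i)))"
  have bij: "bij_betw h (multi n N) H"
  proof (rule bij_betw_byWitness[where f' = "\<lambda>\<alpha>. \<alpha>(n := 0)"])
    show "\<forall>\<beta>\<in>multi n N. (h \<beta>)(n := 0) = \<beta>"
      by (auto simp: h_def multi_def)
    show "\<forall>\<alpha>\<in>H. h (\<alpha>(n := 0)) = \<alpha>"
      by (auto simp: h_def H_def lessThan_Suc_atMost[symmetric])
    have "(\<Sum>i<n. (h \<beta>) i) = (\<Sum>i<n. \<beta> i)" for \<beta>
      by (auto simp: h_def intro!: sum.cong)
    then show "h ` multi n N \<subseteq> H"
      by (auto simp: H_def multi_def lessThan_Suc_atMost[symmetric]) (auto simp: h_def)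
    show "(\<lambda>\<alpha>. \<alpha>(n := 0)) ` H \<subseteq> multi n N"
      by (auto simp: H_def multi_def lessThan_Suc_atMost[symmetric])
  qed
  have symm: "(\<Sum>\<alpha>\<in>H. \<alpha> i) = (\<Sum>\<alpha>\<in>H. \<alpha> j)" if "i \<le> n" for i
  proof -
    let ?p = "Transposition.transpose i j"
    have p: "?p permutes {..n}"
      using that assms by (intro permutes_swap_id) auto
    have H: "\<alpha> \<circ> ?p \<in> H" if "\<alpha> \<in> H" for \<alpha>
    proof -
      have "?p k > n" if "k > n" for k
        using permutes_not_in[OF p, of k] that by simp
      then show ?thesis
        using that sum.permute[OF p, of \<alpha>] by (auto simp: H_def)
    qed
    show ?thesis
      by (rule sum.reindex_bij_witness[where i = "\<lambda>\<alpha>. \<alpha> \<circ> ?p" and j = "\<lambda>\<alpha>. \<alpha> \<circ> ?p"])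
         (use H in \<open>auto simp: comp_assoc\<close>)
  qed
  have "(\<Sum>i\<le>n. \<Sum>\<alpha>\<in>H. \<alpha> i) = (\<Sum>\<alpha>\<in>H. \<Sum>i\<le>n. \<alpha> i)"
    by (rule sum.swap)
  also have "\<dots> = N * card H"
    by (simp add: H_def)
  finally have "(n + 1) * (\<Sum>\<alpha>\<in>H. \<alpha> j) = N * card H"
    using symm by simp
  moreover have "(\<Sum>\<alpha>\<in>H. \<alpha> j) = (\<Sum>\<beta>\<in>multi n N. \<beta> j)"
    using assms by (subst sum.reindex_bij_betw[OF bij, symmetric]) (auto simp: h_def)
  ultimately show ?thesis
    using bij_betw_same_card[OF bij] by simp
qed

section \<open>Iterated partial derivatives\<close>

context chart
begin

definition mon :: "(nat \<Rightarrow> nat) \<Rightarrow> 'a" where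
  "mon \<beta> = (\<Prod>i<n. y i ^ \<beta> i)"

primrec dpow :: "nat \<Rightarrow> (nat \<Rightarrow> nat) \<Rightarrow> 'a \<Rightarrow> 'a" where
  "dpow 0 \<beta> f = f"
| "dpow (Suc k) \<beta> f = (\<delta> k ^^ \<beta> k) (dpow k \<beta> f)"

lemma mon_mem_A: "mon \<beta> \<in> A"
  unfolding mon_def by (intro subalg_prod[OF A] subalg_power[OF A] y_mem_A) auto

lemma mon_mem_K: "mon \<beta> \<in> K"
  using mon_mem_A A_subset_K by blast

lemma mon_mult: "mon (\<lambda>i. \<alpha> i + \<beta> i) = mon \<alpha> * mon \<beta>"
  by (simp add: mon_def power_add prod.distrib)

text \<open>The commutator of two derivations is a derivation, and it vanishes on the coordinates
  because the first derivatives there are constants.\<close>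

lemma deriv_commute:
  assumes "i < n" "j < n" "f \<in> K"
  shows "\<delta> i (\<delta> j f) = \<delta> j (\<delta> i f)"
proof -
  note Di = K(1) derivation_K[OF assms(1)] and Dj = K(1) derivation_K[OF assms(2)]
  let ?D = "\<lambda>f. \<delta> i (\<delta> j f) - \<delta> j (\<delta> i f)"
  have D: "derivation \<iota> K ?D"
    unfolding derivation_def
    by (auto simp: deriv_mem[OF Di] deriv_mem[OF Dj] deriv_const[OF Di] deriv_const[OF Dj] deriv_add[OF Di] deriv_add[OF Dj]
        deriv_mult[OF Di] deriv_mult[OF Dj] deriv_0[OF Di] deriv_0[OF Dj] subalg_mult[OF K(2)] subalg_add[OF K(2)] algebra_simps
        intro!: subalg_diff[OF K(2)])
  have 0: "derivation \<iota> K (\<lambda>f. 0)"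
    by (auto simp: derivation_def subalg_0[OF K(2)])
  have "?D (y l) = 0" if "l < n" for l
    using dual[OF assms(1) that] dual[OF assms(2) that]
      deriv_0[OF Di] deriv_1[OF Di] deriv_0[OF Dj] deriv_1[OF Dj] by auto
  then have "?D f = 0"
    using derivation_eqI[OF D 0 _ assms(3)] by blast
  then show ?thesis
    by simp
qed

lemma deriv_funpow_mem: "i < n \<Longrightarrow> f \<in> K \<Longrightarrow> (\<delta> i ^^ k) f \<in> K"
  by (induction k) (auto intro: deriv_mem[OF K(1) derivation_K])

lemma deriv_funpow_commute: "i < n \<Longrightarrow> j < n \<Longrightarrow> f \<in> K \<Longrightarrow> \<delta> i ((\<delta> j ^^ k) f) = (\<delta> j ^^ k) (\<delta> i f)"
proof (induction k)
  case (Suc k)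
  then show ?case
    using deriv_commute[of i j "(\<delta> j ^^ k) f"] deriv_funpow_mem[of j f k] by simp
qed simp

lemma dpow_mem: "k \<le> n \<Longrightarrow> f \<in> K \<Longrightarrow> dpow k \<beta> f \<in> K"
  by (induction k) (auto intro: deriv_funpow_mem)

lemma dpow_Suc_index:
  assumes "j < n" "f \<in> K" "k \<le> n"
  shows "dpow k (\<beta>(j := Suc (\<beta> j))) f = (if j < k then \<delta> j (dpow k \<beta> f) else dpow k \<beta> f)"
  using assms(3)
proof (induction k)
  case (Suc k)
  then show ?case
    using assms deriv_funpow_commute[of j k "dpow k \<beta> f" "\<beta> k"] dpow_mem[of k f \<beta>]
    by (auto simp: less_Suc_eq)
qed simp

lemma deriv_dpow: "j < n \<Longrightarrow> f \<in> K \<Longrightarrow> \<delta> j (dpow n \<beta> f) = dpow n (\<beta>(j := Suc (\<beta> j))) f"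
  by (simp add: dpow_Suc_index)

lemma dpow_zero: "dpow k (\<lambda>_. 0) f = f"
  by (induction k) auto

lemma dpow_linear:
  assumes "k \<le> n"
  shows "finite S \<Longrightarrow> (\<And>s. s \<in> S \<Longrightarrow> s \<in> K) \<Longrightarrow> dpow k \<beta> (\<Sum>s\<in>S. \<iota> (c s) * s) = (\<Sum>s\<in>S. \<iota> (c s) * dpow k \<beta> s)"
  using assms
proof (induction k)
  case (Suc k)
  note D = K(1) derivation_K[of k]
  have "(\<delta> k ^^ m) (\<Sum>s\<in>S. \<iota> (c s) * g s) = (\<Sum>s\<in>S. \<iota> (c s) * (\<delta> k ^^ m) (g s))"
    if "\<And>s. s \<in> S \<Longrightarrow> g s \<in> K" for m g
  proof (induction m)
    case (Suc m)
    then show ?case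
      using Suc.prems that \<open>Suc k \<le> n\<close> deriv_funpow_mem[of k]
      by (simp add: deriv_sum[OF D] deriv_const_mult[OF D] subalg_mult[OF K(2)] subalg_const[OF K(2)])
  qed simp
  then show ?case
    using Suc dpow_mem[of k] by simp
qed simp

lemma deriv_mon: "j < n \<Longrightarrow> \<delta> j (mon \<gamma>) = of_nat (\<gamma> j) * mon (\<gamma>(j := \<gamma> j - 1))"
proof -
  assume j: "j < n"
  note D = K(1) derivation_K[OF j]
  let ?r = "\<Prod>i\<in>{..<n} - {j}. y i ^ \<gamma> i"
  have r: "?r \<in> K"
    by (intro subalg_prod[OF K(2)] subalg_power[OF K(2)] y_mem_K) auto
  have "\<delta> j (\<Prod>i\<in>I. y i ^ \<gamma> i) = 0" if "finite I" "I \<subseteq> {..<n} - {j}" for I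
    using that
  proof (induction I rule: finite_induct)
    case (insert i I)
    then have "i < n" "i \<noteq> j" "(\<Prod>i\<in>I. y i ^ \<gamma> i) \<in> K"
      by (auto intro!: subalg_prod[OF K(2)] subalg_power[OF K(2)] y_mem_K)
    then show ?case
      using insert j dual[of j i] y_mem_K[of i]
      by (simp add: deriv_mult[OF D] deriv_power[OF D] subalg_power[OF K(2)])
  qed (simp add: deriv_1[OF D])
  then have "\<delta> j ?r = 0"
    by blast
  moreover have "mon \<gamma> = y j ^ \<gamma> j * ?r"
    unfolding mon_def using j by (subst prod.remove[of _ j]) auto
  moreover have "mon (\<gamma>(j := \<gamma> j - 1)) = y j ^ (\<gamma> j - 1) * ?r"
    unfolding mon_def using j by (subst prod.remove[of _ j]) auto
  ultimately show ?thesis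
    using j r dual[of j j] y_mem_K[of j] by (simp add: deriv_mult[OF D] deriv_power[OF D] subalg_power[OF K(2)])
qed

text \<open>The product is a falling factorial written with truncated subtraction. It vanishes as
  soon as \<open>a\<close> exceeds the exponent, so the truncated exponent of the remaining monomial
  does no harm.\<close>

lemma deriv_funpow_mon:
  assumes "j < n"
  shows "(\<delta> j ^^ a) (mon \<gamma>) = of_nat (\<Prod>l<a. \<gamma> j - l) * mon (\<gamma>(j := \<gamma> j - a))"
proof (induction a)
  case (Suc a)
  note D = K(1) derivation_K[OF assms]
  have "(\<delta> j ^^ Suc a) (mon \<gamma>) = \<delta> j (\<iota> (of_nat (\<Prod>l<a. \<gamma> j - l)) * mon (\<gamma>(j := \<gamma> j - a)))"
    by (simp only: funpow.simps o_apply Suc.IH const_of_nat)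
  also have "\<dots> = of_nat (\<Prod>l<a. \<gamma> j - l) * \<delta> j (mon (\<gamma>(j := \<gamma> j - a)))"
    by (subst deriv_const_mult[OF D mon_mem_K]) (simp only: const_of_nat)
  finally show ?case
    using deriv_mon[OF assms, of "\<gamma>(j := \<gamma> j - a)"] by (simp add: mult.assoc diff_diff_left fun_upd_def cong: if_cong)
qed simp

lemma dpow_mon:
  "k \<le> n \<Longrightarrow> dpow k \<alpha> (mon \<gamma>) =
    of_nat (\<Prod>i<k. \<Prod>l<\<alpha> i. \<gamma> i - l) * mon (\<lambda>i. if i < k then \<gamma> i - \<alpha> i else \<gamma> i)"
proof (induction k)
  case (Suc k)
  let ?\<gamma> = "\<lambda>i. if i < k then \<gamma> i - \<alpha> i else \<gamma> i"
  let ?c = "\<Prod>i<k. \<Prod>l<\<alpha> i. \<gamma> i - l"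
  note D = K(1) derivation_K[of k]
  have const: "(\<delta> k ^^ m) (\<iota> c * f) = \<iota> c * (\<delta> k ^^ m) f" if "f \<in> K" for c f m
    using that Suc.prems deriv_funpow_mem[of k f] by (induction m) (auto simp: deriv_const_mult[OF D])
  have "dpow (Suc k) \<alpha> (mon \<gamma>) = (\<delta> k ^^ \<alpha> k) (\<iota> (of_nat ?c) * mon ?\<gamma>)"
    using Suc.prems by (simp only: dpow.simps Suc.IH[OF Suc_leD] const_of_nat)
  also have "\<dots> = of_nat ?c * (\<delta> k ^^ \<alpha> k) (mon ?\<gamma>)"
    by (subst const[OF mon_mem_K]) (simp only: const_of_nat)
  also have "(\<delta> k ^^ \<alpha> k) (mon ?\<gamma>) = of_nat (\<Prod>l<\<alpha> k. \<gamma> k - l) * mon (?\<gamma>(k := \<gamma> k - \<alpha> k))"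
    using deriv_funpow_mon[of k "\<alpha> k" ?\<gamma>] Suc.prems by simp
  also have "?\<gamma>(k := \<gamma> k - \<alpha> k) = (\<lambda>i. if i < Suc k then \<gamma> i - \<alpha> i else \<gamma> i)"
    by (auto simp: fun_eq_iff less_Suc_eq)
  finally show ?case
    by (simp add: mult.assoc)
qed simp

lemma dpow_mon_nonzero:
  assumes "dpow n \<alpha> (mon \<gamma>) \<noteq> 0" "i < n"
  shows "\<alpha> i \<le> \<gamma> i"
proof (rule ccontr)
  assume "\<not> \<alpha> i \<le> \<gamma> i"
  then have "(\<Prod>l<\<alpha> i. \<gamma> i - l) = 0"
    by (auto intro!: bexI[of _ "\<gamma> i"])
  then have "(\<Prod>i<n. \<Prod>l<\<alpha> i. \<gamma> i - l) = 0"
    using assms(2) by (intro prod_zero) auto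
  then have "dpow n \<alpha> (mon \<gamma>) = 0"
    by (simp only: dpow_mon[OF order_refl] of_nat_0 mult_zero_left)
  then show False
    using assms(1) by contradiction
qed

text \<open>The number is the product of the factorials of the exponents.\<close>

lemma dpow_mon_self: "\<exists>k>0. dpow n \<gamma> (mon \<gamma>) = of_nat k"
proof (intro exI conjI)
  show "dpow n \<gamma> (mon \<gamma>) = of_nat (\<Prod>i<n. \<Prod>l<\<gamma> i. \<gamma> i - l)"
    using dpow_mon[of n \<gamma> \<gamma>] by (simp add: mon_def)
qed (auto intro!: prod_pos)

lemma multi_eqI:
  assumes "\<alpha> \<in> multi n N" "\<gamma> \<in> multi n M" "\<And>i. i < n \<Longrightarrow> \<alpha> i \<le> \<gamma> i" "(\<Sum>i<n. \<gamma> i) \<le> (\<Sum>i<n. \<alpha> i)"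
  shows "\<alpha> = \<gamma>"
proof
  fix i
  have eq: "(\<Sum>i<n. \<alpha> i) = (\<Sum>i<n. \<gamma> i)"
    using assms(3,4) sum_mono[of "{..<n}" \<alpha> \<gamma>] by simp
  show "\<alpha> i = \<gamma> i"
  proof (cases "i < n")
    case True
    then show ?thesis
      using sum_mono_inv[OF eq] assms(3) by auto
  qed (use assms in \<open>auto simp: multi_def\<close>)
qed

section \<open>Triangular differential operators\<close>

text \<open>Larger indices weigh more, so exchanging a partial derivative for one of smaller index
  lowers the weight although the order of differentiation stays the same. For this ordering
  triangular vector fields act as triangular operators.\<close>

definition weight :: "(nat \<Rightarrow> nat) \<Rightarrow> nat" where
  "weight \<beta> = (\<Sum>i<n. Suc i * \<beta> i)"

text \<open>Differential operators with coefficients in \<open>K\<close>, supported on the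
  multi-indices in \<open>S\<close>. Equality is demanded only on \<open>K\<close>, where the
  partial derivatives are known to commute.\<close>

definition operator :: "(nat \<Rightarrow> nat) set \<Rightarrow> ('a \<Rightarrow> 'a) \<Rightarrow> bool" where
  "operator S Q \<longleftrightarrow> (\<exists>c. (\<forall>\<gamma>\<in>S. c \<gamma> \<in> K) \<and> (\<forall>f\<in>K. Q f = (\<Sum>\<gamma>\<in>S. c \<gamma> * dpow n \<gamma> f)))"

lemma operator_cong: "operator S Q \<Longrightarrow> (\<And>f. f \<in> K \<Longrightarrow> Q' f = Q f) \<Longrightarrow> operator S Q'"
  by (auto simp: operator_def)

lemma operator_zero: "operator S (\<lambda>f. 0)"
  by (auto simp: operator_def subalg_0[OF K(2)] intro!: exI[of _ "\<lambda>_. 0"])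

lemma operator_add:
  assumes "operator S P" "operator S Q" shows "operator S (\<lambda>f. P f + Q f)"
proof -
  obtain c d where "\<forall>\<gamma>\<in>S. c \<gamma> \<in> K" "\<forall>f\<in>K. P f = (\<Sum>\<gamma>\<in>S. c \<gamma> * dpow n \<gamma> f)"
    "\<forall>\<gamma>\<in>S. d \<gamma> \<in> K" "\<forall>f\<in>K. Q f = (\<Sum>\<gamma>\<in>S. d \<gamma> * dpow n \<gamma> f)"
    using assms by (auto simp: operator_def)
  then show ?thesis
    unfolding operator_def
    by (intro exI[of _ "\<lambda>\<gamma>. c \<gamma> + d \<gamma>"]) (auto simp: distrib_right sum.distrib intro: subalg_add[OF K(2)])
qed

lemma operator_sum: "(\<And>i. i \<in> I \<Longrightarrow> operator S (Q i)) \<Longrightarrow> operator S (\<lambda>f. \<Sum>i\<in>I. Q i f)"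
  by (induction I rule: infinite_finite_induct) (auto intro: operator_add operator_zero)

lemma operator_single:
  assumes "finite S" "\<gamma> \<in> S" "k \<in> K"
  shows "operator S (\<lambda>f. k * dpow n \<gamma> f)"
proof -
  have "k * dpow n \<gamma> f = (\<Sum>\<gamma>'\<in>S. (if \<gamma>' = \<gamma> then k else 0) * dpow n \<gamma>' f)" for f
    using assms by (subst sum.remove[of _ \<gamma>]) (auto intro!: sum.neutral)
  then show ?thesis
    unfolding operator_def using assms subalg_0[OF K(2)]
    by (intro exI[of _ "\<lambda>\<gamma>'. if \<gamma>' = \<gamma> then k else 0"]) auto
qed

definition lower :: "nat \<Rightarrow> (nat \<Rightarrow> nat) \<Rightarrow> (nat \<Rightarrow> nat) set" where
  "lower N \<beta> = {\<gamma> \<in> multi n N. weight \<gamma> < weight \<beta>}"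

lemma finite_lower: "finite (lower N \<beta>)"
  using finite_multi by (simp add: lower_def)

lemma operator_mono:
  assumes "operator S Q" "S \<subseteq> S'" "finite S'"
  shows "operator S' Q"
proof -
  obtain c where c: "\<forall>\<gamma>\<in>S. c \<gamma> \<in> K" "\<forall>f\<in>K. Q f = (\<Sum>\<gamma>\<in>S. c \<gamma> * dpow n \<gamma> f)"
    using assms by (auto simp: operator_def)
  have "operator S' (\<lambda>f. \<Sum>\<gamma>\<in>S. c \<gamma> * dpow n \<gamma> f)"
    using c assms by (intro operator_sum operator_single) auto
  then show ?thesis
    by (rule operator_cong) (use c in auto)
qed

lemma weight_Suc: "j < n \<Longrightarrow> weight (\<beta>(j := Suc (\<beta> j))) = weight \<beta> + Suc j"
  unfolding weight_def by (rule sum_fun_upd_Suc)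

text \<open>By the product rule a term of index \<open>\<gamma>\<close> keeps its index when the
  coefficient is differentiated, and otherwise gains one partial derivative of index at most
  \<open>j\<close>. Either way its weight stays below that of \<open>\<beta>\<close> plus
  \<open>Suc j\<close>.\<close>

lemma operator_deriv:
  assumes Q: "operator (lower N \<beta>) Q" and j: "j < n"
    and c: "\<And>i. i < n \<Longrightarrow> c i \<in> K" "\<And>i. i < n \<Longrightarrow> j < i \<Longrightarrow> c i = 0"
  shows "operator (lower (Suc N) (\<beta>(j := Suc (\<beta> j)))) (\<lambda>f. apply_field c (Q f))"
proof -
  let ?L = "lower (Suc N) (\<beta>(j := Suc (\<beta> j)))"
  note D = K(1) derivation_apply_field[OF c(1)]
  obtain q where q: "\<And>\<gamma>. \<gamma> \<in> lower N \<beta> \<Longrightarrow> q \<gamma> \<in> K" "\<And>f. f \<in> K \<Longrightarrow> Q f = (\<Sum>\<gamma>\<in>lower N \<beta>. q \<gamma> * dpow n \<gamma> f)"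
    using Q by (auto simp: operator_def)
  have "operator ?L (\<lambda>f. \<Sum>\<gamma>\<in>lower N \<beta>. (apply_field c (q \<gamma>) * dpow n \<gamma> f + (\<Sum>i<n. q \<gamma> * c i * dpow n (\<gamma>(i := Suc (\<gamma> i))) f)))"
  proof (intro operator_sum operator_add)
    fix \<gamma> assume \<gamma>: "\<gamma> \<in> lower N \<beta>"
    then have "\<gamma> \<in> ?L"
      using weight_Suc[OF j, of \<beta>] multi_mono[of N "Suc N" n] by (auto simp: lower_def)
    then show "operator ?L (\<lambda>f. apply_field c (q \<gamma>) * dpow n \<gamma> f)"
      using q(1)[OF \<gamma>] deriv_mem[OF D] by (intro operator_single finite_lower) auto
    fix i assume "i \<in> {..<n}"
    then have i: "i < n"
      by simp
    show "operator ?L (\<lambda>f. q \<gamma> * c i * dpow n (\<gamma>(i := Suc (\<gamma> i))) f)"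
    proof (cases "i \<le> j")
      case True
      then have "\<gamma>(i := Suc (\<gamma> i)) \<in> ?L"
        using \<gamma> i j weight_Suc[OF j, of \<beta>] weight_Suc[OF i, of \<gamma>] multi_Suc[of \<gamma> n N i] by (auto simp: lower_def)
      then show ?thesis
        using q(1)[OF \<gamma>] c i by (intro operator_single finite_lower subalg_mult[OF K(2)]) auto
    qed (use c i operator_zero in auto)
  qed
  then show ?thesis
  proof (rule operator_cong)
    fix f assume f: "f \<in> K"
    have "apply_field c (Q f) = (\<Sum>\<gamma>\<in>lower N \<beta>. apply_field c (q \<gamma> * dpow n \<gamma> f))"
      using q f dpow_mem[of n f] by (simp add: deriv_sum[OF D] subalg_mult[OF K(2)])
    also have "\<dots> = (\<Sum>\<gamma>\<in>lower N \<beta>. (apply_field c (q \<gamma>) * dpow n \<gamma> f + (\<Sum>i<n. q \<gamma> * c i * dpow n (\<gamma>(i := Suc (\<gamma> i))) f)))"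
    proof (intro sum.cong refl)
      fix \<gamma> assume "\<gamma> \<in> lower N \<beta>"
      then have "apply_field c (q \<gamma> * dpow n \<gamma> f) = apply_field c (q \<gamma>) * dpow n \<gamma> f + q \<gamma> * apply_field c (dpow n \<gamma> f)"
        using q(1) dpow_mem[of n f \<gamma>] f by (simp add: deriv_mult[OF D])
      also have "q \<gamma> * apply_field c (dpow n \<gamma> f) = (\<Sum>i<n. q \<gamma> * c i * dpow n (\<gamma>(i := Suc (\<gamma> i))) f)"
        using f by (auto simp: apply_field_def sum_distrib_left deriv_dpow mult.assoc intro!: sum.cong)
      finally show "apply_field c (q \<gamma> * dpow n \<gamma> f) = apply_field c (q \<gamma>) * dpow n \<gamma> f + (\<Sum>i<n. q \<gamma> * c i * dpow n (\<gamma>(i := Suc (\<gamma> i))) f)" .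
    qed
    finally show "apply_field c (Q f) = \<dots>" .
  qed
qed

end

section \<open>Logarithmic derivations\<close>

context chart_dvr
begin

text \<open>Equivalently, D f / f lies in \<open>R\<close> for every nonzero \<open>f\<close> in
  \<open>K\<close>. Such fields never lower the order, however often they are applied.\<close>

definition log_field :: "(nat \<Rightarrow> 'a) \<Rightarrow> bool" where
  "log_field c \<longleftrightarrow> (\<forall>i<n. c i \<in> K) \<and> (\<forall>k. \<forall>f\<in>V.filt k. apply_field c f \<in> V.filt k)"

lemma log_fieldI:
  assumes c: "\<And>i. i < n \<Longrightarrow> c i \<in> K" and R: "\<And>f. f \<in> R \<Longrightarrow> apply_field c f \<in> R"
    and t: "apply_field c t \<in> V.filt 1"
  shows "log_field c"
proof -
  note D = K(1) derivation_apply_field[OF c]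
  let ?D = "apply_field c"
  \<comment> \<open>The logarithmic derivative turns products into sums, so it is enough to control
    units, where preservation of \<open>R\<close> suffices, and the uniformizer.\<close>
  let ?S = "\<lambda>f. f \<in> K \<and> f \<noteq> 0 \<and> ?D f / f \<in> R"
  have mult: "?S (f * g)" if "?S f" "?S g" for f g
  proof -
    have "?D (f * g) / (f * g) = ?D f / f + ?D g / g"
      using that by (simp add: deriv_mult[OF D] field_simps)
    then show ?thesis
      using that subalg_add[OF V.ring] subalg_mult[OF K(2)] by simp
  qed
  have inverse: "?S (inverse f)" if "?S f" for f
  proof -
    have "?D (inverse f) / inverse f = - (?D f / f)"
      using that by (simp add: deriv_inverse[OF D] power2_eq_square divide_inverse)
    moreover have "- (?D f / f) \<in> R"
      using that subalg_minus[OF V.ring] by blast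
    ultimately show ?thesis
      using that subfield_inverse[OF K(1)] by simp
  qed
  have St: "?S t"
    using t V.filt_iff[of "?D t" 1] V.t deriv_mem[OF D] fractions_R
    by (simp add: power_int_minus divide_inverse)
  have power: "?S (t ^ k)" for k
  proof (induction k)
    case 0
    show ?case
      by (simp add: subalg_1[OF K(2)] deriv_1[OF D] subalg_0[OF V.ring])
  next
    case (Suc k)
    then show ?case
      using mult[OF St] V.t(1) by simp
  qed
  have powi: "?S (t powi e)" for e
    using power[of "nat e"] inverse[OF power[of "nat (- e)"]]
    by (auto simp: power_int_def power_inverse)
  have "?D f \<in> V.filt k" if f: "f \<in> V.filt k" for k f
  proof (cases "f = 0")
    case True
    then show ?thesis
      using deriv_0[OF D] V.filt_zero by simp
  next
    case False
    have fK: "f \<in> K" "k \<le> ord R f"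
      using f False fractions_R by (auto simp: V.filt_def)
    obtain u where u: "u \<in> V.U" "f = u * t powi (ord R f)"
      using V.ord_decomposition fK False fractions_R by metis
    have "?S u"
      using u(1) R[of u] R_subset_K subalg_mult[OF V.ring] by (auto simp: V.U_iff divide_inverse)
    then have "?S f"
      using mult[OF _ powi] u(2) by metis
    then have "?D f / f \<in> V.filt 0"
      by (simp add: V.filt_0)
    then have "f * (?D f / f) \<in> V.filt k"
      using V.filt_mult[OF f] by fastforce
    then show ?thesis
      using False by simp
  qed
  then show ?thesis
    using c by (simp add: log_field_def)
qed

lemma apply_field_linear:
  "apply_field (\<lambda>i. a * x i + b * z i) f = a * apply_field x f + b * apply_field z f"
  by (simp add: apply_field_def distrib_right sum.distrib sum_distrib_left mult.assoc)

lemma log_field_linear: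
  assumes "log_field x" "log_field z" "c \<in> R"
  shows "log_field (\<lambda>i. x i + c * z i)"
proof -
  have "apply_field (\<lambda>i. x i + c * z i) f \<in> V.filt k" if "f \<in> V.filt k" for f k
    using assms that apply_field_linear[of 1 x c z f] V.filt_add V.filt_mult[of c 0 _ k]
    by (auto simp: log_field_def V.filt_0)
  then show ?thesis
    using assms R_subset_K by (auto simp: log_field_def intro!: subalg_add[OF K(2)] subalg_mult[OF K(2)])
qed

text \<open>
  The basis of derivations dual to a canonical generator \<open>r\<close> preserves \<open>R\<close>; it becomes logarithmic
  after multiplying one of its members by \<open>t\<close> and subtracting multiples of that member from the others.
\<close>

lemma dual_frame:
  assumes r: "canonical_generator \<iota> n R r"
  obtains M where "\<And>i j. i < n \<Longrightarrow> j < n \<Longrightarrow> M i j \<in> R" "\<And>i f. i < n \<Longrightarrow> f \<in> R \<Longrightarrow> apply_field (M i) f \<in> R"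
    "det (mat n n (\<lambda>(i, j). M i j)) * jacobian r = 1"
proof -
  note r' = canonical_generatorD[OF r]
  let ?J = "\<lambda>r. mat n n (\<lambda>(i, j). \<delta> j (r i))"
  \<comment> \<open>Cramer's rule. By Laplace expansion along row \<open>i\<close>, the field
    \<open>M i\<close> sends \<open>f\<close> to the Jacobian of \<open>r\<close> with
    \<open>r i\<close> replaced by \<open>f\<close>, divided by the Jacobian of \<open>r\<close>;
    this lies in \<open>R\<close> because \<open>r\<close> is a generator.\<close>
  define M where "M = (\<lambda>i j. cofactor (?J r) i j / jacobian r)"
  have apply_M: "apply_field (M i) f = jacobian (r(i := f)) / jacobian r" if "i < n" for i f
  proof -
    have "jacobian (r(i := f)) = (\<Sum>j<n. ?J (r(i := f)) $$ (i, j) * cofactor (?J (r(i := f))) i j)"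
      unfolding wedge_def using that by (intro laplace_expansion_row) auto
    also have "\<dots> = (\<Sum>j<n. \<delta> j f * cofactor (?J r) i j)"
    proof (intro sum.cong refl)
      fix j assume "j \<in> {..<n}"
      have "mat_delete (?J (r(i := f))) i j = mat_delete (?J r) i j"
        using that by (intro eq_matI) (auto simp: mat_delete_def)
      then show "?J (r(i := f)) $$ (i, j) * cofactor (?J (r(i := f))) i j = \<delta> j f * cofactor (?J r) i j"
        using that \<open>j \<in> _\<close> by (simp add: cofactor_def)
    qed
    finally show ?thesis
      by (simp add: apply_field_def M_def sum_divide_distrib mult.commute)
  qed
  have preserve: "apply_field (M i) f \<in> R" if "i < n" "f \<in> R" for i f
    unfolding apply_M[OF that(1)] using r'(1) that by (intro r'(4)) auto
  have mem: "M i j \<in> R" if "i < n" "j < n" for i j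
    using preserve[OF that(1) y_mem_R[OF that(2)]] apply_field_y[OF that(2)] by simp
  have kronecker: "apply_field (M i) (r k) = (if i = k then 1 else 0)" if "i < n" "k < n" for i k
  proof (cases "i = k")
    case True
    then show ?thesis
      using apply_M[OF that(1)] r'(3) by simp
  next
    case False
    have "row (?J (r(i := r k))) i = row (?J (r(i := r k))) k"
      using that False by (intro eq_vecI) auto
    then have "jacobian (r(i := r k)) = 0"
      unfolding wedge_def using that False by (intro det_identical_rows[of _ n i k]) auto
    then show ?thesis
      using apply_M[OF that(1)] False by simp
  qed
  have "det (mat n n (\<lambda>(i, j). M i j)) * det (mat n n (\<lambda>(i, j). \<delta> i (r j))) =
      det (mat n n (\<lambda>(i, k). \<Sum>l<n. (\<lambda>(i, j). M i j) (i, l) * (\<lambda>(i, j). \<delta> i (r j)) (l, k)))"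
    by (simp only: det_mat_mult)
  also have "mat n n (\<lambda>(i, k). \<Sum>l<n. (\<lambda>(i, j). M i j) (i, l) * (\<lambda>(i, j). \<delta> i (r j)) (l, k)) = 1\<^sub>m n"
    using kronecker by (intro eq_matI) (auto simp: apply_field_def)
  finally have "det (mat n n (\<lambda>(i, j). M i j)) * jacobian r = 1"
    using det_mat_transpose[of n "\<lambda>(i, j). \<delta> j (r i)"] by (simp add: wedge_def)
  then show ?thesis
    using that mem preserve by blast
qed

lemma log_frame:
  assumes r: "canonical_generator \<iota> n R r"
  obtains M where "\<And>i. i < n \<Longrightarrow> log_field (M i)" "det (mat n n (\<lambda>(i, j). M i j)) \<noteq> 0"
    "ord R (det (mat n n (\<lambda>(i, j). M i j))) \<le> 1 - ord R (jacobian r)"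
proof -
  note r' = canonical_generatorD[OF r]
  obtain M where M: "\<And>i j. i < n \<Longrightarrow> j < n \<Longrightarrow> M i j \<in> R" "\<And>i f. i < n \<Longrightarrow> f \<in> R \<Longrightarrow> apply_field (M i) f \<in> R"
    and det1: "det (mat n n (\<lambda>(i, j). M i j)) * jacobian r = 1"
    using dual_frame[OF r] by blast
  let ?d = "det (mat n n (\<lambda>(i, j). M i j))"
  have d: "?d \<in> K" "?d \<noteq> 0"
    using det1 M(1) R_subset_K by (auto intro!: subalg_det[OF K(2)])
  have ordd: "ord R ?d = - ord R (jacobian r)"
    using V.ord_mult[of ?d "jacobian r"] d r' det1 fractions_R by simp
  have filt1: "f \<in> V.filt 1 \<longleftrightarrow> f / t \<in> R" if "f \<in> R" for f
    using V.filt_iff[of f 1] that V.R_subset_K by (auto simp: power_int_minus divide_inverse)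
  show ?thesis
  proof (cases "\<forall>i<n. apply_field (M i) t \<in> V.filt 1")
    case True
    then have "log_field (M i)" if "i < n" for i
      using that M R_subset_K by (intro log_fieldI) auto
    then show ?thesis
      using that[of M] d ordd by simp
  next
    case False
    \<comment> \<open>This member sends \<open>t\<close> to a unit. It is the only one to be
      multiplied by \<open>t\<close>, which costs one factor \<open>t\<close> in the determinant and
      explains the 1 in the bound.\<close>
    then obtain p where p: "p < n" "apply_field (M p) t \<notin> V.filt 1"
      by blast
    define u where "u = apply_field (M p) t"
    have u: "u \<in> R" "u \<noteq> 0" "inverse u \<in> R"
    proof -
      show uR: "u \<in> R"
        using M(2)[OF p(1) V.t(2)] by (simp add: u_def)
      show u0: "u \<noteq> 0"
        using p V.filt_zero by (auto simp: u_def)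
      have uK: "u \<in> V.K"
        using uR V.R_subset_K by blast
      have "ord R u < 1" "ord R u \<ge> 0"
        using p uR u0 uK V.mem_iff_ord[OF uK u0] by (auto simp: V.filt_def u_def)
      then have "u \<in> V.U"
        using V.U_iff_ord[OF uK u0] by simp
      then show "inverse u \<in> R"
        by (simp add: V.U_iff)
    qed
    \<comment> \<open>Chosen so that member \<open>i\<close> minus \<open>b i\<close> times member
      \<open>p\<close> is a derivation killing \<open>t\<close>.\<close>
    define b where "b = (\<lambda>i. apply_field (M i) t * inverse u)"
    have b: "b i \<in> R" if "i < n" for i
      using M(2)[OF that V.t(2)] u subalg_mult[OF V.ring] by (simp add: b_def)
    define E where "E = (\<lambda>(i, k). if i = p then (if k = p then t else 0) else if k = i then 1 else if k = p then - b i else 0)"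
    define M' where "M' = (\<lambda>i j. if i = p then t * M p j else M i j + (- b i) * M p j)"
    have EM: "(\<Sum>k<n. E (i, k) * M k j) = M' i j" if "i < n" for i j
    proof (cases "i = p")
      case True
      then have "(\<Sum>k<n. E (i, k) * M k j) = (\<Sum>k<n. if k = p then t * M k j else 0)"
        by (intro sum.cong) (auto simp: E_def)
      then show ?thesis
        using True p by (simp add: M'_def)
    next
      case False
      then have "(\<Sum>k<n. E (i, k) * M k j) = (\<Sum>k<n. (if k = i then M k j else 0) + (if k = p then - b i * M k j else 0))"
        by (intro sum.cong) (auto simp: E_def)
      then show ?thesis
        using False p that by (simp add: M'_def sum.distrib)
    qed
    have "det (mat n n E) = (\<Prod>i<n. E (i, i))"
      by (rule det_triangular_weight[where w = "\<lambda>i. if i = p then 0 else 1"]) (auto simp: E_def split: if_splits)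
    also have "\<dots> = (\<Prod>i<n. if i = p then t else 1)"
      by (intro prod.cong) (auto simp: E_def)
    also have "\<dots> = t"
      using p by simp
    finally have detE: "det (mat n n E) = t" .
    have "mat n n (\<lambda>(i, j). \<Sum>k<n. E (i, k) * (\<lambda>(i, j). M i j) (k, j)) = mat n n (\<lambda>(i, j). M' i j)"
      using EM by (intro eq_matI) auto
    then have detM': "det (mat n n (\<lambda>(i, j). M' i j)) = t * ?d"
      using det_mat_mult[of n E "\<lambda>(i, j). M i j"] detE by simp
    have "log_field (M' i)" if i: "i < n" for i
    proof (cases "i = p")
      case True
      have app: "apply_field (M' i) f = t * apply_field (M p) f" for f
        using True by (simp add: M'_def apply_field_def sum_distrib_left mult.assoc)
      show ?thesis
      proof (rule log_fieldI)
        show "apply_field (M' i) t \<in> V.filt 1"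
          unfolding app using M(2)[OF p(1) V.t(2)] V.t subalg_mult[OF V.ring] by (subst filt1) auto
        show "apply_field (M' i) f \<in> R" if "f \<in> R" for f
          unfolding app using M(2)[OF p(1) that] V.t subalg_mult[OF V.ring] by simp
        show "M' i j \<in> K" if "j < n" for j
          using True M(1)[OF p(1) that] V.t subalg_mult[OF V.ring] R_subset_K by (auto simp: M'_def)
      qed
    next
      case False
      have app: "apply_field (M' i) f = apply_field (M i) f + (- b i) * apply_field (M p) f" for f
        using False apply_field_linear[of 1 "M i" "- b i" "M p" f] by (simp add: M'_def)
      have minus_b: "- b i \<in> R"
        using b[OF i] subalg_minus[OF V.ring] by blast
      show ?thesis
      proof (rule log_fieldI)
        have "apply_field (M' i) t = 0"
          unfolding app using u by (simp add: b_def u_def)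
        then show "apply_field (M' i) t \<in> V.filt 1"
          using V.filt_zero by simp
        show "apply_field (M' i) f \<in> R" if "f \<in> R" for f
          unfolding app using M i p that minus_b by (intro subalg_add[OF V.ring] subalg_mult[OF V.ring]) auto
        show "M' i j \<in> K" if "j < n" for j
        proof -
          have "M i j + (- b i) * M p j \<in> R"
            using M i p that minus_b by (intro subalg_add[OF V.ring] subalg_mult[OF V.ring]) auto
          then show ?thesis
            using False R_subset_K by (auto simp: M'_def)
        qed
      qed
    qed
    moreover have "ord R (t * ?d) = 1 - ord R (jacobian r)"
      using V.ord_mult[of t ?d] V.t d ordd V.ord_uniformizer fractions_R by simp
    ultimately show ?thesis
      using that[of M'] detM' d V.t by simp
  qed
qed

text \<open>Logarithmic fields are closed under adding \<open>R\<close>-multiples, so the Hermite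
  normal form applies to them. The bound on the right is the log discrepancy, by
  \<open>log_discrepancy_eq\<close>.\<close>

lemma triangular_log_frame:
  assumes r: "canonical_generator \<iota> n R r"
  obtains T where "\<And>j. j < n \<Longrightarrow> log_field (T j)" "\<And>j. j < n \<Longrightarrow> T j j \<noteq> 0"
    "\<And>i j. i < n \<Longrightarrow> j < i \<Longrightarrow> T j i = 0" "(\<Sum>j<n. ord R (T j j)) \<le> 1 - ord R (jacobian r)"
proof -
  obtain M where M: "\<And>i. i < n \<Longrightarrow> log_field (M i)" "det (mat n n (\<lambda>(i, j). M i j)) \<noteq> 0"
    "ord R (det (mat n n (\<lambda>(i, j). M i j))) \<le> 1 - ord R (jacobian r)"
    using log_frame[OF r] by blast
  let ?d = "det (mat n n (\<lambda>(i, j). M i j))"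
  obtain T where T: "\<And>j. j < n \<Longrightarrow> log_field (T j) \<and> T j j \<noteq> 0 \<and> (\<forall>i<n. j < i \<longrightarrow> T j i = 0)"
    and dT: "?d / (\<Prod>j<n. T j j) \<in> R"
    using V.lattice_triangular[of n M "Collect log_field"] M(1,2) log_field_linear fractions_R
    by (auto simp: log_field_def)
  have TK: "T j j \<in> K \<and> T j j \<noteq> 0" if "j < n" for j
    using T[OF that] that by (simp add: log_field_def)
  have P: "(\<Prod>j<n. T j j) \<in> K" "(\<Prod>j<n. T j j) \<noteq> 0"
    using TK by (auto intro!: subalg_prod[OF K(2)])
  have d: "?d \<in> K"
    using M(1) by (intro subalg_det[OF K(2)]) (auto simp: log_field_def)
  have "ord R (\<Prod>j<n. T j j) \<le> ord R ?d"
    using dT V.mem_iff_ord[of "?d / (\<Prod>j<n. T j j)"] V.ord_divide[OF _ M(2), of "\<Prod>j<n. T j j"] P d M(2)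
      fractions_R subfield_divide[OF K(1)] by auto
  moreover have "ord R (\<Prod>j<n. T j j) = (\<Sum>j<n. ord R (T j j))"
    using TK fractions_R by (intro V.ord_prod) auto
  ultimately have "(\<Sum>j<n. ord R (T j j)) \<le> 1 - ord R (jacobian r)"
    using M(3) by simp
  then show ?thesis
    using that[of T] T by auto
qed

section \<open>The Wronskian bound\<close>

text \<open>The operator \<open>P\<close> is the composite \<open>D\<^sup>\<beta>\<close> of the derivations \<open>D\<^sub>j\<close> with coefficients \<open>T\<^sub>j\<^sub>i / T\<^sub>j\<^sub>j\<close>.\<close>

lemma triangular_operators:
  assumes T: "\<And>j. j < n \<Longrightarrow> log_field (T j)" "\<And>j. j < n \<Longrightarrow> T j j \<noteq> 0" "\<And>i j. i < n \<Longrightarrow> j < i \<Longrightarrow> T j i = 0"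
    and "\<beta> \<in> multi n N"
  shows "\<exists>P Q. operator (lower N \<beta>) Q \<and> (\<forall>f\<in>K. P f = dpow n \<beta> f + Q f) \<and>
    (\<forall>k. \<forall>f\<in>V.filt k. P f \<in> V.filt (k - (\<Sum>j<n. int (\<beta> j) * ord R (T j j))))"
  using assms(4)
proof (induction N arbitrary: \<beta>)
  case 0
  then have \<beta>: "\<beta> = (\<lambda>_. 0)"
    by (auto simp: multi_def fun_eq_iff) (metis lessThan_iff not_less)
  have "(\<Sum>j<n. int (\<beta> j) * ord R (T j j)) = 0"
    by (simp add: \<beta>)
  then show ?case
    using operator_zero by (intro exI[of _ "\<lambda>f. f"] exI[of _ "\<lambda>f. 0"]) (auto simp: \<beta> dpow_zero)
next
  case (Suc N)
  show ?case
  proof (cases "\<beta> \<in> multi n N")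
    case True
    have "lower N \<beta> \<subseteq> lower (Suc N) \<beta>"
      using multi_mono[of N "Suc N" n] by (auto simp: lower_def)
    from Suc.IH[OF True] obtain P Q where PQ: "operator (lower N \<beta>) Q" "\<forall>f\<in>K. P f = dpow n \<beta> f + Q f"
      "\<forall>k. \<forall>f\<in>V.filt k. P f \<in> V.filt (k - (\<Sum>j<n. int (\<beta> j) * ord R (T j j)))"
      by (elim exE conjE)
    from operator_mono[OF PQ(1) \<open>lower N \<beta> \<subseteq> _\<close> finite_lower] PQ(2,3) show ?thesis
      by (intro exI conjI)
  next
    case False
    have "\<exists>j<n. \<beta> j \<noteq> 0"
    proof (rule ccontr)
      assume "\<not> ?thesis"
      then show False
        using False Suc.prems by (auto simp: multi_def)
    qed
    then obtain j where j: "j < n" "\<beta> j \<noteq> 0"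
      by blast
    define \<beta>' where "\<beta>' = \<beta>(j := \<beta> j - 1)"
    have \<beta>: "\<beta> = \<beta>'(j := Suc (\<beta>' j))"
      using j by (simp add: \<beta>'_def)
    have "(\<Sum>i<n. \<beta> i) = (\<Sum>i<n. \<beta>' i) + 1"
      using sum_fun_upd_Suc[OF j(1), of "\<lambda>_. 1" \<beta>'] by (simp add: \<beta>[symmetric])
    then have "\<beta>' \<in> multi n N"
      using Suc.prems by (auto simp: multi_def \<beta>'_def)
    then obtain P Q where Q: "operator (lower N \<beta>') Q" and P: "\<And>f. f \<in> K \<Longrightarrow> P f = dpow n \<beta>' f + Q f"
      and filt: "\<And>k f. f \<in> V.filt k \<Longrightarrow> P f \<in> V.filt (k - (\<Sum>j<n. int (\<beta>' j) * ord R (T j j)))"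
      using Suc.IH by blast
    \<comment> \<open>Normalizing the coefficient of the partial derivative of index
      \<open>j\<close> to 1 keeps the leading term a pure derivative. The division lowers the
      filtration by the order of \<open>T j j\<close>; applying the logarithmic field itself costs
      nothing.\<close>
    define c where "c = (\<lambda>i. T j i / T j j)"
    have TK: "T j i \<in> K" if "i < n" for i
      using T(1)[OF j(1)] that by (simp add: log_field_def)
    have c: "c i \<in> K" if "i < n" for i
      using TK j that subfield_divide[OF K(1)] by (simp add: c_def)
    have c0: "c i = 0" if "i < n" "j < i" for i
      using T(3) that by (simp add: c_def)
    have cj: "c j = 1"
      using T(2)[OF j(1)] by (simp add: c_def)
    note D = K(1) derivation_apply_field[OF c]
    let ?L = "lower (Suc N) \<beta>"
    let ?Q = "\<lambda>f. apply_field c (Q f) + (\<Sum>i<j. c i * dpow n (\<beta>'(i := Suc (\<beta>' i))) f)"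
    have "operator ?L ?Q"
    proof (intro operator_add operator_sum)
      show "operator ?L (\<lambda>f. apply_field c (Q f))"
        using operator_deriv[OF Q j(1) c c0] by (simp add: \<beta>[symmetric])
      fix i assume "i \<in> {..<j}"
      then have i: "i < j" "i < n"
        using j by auto
      have "\<beta>'(i := Suc (\<beta>' i)) \<in> ?L"
        using multi_Suc[OF \<open>\<beta>' \<in> multi n N\<close> i(2)] weight_Suc[OF i(2), of \<beta>'] weight_Suc[OF j(1), of \<beta>'] i
        by (simp add: lower_def \<beta>[symmetric])
      then show "operator ?L (\<lambda>f. c i * dpow n (\<beta>'(i := Suc (\<beta>' i))) f)"
        using c i by (intro operator_single finite_lower) auto
    qed
    moreover have "apply_field c (P f) = dpow n \<beta> f + ?Q f" if f: "f \<in> K" for f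
    proof -
      have QK: "Q f \<in> K"
      proof -
        obtain q where "\<And>\<gamma>. \<gamma> \<in> lower N \<beta>' \<Longrightarrow> q \<gamma> \<in> K" "Q f = (\<Sum>\<gamma>\<in>lower N \<beta>'. q \<gamma> * dpow n \<gamma> f)"
          using Q f by (auto simp: operator_def)
        then show ?thesis
          using dpow_mem[of n f] f by (auto intro!: subalg_sum[OF K(2)] subalg_mult[OF K(2)])
      qed
      have "apply_field c (dpow n \<beta>' f) = (\<Sum>i<n. c i * dpow n (\<beta>'(i := Suc (\<beta>' i))) f)"
        using f by (auto simp: apply_field_def deriv_dpow intro!: sum.cong)
      also have "\<dots> = (\<Sum>i<Suc j. c i * dpow n (\<beta>'(i := Suc (\<beta>' i))) f)"
        using j c0 by (intro sum.mono_neutral_right) auto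
      also have "\<dots> = dpow n \<beta> f + (\<Sum>i<j. c i * dpow n (\<beta>'(i := Suc (\<beta>' i))) f)"
        by (simp add: cj \<beta>[symmetric])
      finally show ?thesis
        using P[OF f] deriv_add[OF D dpow_mem[OF order_refl f] QK] by simp
    qed
    moreover have "apply_field c (P f) \<in> V.filt (k - (\<Sum>j<n. int (\<beta> j) * ord R (T j j)))" if f: "f \<in> V.filt k" for k f
    proof -
      let ?s = "\<Sum>j<n. int (\<beta>' j) * ord R (T j j)"
      have "(\<Sum>i<n. int (\<beta> i) * ord R (T i i)) = (\<Sum>i<n. int (\<beta>' i) * ord R (T i i) + (if i = j then ord R (T i i) else 0))"
        by (intro sum.cong) (auto simp: \<beta> algebra_simps)
      then have s: "(\<Sum>i<n. int (\<beta> i) * ord R (T i i)) = ?s + ord R (T j j)"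
        using j by (simp add: sum.distrib)
      have "apply_field (T j) (P f) \<in> V.filt (k - ?s)"
        using T(1)[OF j(1)] filt[OF f] by (simp add: log_field_def)
      moreover have "inverse (T j j) \<in> V.filt (- ord R (T j j))"
        using V.filt_ord[of "inverse (T j j)"] V.ord_inverse[of "T j j"] T(2)[OF j(1)] TK[OF j(1)]
          fractions_R subfield_inverse[OF K(1)] by simp
      ultimately have "apply_field (T j) (P f) * inverse (T j j) \<in> V.filt (k - ?s + (- ord R (T j j)))"
        by (rule V.filt_mult)
      moreover have "apply_field c (P f) = apply_field (T j) (P f) * inverse (T j j)"
        by (simp add: apply_field_def c_def sum_distrib_left divide_inverse ac_simps)
      ultimately show ?thesis
        using s by (simp add: algebra_simps)
    qed
    ultimately show ?thesis
      by (intro exI[of _ "\<lambda>f. apply_field c (P f)"] exI[of _ ?Q]) blast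
  qed
qed

text \<open>The order of the Wronskian is squeezed. Rewritten with the operators \<open>P\<close>,
  it lies in \<open>filt\<close> at the difference of the two sums, by \<open>det_filt\<close>;
  times a determinant in \<open>R\<close> it becomes a nonzero constant, so its order is at most
  0.\<close>

lemma wronskian_bound:
  assumes T: "\<And>j. j < n \<Longrightarrow> log_field (T j)" "\<And>j. j < n \<Longrightarrow> T j j \<noteq> 0" "\<And>i j. i < n \<Longrightarrow> j < i \<Longrightarrow> T j i = 0"
    and B: "finite B" "B \<subseteq> K" "card B = card (multi n N)"
    and span: "\<And>\<gamma>. \<gamma> \<in> multi n N \<Longrightarrow> \<exists>c. mon \<gamma> = (\<Sum>s\<in>B. \<iota> (c s) * s)"
  shows "(\<Sum>s\<in>B. ord R s) \<le> (\<Sum>\<beta>\<in>multi n N. \<Sum>j<n. int (\<beta> j) * ord R (T j j))"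
proof -
  define d where "d = card B"
  obtain e where e: "bij_betw e {..<d} (multi n N)"
    using ex_bij_betw_nat_finite[OF finite_multi, of n N] B(3) by (auto simp: d_def atLeast0LessThan)
  obtain b where b: "bij_betw b {..<d} B"
    using ex_bij_betw_nat_finite[OF B(1)] by (auto simp: d_def atLeast0LessThan)
  have eM: "e i \<in> multi n N" and bB: "b i \<in> B" if "i < d" for i
    using bij_betwE[OF e] bij_betwE[OF b] that by auto
  let ?l = "\<lambda>\<beta>. \<Sum>j<n. int (\<beta> j) * ord R (T j j)"
  have "\<forall>\<beta>\<in>multi n N. \<exists>P Q. operator (lower N \<beta>) Q \<and> (\<forall>f\<in>K. P f = dpow n \<beta> f + Q f) \<and>
      (\<forall>k. \<forall>f\<in>V.filt k. P f \<in> V.filt (k - ?l \<beta>))"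
    by (rule ballI) (rule triangular_operators[OF T])
  from bchoice[OF this] obtain P where
    "\<forall>\<beta>\<in>multi n N. \<exists>Q. operator (lower N \<beta>) Q \<and> (\<forall>f\<in>K. P \<beta> f = dpow n \<beta> f + Q f) \<and>
      (\<forall>k. \<forall>f\<in>V.filt k. P \<beta> f \<in> V.filt (k - ?l \<beta>))" ..
  from bchoice[OF this] obtain Q where
    PQ: "\<forall>\<beta>\<in>multi n N. operator (lower N \<beta>) (Q \<beta>) \<and> (\<forall>f\<in>K. P \<beta> f = dpow n \<beta> f + Q \<beta> f) \<and>
      (\<forall>k. \<forall>f\<in>V.filt k. P \<beta> f \<in> V.filt (k - ?l \<beta>))" ..
  have Q: "operator (lower N \<beta>) (Q \<beta>)" and P: "f \<in> K \<Longrightarrow> P \<beta> f = dpow n \<beta> f + Q \<beta> f"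
    and filt: "f \<in> V.filt k \<Longrightarrow> P \<beta> f \<in> V.filt (k - ?l \<beta>)" if "\<beta> \<in> multi n N" for \<beta> f k
    using bspec[OF PQ that] by simp_all
  have "\<exists>c. (\<forall>\<gamma>\<in>lower N \<beta>. c \<gamma> \<in> K) \<and> (\<forall>f\<in>K. Q \<beta> f = (\<Sum>\<gamma>\<in>lower N \<beta>. c \<gamma> * dpow n \<gamma> f))" if "\<beta> \<in> multi n N" for \<beta>
    using Q[OF that] by (simp add: operator_def)
  then obtain q where q: "\<And>\<beta> f. \<beta> \<in> multi n N \<Longrightarrow> f \<in> K \<Longrightarrow> Q \<beta> f = (\<Sum>\<gamma>\<in>lower N \<beta>. q \<beta> \<gamma> * dpow n \<gamma> f)"
    by metis
  \<comment> \<open>The change from pure derivatives to the operators \<open>P\<close>; it is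
    unitriangular for \<open>weight\<close>.\<close>
  define C where "C = (\<lambda>(i, k). if k = i then 1 else if e k \<in> lower N (e i) then q (e i) (e k) else 0)"
  define W where "W = (\<lambda>(i, s). dpow n (e i) (b s))"
  have "det (mat d d C) = (\<Prod>i<d. C (i, i))"
    by (rule det_triangular_weight[where w = "\<lambda>i. int (weight (e i))"]) (auto simp: C_def lower_def split: if_splits)
  then have detC: "det (mat d d C) = 1"
    by (simp add: C_def)
  have expand: "(\<Sum>k<d. C (i, k) * W (k, s)) = P (e i) (b s)" if i: "i < d" and s: "s < d" for i s
  proof -
    have bs: "b s \<in> K"
      using bB[OF s] B(2) by auto
    have inj: "e k \<noteq> e i" if "k < d" "k \<noteq> i" for k
      using bij_betw_imp_inj_on[OF e] i that by (auto dest: inj_onD)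
    have "(\<Sum>k<d. C (i, k) * W (k, s)) = (\<Sum>k<d. (\<lambda>\<gamma>. ((if \<gamma> = e i then 1 else 0) + (if \<gamma> \<in> lower N (e i) then q (e i) \<gamma> else 0)) * dpow n \<gamma> (b s)) (e k))"
      using inj by (intro sum.cong) (auto simp: C_def W_def lower_def)
    also have "\<dots> = (\<Sum>\<gamma>\<in>multi n N. ((if \<gamma> = e i then 1 else 0) + (if \<gamma> \<in> lower N (e i) then q (e i) \<gamma> else 0)) * dpow n \<gamma> (b s))"
      by (rule sum.reindex_bij_betw[OF e])
    also have "\<dots> = (\<Sum>\<gamma>\<in>multi n N. if \<gamma> = e i then dpow n \<gamma> (b s) else 0) +
        (\<Sum>\<gamma>\<in>multi n N. if \<gamma> \<in> lower N (e i) then q (e i) \<gamma> * dpow n \<gamma> (b s) else 0)"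
      by (subst sum.distrib[symmetric]) (intro sum.cong; auto simp: distrib_right)
    also have "(\<Sum>\<gamma>\<in>multi n N. if \<gamma> = e i then dpow n \<gamma> (b s) else 0) = dpow n (e i) (b s)"
      using eM[OF i] finite_multi by simp
    also have "(\<Sum>\<gamma>\<in>multi n N. if \<gamma> \<in> lower N (e i) then q (e i) \<gamma> * dpow n \<gamma> (b s) else 0) = Q (e i) (b s)"
      unfolding q[OF eM[OF i] bs]
      by (subst sum.inter_restrict[OF finite_multi, symmetric]) (auto simp: lower_def intro!: sum.cong)
    finally show ?thesis
      using P[OF eM[OF i] bs] by simp
  qed
  have "mat d d (\<lambda>(i, s). \<Sum>k<d. C (i, k) * W (k, s)) = mat d d (\<lambda>(i, s). P (e i) (b s))"
    using expand by (intro eq_matI) auto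
  then have detW: "det (mat d d W) = det (mat d d (\<lambda>(i, s). P (e i) (b s)))"
    using det_mat_mult[of d C W] detC by simp
  have "det (mat d d (\<lambda>(i, s). P (e i) (b s))) \<in> V.filt ((\<Sum>i<d. - ?l (e i)) + (\<Sum>s<d. ord R (b s)))"
  proof (rule V.det_filt)
    fix i s assume "i < d" "s < d"
    then have "P (e i) (b s) \<in> V.filt (ord R (b s) - ?l (e i))"
      using eM bB B(2) fractions_R by (intro filt V.filt_ord) auto
    then show "(\<lambda>(i, s). P (e i) (b s)) (i, s) \<in> V.filt (- ?l (e i) + ord R (b s))"
      by (simp add: algebra_simps)
  qed
  then have Wfilt: "det (mat d d W) \<in> V.filt ((\<Sum>s\<in>B. ord R s) - (\<Sum>\<beta>\<in>multi n N. ?l \<beta>))"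
    using sum.reindex_bij_betw[OF e, of ?l] sum.reindex_bij_betw[OF b, of "ord R"]
    by (simp add: detW sum_negf)
  obtain c where c: "\<And>\<gamma>. \<gamma> \<in> multi n N \<Longrightarrow> mon \<gamma> = (\<Sum>s\<in>B. \<iota> (c \<gamma> s) * s)"
    using span by metis
  \<comment> \<open>Coordinates of the monomials with respect to \<open>B\<close>. The entries are
    constants, so the determinant lies in \<open>R\<close>; that it is nonzero comes out of the
    product \<open>W X = Y\<close>.\<close>
  define X where "X = (\<lambda>(s, k). \<iota> (c (e k) (b s)))"
  define Y where "Y = (\<lambda>(i, k). dpow n (e i) (mon (e k)))"
  have "(\<Sum>s<d. W (i, s) * X (s, k)) = Y (i, k)" if "i < d" "k < d" for i k
  proof -
    have "Y (i, k) = (\<Sum>s\<in>B. \<iota> (c (e k) s) * dpow n (e i) s)"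
      using c[OF eM[OF that(2)]] dpow_linear[OF order_refl B(1), of "e i" "c (e k)"] B(2) by (auto simp: Y_def)
    also have "\<dots> = (\<Sum>s<d. \<iota> (c (e k) (b s)) * dpow n (e i) (b s))"
      by (rule sum.reindex_bij_betw[OF b, symmetric])
    finally show ?thesis
      by (simp add: W_def X_def mult.commute)
  qed
  then have "mat d d (\<lambda>(i, k). \<Sum>s<d. W (i, s) * X (s, k)) = mat d d Y"
    by (intro eq_matI) auto
  then have WX: "det (mat d d W) * det (mat d d X) = det (mat d d Y)"
    using det_mat_mult[of d W X] by simp
  \<comment> \<open>A derivative of index \<alpha> kills the monomial of exponent \<gamma> unless
    \<alpha> \<le> \<gamma> componentwise. So \<open>Y\<close> is triangular for the negated degree,
    with products of factorials on the diagonal.\<close>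
  have "det (mat d d Y) = (\<Prod>i<d. Y (i, i))"
  proof (rule det_triangular_weight[where w = "\<lambda>i. - int (\<Sum>j<n. e i j)"])
    fix i k assume ik: "i < d" "k < d" "Y (i, k) \<noteq> 0"
    then have le: "e i j \<le> e k j" if "j < n" for j
      using dpow_mon_nonzero that by (auto simp: Y_def)
    show "i = k \<or> - int (\<Sum>j<n. e k j) < - int (\<Sum>j<n. e i j)"
    proof (cases "(\<Sum>j<n. e k j) \<le> (\<Sum>j<n. e i j)")
      case True
      then have "e i = e k"
        using multi_eqI[OF eM[OF ik(1)] eM[OF ik(2)] le] by simp
      then show ?thesis
        using bij_betw_imp_inj_on[OF e] ik by (auto dest: inj_onD)
    next
      case False
      then show ?thesis
        by (simp flip: of_nat_sum)
    qed
  qed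
  moreover have Yii: "Y (i, i) \<in> V.U" for i
  proof -
    obtain k where k: "k > 0" "dpow n (e i) (mon (e i)) = of_nat k"
      using dpow_mon_self by blast
    then show ?thesis
      using V.U_const[of "of_nat k"] by (simp add: Y_def const_of_nat)
  qed
  have "(\<Prod>i<k. Y (i, i)) \<in> V.U" for k
    using Yii by (induction k) (simp_all add: V.U_1 V.U_mult)
  ultimately have YU: "det (mat d d Y) \<in> V.U"
    by simp
  have XR: "det (mat d d X) \<in> R"
    using subalg_const[OF V.ring] by (intro subalg_det[OF V.ring]) (auto simp: X_def)
  then have XK: "det (mat d d X) \<in> V.K"
    using V.R_subset_K by blast
  have WK: "det (mat d d W) \<in> V.K"
    unfolding fractions_R using dpow_mem[of n] bB B(2) by (intro subalg_det[OF K(2)]) (auto simp: W_def)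
  have "det (mat d d Y) \<noteq> 0"
    using YU by (simp add: V.U_iff)
  then have nz: "det (mat d d W) \<noteq> 0" "det (mat d d X) \<noteq> 0"
    by (auto simp flip: WX)
  have "ord R (det (mat d d W)) + ord R (det (mat d d X)) = 0"
    using V.ord_mult[OF WK nz(1) XK nz(2)] V.ord_unit[OF YU] by (simp add: WX)
  moreover have "ord R (det (mat d d X)) \<ge> 0"
    using V.mem_iff_ord[OF XK nz(2)] XR by simp
  ultimately have "ord R (det (mat d d W)) \<le> 0"
    by simp
  then show ?thesis
    using Wfilt nz(1) by (simp add: V.filt_def)
qed

text \<open>Since \<open>\<Sum>\<^sub>\<beta> \<beta>\<^sub>j\<close> does not depend on \<open>j\<close>, the Wronskian bound sees the frame \<open>T\<close> only through the sum of the orders of the \<open>T\<^sub>j\<^sub>j\<close>.\<close>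

lemma sum_ord_basis_le:
  assumes r: "canonical_generator \<iota> n R r"
    and B: "finite B" "B \<subseteq> K" "card B = card (multi n N)"
    and span: "\<And>\<gamma>. \<gamma> \<in> multi n N \<Longrightarrow> \<exists>c. mon \<gamma> = (\<Sum>s\<in>B. \<iota> (c s) * s)"
  shows "int (n + 1) * (\<Sum>s\<in>B. ord R s) \<le> int (N * card B) * (1 - ord R (jacobian r))"
proof -
  obtain T where T: "\<And>j. j < n \<Longrightarrow> log_field (T j)" "\<And>j. j < n \<Longrightarrow> T j j \<noteq> 0"
    "\<And>i j. i < n \<Longrightarrow> j < i \<Longrightarrow> T j i = 0" "(\<Sum>j<n. ord R (T j j)) \<le> 1 - ord R (jacobian r)"
    using triangular_log_frame[OF r] by blast
  have "(\<Sum>\<beta>\<in>multi n N. \<Sum>j<n. int (\<beta> j) * ord R (T j j)) = (\<Sum>j<n. \<Sum>\<beta>\<in>multi n N. int (\<beta> j) * ord R (T j j))"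
    by (rule sum.swap)
  then have "int (n + 1) * (\<Sum>\<beta>\<in>multi n N. \<Sum>j<n. int (\<beta> j) * ord R (T j j)) =
      (\<Sum>j<n. int ((n + 1) * (\<Sum>\<beta>\<in>multi n N. \<beta> j)) * ord R (T j j))"
    by (simp only: sum_distrib_left sum_distrib_right of_nat_mult of_nat_sum mult.assoc)
  also have "\<dots> = (\<Sum>j<n. int (N * card B) * ord R (T j j))"
    using sum_multi[of _ n N] B(3) by (intro sum.cong) auto
  also have "\<dots> = int (N * card B) * (\<Sum>j<n. ord R (T j j))"
    by (simp add: sum_distrib_left)
  also have "\<dots> \<le> int (N * card B) * (1 - ord R (jacobian r))"
    using T(4) by (intro mult_left_mono) auto
  finally have bound: "int (n + 1) * (\<Sum>\<beta>\<in>multi n N. \<Sum>j<n. int (\<beta> j) * ord R (T j j))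
      \<le> int (N * card B) * (1 - ord R (jacobian r))" .
  have "int (n + 1) * (\<Sum>s\<in>B. ord R s) \<le> int (n + 1) * (\<Sum>\<beta>\<in>multi n N. \<Sum>j<n. int (\<beta> j) * ord R (T j j))"
    by (intro mult_left_mono wronskian_bound[OF T(1-3) B span]) auto
  then show ?thesis
    using bound by (rule order_trans)
qed

end

section \<open>Polynomials of bounded degree on a chart\<close>

context constants
begin

sublocale VS: vector_space "\<lambda>c x. \<iota> c * x"
  by unfold_locales (auto simp: const_add const_mult algebra_simps)

lemma span_mult:
  assumes "x \<in> VS.span S" "z \<in> VS.span T" "\<And>a b. a \<in> S \<Longrightarrow> b \<in> T \<Longrightarrow> a * b \<in> VS.span U"
  shows "x * z \<in> VS.span U"
  using assms(1)
proof (induction rule: VS.span_induct_alt)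
  case base
  then show ?case
    by (simp add: VS.span_zero)
next
  case (step c a x)
  have "a * z \<in> VS.span U"
    using assms(2)
  proof (induction rule: VS.span_induct_alt)
    case base
    then show ?case
      by (simp add: VS.span_zero)
  next
    case (step d b z)
    then have "\<iota> d * (a * b) + a * z \<in> VS.span U"
      using assms(3) \<open>a \<in> S\<close> by (intro VS.span_add VS.span_scale) auto
    then show ?case
      by (simp add: algebra_simps)
  qed
  then have "\<iota> c * (a * z) + x * z \<in> VS.span U"
    using step by (intro VS.span_add VS.span_scale)
  then show ?case
    by (simp add: algebra_simps)
qed

end

context chart
begin

definition pdeg :: "nat \<Rightarrow> 'a set" where
  "pdeg N = VS.span (mon ` multi n N)"

lemma pdeg_mon: "\<gamma> \<in> multi n N \<Longrightarrow> mon \<gamma> \<in> pdeg N"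
  by (auto simp: pdeg_def intro: VS.span_base)

lemma pdeg_mult: "x \<in> pdeg M \<Longrightarrow> z \<in> pdeg N \<Longrightarrow> x * z \<in> pdeg (M + N)"
proof -
  have "mon \<alpha> * mon \<beta> \<in> pdeg (M + N)" if "\<alpha> \<in> multi n M" "\<beta> \<in> multi n N" for \<alpha> \<beta>
    using that unfolding mon_mult[symmetric] by (intro pdeg_mon) (auto simp: multi_def sum.distrib)
  then show "x \<in> pdeg M \<Longrightarrow> z \<in> pdeg N \<Longrightarrow> x * z \<in> pdeg (M + N)"
    unfolding pdeg_def by (elim span_mult) auto
qed

lemma pdeg_mono: "M \<le> N \<Longrightarrow> pdeg M \<subseteq> pdeg N"
  unfolding pdeg_def by (intro VS.span_mono image_mono multi_mono)

lemma pdeg_const: "\<iota> c \<in> pdeg N"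
proof -
  have "\<iota> c * mon (\<lambda>_. 0) \<in> pdeg N"
    unfolding pdeg_def using zero_multi by (intro VS.span_scale VS.span_base) auto
  then show ?thesis
    by (simp add: mon_def)
qed

lemma pdeg_y: "l < n \<Longrightarrow> y l \<in> pdeg 1"
proof -
  assume l: "l < n"
  have "mon (\<lambda>i. if i = l then 1 else 0) = (\<Prod>i<n. if i = l then y i else 1)"
    unfolding mon_def by (intro prod.cong) auto
  then have "mon (\<lambda>i. if i = l then 1 else 0) = y l"
    using l by simp
  moreover have "(\<lambda>i. if i = l then 1 else 0) \<in> multi n 1"
    using l by (auto simp: multi_def)
  ultimately show ?thesis
    using pdeg_mon by metis
qed

lemma pdeg_power: "x \<in> pdeg N \<Longrightarrow> x ^ k \<in> pdeg (k * N)"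
  using pdeg_const[of 1] by (induction k) (auto intro: pdeg_mult)

lemma pdeg_prod: "(\<And>i. i \<in> I \<Longrightarrow> f i \<in> pdeg (N i)) \<Longrightarrow> prod f I \<in> pdeg (sum N I)"
  using pdeg_const[of 1] by (induction I rule: infinite_finite_induct) (auto intro: pdeg_mult)

lemma pdeg_subset_A: "pdeg N \<subseteq> A"
proof
  fix x assume "x \<in> pdeg N"
  then show "x \<in> A"
    unfolding pdeg_def
  proof (induction rule: VS.span_induct_alt)
    case (step c x z)
    then show ?case
      using mon_mem_A by (auto intro!: subalg_add[OF A] subalg_mult[OF A] subalg_const[OF A])
  qed (rule subalg_0[OF A])
qed

text \<open>The degree filtration exhausts the chart ring. The lower bound \<open>N\<close> can be
  prescribed so that later differences of degrees are not truncated.\<close>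

lemma A_pdeg:
  assumes "x \<in> A" obtains k where "k \<ge> N" "x \<in> pdeg k"
proof -
  have "subalgebra \<iota> (\<Union>k. pdeg k)"
    unfolding subalgebra_def
  proof (intro conjI ballI)
    show "range \<iota> \<subseteq> (\<Union>k. pdeg k)"
      using pdeg_const by auto
    fix x z assume "x \<in> (\<Union>k. pdeg k)" "z \<in> (\<Union>k. pdeg k)"
    then obtain a b where ab: "x \<in> pdeg a" "z \<in> pdeg b"
      by auto
    then show "x * z \<in> (\<Union>k. pdeg k)"
      using pdeg_mult by blast
    have "x \<in> pdeg (a + b)" "z \<in> pdeg (a + b)"
      using ab pdeg_mono[of a "a + b"] pdeg_mono[of b "a + b"] by auto
    then have "x + z \<in> pdeg (a + b)"
      by (simp add: pdeg_def VS.span_add)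
    then show "x + z \<in> (\<Union>k. pdeg k)"
      by blast
  qed
  moreover have "y ` {..<n} \<subseteq> (\<Union>k. pdeg k)"
    using pdeg_y by blast
  ultimately have "A \<subseteq> (\<Union>k. pdeg k)"
    by (rule adjoin_least)
  then obtain k where "x \<in> pdeg k"
    using assms by auto
  then show ?thesis
    using that[of "max N k"] pdeg_mono[of k "max N k"] by auto
qed

text \<open>A monomial is not killed by the derivative of its own index, so the exponents of equal
  monomials bound each other.\<close>

lemma mon_inj: "inj_on mon (multi n N)"
proof (rule inj_onI)
  fix \<alpha> \<gamma> assume *: "\<alpha> \<in> multi n N" "\<gamma> \<in> multi n N" "mon \<alpha> = mon \<gamma>"
  have nz: "dpow n \<gamma> (mon \<gamma>) \<noteq> 0" for \<gamma>
    using dpow_mon_self[of \<gamma>] of_nat_field_eq_0_iff by force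
  have "\<alpha> i \<le> \<gamma> i" "\<gamma> i \<le> \<alpha> i" if "i < n" for i
    using dpow_mon_nonzero[of \<alpha> \<gamma> i] dpow_mon_nonzero[of \<gamma> \<alpha> i] nz[of \<alpha>] nz[of \<gamma>] * that by simp_all
  then show "\<alpha> = \<gamma>"
    using multi_eqI[of \<alpha> N \<gamma> N] * sum_mono[of "{..<n}" \<gamma> \<alpha>] by auto
qed

text \<open>The derivative indexed by an exponent of maximal degree among the nonzero terms kills
  all other terms and leaves a nonzero multiple of its coefficient.\<close>

lemma mon_independent:
  assumes S: "finite S" "S \<subseteq> multi n N" and zero: "(\<Sum>\<gamma>\<in>S. \<iota> (c \<gamma>) * mon \<gamma>) = 0" and "\<gamma> \<in> S"
  shows "c \<gamma> = 0"
proof (rule ccontr)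
  assume "c \<gamma> \<noteq> 0"
  let ?T = "{\<gamma> \<in> S. c \<gamma> \<noteq> 0}"
  let ?deg = "\<lambda>\<gamma>. \<Sum>i<n. \<gamma> i"
  have "finite ?T" "?T \<noteq> {}"
    using S \<open>c \<gamma> \<noteq> 0\<close> \<open>\<gamma> \<in> S\<close> by auto
  then have "Max (?deg ` ?T) \<in> ?deg ` ?T"
    by (intro Max_in) auto
  then obtain \<beta> where \<beta>: "\<beta> \<in> ?T" "Max (?deg ` ?T) = ?deg \<beta>"
    by blast
  have max: "?deg \<gamma> \<le> ?deg \<beta>" if "\<gamma> \<in> ?T" for \<gamma>
    unfolding \<beta>(2)[symmetric] using that \<open>finite ?T\<close> by (intro Max_ge) auto
  have inj: "inj_on mon S"
    using mon_inj S(2) by (rule inj_on_subset)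
  \<comment> \<open>\<open>dpow_linear\<close> speaks of sums over sets of field elements, hence the
    coefficients are relabelled by the monomials.\<close>
  define c' where "c' = (\<lambda>s. c (inv_into S mon s))"
  have "(\<Sum>s\<in>mon ` S. \<iota> (c' s) * s) = (\<Sum>\<gamma>\<in>S. \<iota> (c \<gamma>) * mon \<gamma>)"
    unfolding sum.reindex[OF inj] using inj by (intro sum.cong) (auto simp: c'_def)
  then have "dpow n \<beta> (\<Sum>s\<in>mon ` S. \<iota> (c' s) * s) = 0"
    using zero dpow_linear[OF order_refl, of "{}" \<beta>] by simp
  then have "(\<Sum>s\<in>mon ` S. \<iota> (c' s) * dpow n \<beta> s) = 0"
    using dpow_linear[OF order_refl, of "mon ` S" \<beta> c'] S mon_mem_K by auto
  then have "(\<Sum>\<gamma>\<in>S. \<iota> (c \<gamma>) * dpow n \<beta> (mon \<gamma>)) = 0"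
    unfolding sum.reindex[OF inj] using inj by (simp add: c'_def)
  also have "(\<Sum>\<gamma>\<in>S. \<iota> (c \<gamma>) * dpow n \<beta> (mon \<gamma>)) = (\<Sum>\<gamma>\<in>{\<beta>}. \<iota> (c \<gamma>) * dpow n \<beta> (mon \<gamma>))"
  proof (rule sum.mono_neutral_right)
    show "\<forall>\<gamma>\<in>S - {\<beta>}. \<iota> (c \<gamma>) * dpow n \<beta> (mon \<gamma>) = 0"
    proof
      fix \<gamma> assume \<gamma>: "\<gamma> \<in> S - {\<beta>}"
      show "\<iota> (c \<gamma>) * dpow n \<beta> (mon \<gamma>) = 0"
      proof (rule ccontr)
        assume nz: "\<iota> (c \<gamma>) * dpow n \<beta> (mon \<gamma>) \<noteq> 0"
        then have "\<beta> = \<gamma>"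
          using \<gamma> \<beta> S(2) max dpow_mon_nonzero[of \<beta> \<gamma>] by (intro multi_eqI[of \<beta> N \<gamma> N]) auto
        then show False
          using \<gamma> by simp
      qed
    qed
  qed (use S \<beta> in auto)
  finally have "\<iota> (c \<beta>) * dpow n \<beta> (mon \<beta>) = 0"
    by simp
  then show False
    using \<beta> dpow_mon_self[of \<beta>] of_nat_field_eq_0_iff by force
qed

lemma independent_scaled_mon:
  assumes "h \<noteq> 0"
  shows "VS.independent ((\<lambda>\<gamma>. h * mon \<gamma>) ` multi n N)"
    and "card ((\<lambda>\<gamma>. h * mon \<gamma>) ` multi n N) = card (multi n N)"
proof -
  let ?f = "\<lambda>\<gamma>. h * mon \<gamma>"
  have inj: "inj_on ?f (multi n N)"
    using mon_inj[of N] assms by (auto simp: inj_on_def)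
  then show "card (?f ` multi n N) = card (multi n N)"
    by (rule card_image)
  show "VS.independent (?f ` multi n N)"
  proof (rule VS.independent_if_scalars_zero)
    show "finite (?f ` multi n N)"
      using finite_multi by auto
    fix u x assume u: "(\<Sum>x\<in>?f ` multi n N. \<iota> (u x) * x) = 0" and x: "x \<in> ?f ` multi n N"
    obtain \<gamma> where \<gamma>: "\<gamma> \<in> multi n N" "x = h * mon \<gamma>"
      using x by auto
    have "(\<Sum>x\<in>?f ` multi n N. \<iota> (u x) * x) = h * (\<Sum>\<gamma>\<in>multi n N. \<iota> (u (?f \<gamma>)) * mon \<gamma>)"
      by (subst sum.reindex[OF inj]) (simp add: sum_distrib_left ac_simps)
    then have "(\<Sum>\<gamma>\<in>multi n N. \<iota> (u (?f \<gamma>)) * mon \<gamma>) = 0"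
      using u assms by simp
    then show "u x = 0"
      using mon_independent[OF finite_multi subset_refl, where c = "\<lambda>\<gamma>. u (?f \<gamma>)"] \<gamma> by blast
  qed
qed

lemma pdeg_iff: "x \<in> pdeg N \<longleftrightarrow> (\<exists>c. x = (\<Sum>\<gamma>\<in>multi n N. \<iota> (c \<gamma>) * mon \<gamma>))"
proof
  assume "x \<in> pdeg N"
  then obtain u where "x = (\<Sum>s\<in>mon ` multi n N. \<iota> (u s) * s)"
    using VS.span_finite[of "mon ` multi n N"] finite_multi by (auto simp: pdeg_def)
  then show "\<exists>c. x = (\<Sum>\<gamma>\<in>multi n N. \<iota> (c \<gamma>) * mon \<gamma>)"
    unfolding sum.reindex[OF mon_inj] by (intro exI[of _ "\<lambda>\<gamma>. u (mon \<gamma>)"]) simp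
next
  assume "\<exists>c. x = (\<Sum>\<gamma>\<in>multi n N. \<iota> (c \<gamma>) * mon \<gamma>)"
  then show "x \<in> pdeg N"
    using pdeg_mon by (auto simp: pdeg_def intro!: VS.span_sum VS.span_scale)
qed

text \<open>Multiplication with \<open>y l ^ e\<close> shifts exponents injectively and raises
  degrees by exactly \<open>e\<close>. Comparing the two expansions of the product, independence of
  the monomials removes all coefficients of \<open>f\<close> in degrees above
  \<open>M\<close>.\<close>

lemma pdeg_cancel_y:
  assumes l: "l < n" and f: "f \<in> A" and deg: "y l ^ e * f \<in> pdeg (M + e)"
  shows "f \<in> pdeg M"
proof -
  obtain L where L: "f \<in> pdeg L" "L \<ge> M"
    using A_pdeg[OF f] by blast
  then obtain c where c: "f = (\<Sum>\<gamma>\<in>multi n L. \<iota> (c \<gamma>) * mon \<gamma>)"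
    using pdeg_iff by blast
  obtain d where d: "y l ^ e * f = (\<Sum>\<gamma>\<in>multi n (M + e). \<iota> (d \<gamma>) * mon \<gamma>)"
    using deg pdeg_iff by blast
  let ?s = "\<lambda>\<gamma>. \<gamma>(l := \<gamma> l + e)"
  have s: "mon (?s \<gamma>) = y l ^ e * mon \<gamma>" for \<gamma>
  proof -
    have "?s \<gamma> = (\<lambda>i. (if i = l then e else 0) + \<gamma> i)"
      by auto
    moreover have "mon (\<lambda>i. if i = l then e else 0) = (\<Prod>i<n. if i = l then y i ^ e else 1)"
      unfolding mon_def by (intro prod.cong) auto
    ultimately show ?thesis
      using l by (simp add: mon_mult)
  qed
  have deg_s: "(\<Sum>i<n. ?s \<gamma> i) = (\<Sum>i<n. \<gamma> i) + e" for \<gamma>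
  proof -
    have "(\<Sum>i<n. ?s \<gamma> i) = (\<Sum>i<n. \<gamma> i + (if i = l then e else 0))"
      by (intro sum.cong) auto
    then show ?thesis
      using l by (simp add: sum.distrib)
  qed
  have inj: "inj ?s"
    by (rule injI) (metis add_right_cancel fun_upd_same fun_upd_triv fun_upd_upd)
  have sL: "?s ` multi n L \<subseteq> multi n (L + e)"
    using deg_s l by (auto simp: multi_def)
  \<comment> \<open>Coefficients of the difference of the two expansions of
    \<open>y l ^ e * f\<close>: the shifted expansion of \<open>f\<close> minus the given
    one.\<close>
  define a where "a = (\<lambda>\<gamma>. (if \<gamma> \<in> ?s ` multi n L then c (inv_into UNIV ?s \<gamma>) else 0) - (if \<gamma> \<in> multi n (M + e) then d \<gamma> else 0))"
  have "(\<Sum>\<gamma>\<in>multi n (L + e). \<iota> (a \<gamma>) * mon \<gamma>) =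
      (\<Sum>\<gamma>\<in>multi n (L + e). if \<gamma> \<in> ?s ` multi n L then \<iota> (c (inv_into UNIV ?s \<gamma>)) * mon \<gamma> else 0) -
      (\<Sum>\<gamma>\<in>multi n (L + e). if \<gamma> \<in> multi n (M + e) then \<iota> (d \<gamma>) * mon \<gamma> else 0)"
    by (subst sum_subtractf[symmetric])
       (auto intro!: sum.cong simp: a_def const_minus const_add diff_conv_add_uminus distrib_right simp del: add_uminus_conv_diff)
  also have "(\<Sum>\<gamma>\<in>multi n (L + e). if \<gamma> \<in> ?s ` multi n L then \<iota> (c (inv_into UNIV ?s \<gamma>)) * mon \<gamma> else 0) =
      (\<Sum>\<gamma>\<in>?s ` multi n L. \<iota> (c (inv_into UNIV ?s \<gamma>)) * mon \<gamma>)"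
    using sL by (subst sum.inter_restrict[OF finite_multi, symmetric]) (auto intro!: sum.cong)
  also have "\<dots> = (\<Sum>\<gamma>\<in>multi n L. \<iota> (c \<gamma>) * mon (?s \<gamma>))"
    by (subst sum.reindex[OF inj_on_subset[OF inj]]) (auto simp: inv_f_f[OF inj])
  also have "\<dots> = y l ^ e * f"
    by (simp only: s) (simp add: c sum_distrib_left ac_simps)
  also have "(\<Sum>\<gamma>\<in>multi n (L + e). if \<gamma> \<in> multi n (M + e) then \<iota> (d \<gamma>) * mon \<gamma> else 0) = y l ^ e * f"
    unfolding d using multi_mono[of "M + e" "L + e" n] L(2)
    by (subst sum.inter_restrict[OF finite_multi, symmetric]) (auto intro!: sum.cong)
  finally have zero: "(\<Sum>\<gamma>\<in>multi n (L + e). \<iota> (a \<gamma>) * mon \<gamma>) = 0"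
    by simp
  have "c \<gamma> = 0" if \<gamma>: "\<gamma> \<in> multi n L" "\<gamma> \<notin> multi n M" for \<gamma>
  proof -
    have "a (?s \<gamma>) = 0"
      using mon_independent[OF finite_multi _ zero] sL \<gamma>(1) by blast
    moreover have "?s \<gamma> \<notin> multi n (M + e)"
      using \<gamma> deg_s[of \<gamma>] by (auto simp: multi_def)
    ultimately show ?thesis
      using \<gamma>(1) by (simp add: a_def inv_f_f[OF inj])
  qed
  then have "f = (\<Sum>\<gamma>\<in>multi n M. \<iota> (c \<gamma>) * mon \<gamma>)"
    unfolding c using multi_mono[OF L(2)] finite_multi by (intro sum.mono_neutral_right) auto
  then show ?thesis
    using pdeg_iff by blast
qed

end

section \<open>Derivations of the field of rational functions\<close>

text \<open>If variable \<open>j\<close> does not occur in \<open>m\<close>, the truncated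
  subtraction leaves the exponent unchanged, but then the coefficient is 0.\<close>

definition monomial_deriv :: "nat \<Rightarrow> (nat \<Rightarrow>\<^sub>0 nat) \<Rightarrow> complex \<Rightarrow> ((nat \<Rightarrow>\<^sub>0 nat) \<Rightarrow>\<^sub>0 complex)" where
  "monomial_deriv j m a = Poly_Mapping.single (m - Poly_Mapping.single j 1) (of_nat (Poly_Mapping.lookup m j) * a)"

definition poly_deriv :: "nat \<Rightarrow> ((nat \<Rightarrow>\<^sub>0 nat) \<Rightarrow>\<^sub>0 complex) \<Rightarrow> ((nat \<Rightarrow>\<^sub>0 nat) \<Rightarrow>\<^sub>0 complex)" where
  "poly_deriv j p = (\<Sum>m\<in>Poly_Mapping.keys p. monomial_deriv j m (Poly_Mapping.lookup p m))"

lemma poly_deriv_add: "poly_deriv j (p + q) = poly_deriv j p + poly_deriv j q"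
  unfolding poly_deriv_def
  by (rule setsum_keys_plus_distrib) (auto simp: monomial_deriv_def single_add distrib_left)

lemma poly_deriv_single: "poly_deriv j (Poly_Mapping.single m a) = monomial_deriv j m a"
  by (auto simp: poly_deriv_def monomial_deriv_def)

lemma poly_mapping_induct_add:
  assumes "P 0" "\<And>m a p. P p \<Longrightarrow> P (Poly_Mapping.single m a + p)"
  shows "P (p :: 'a \<Rightarrow>\<^sub>0 'b::comm_monoid_add)"
proof (induction p rule: update_induct)
  case (update p m a)
  then have "Poly_Mapping.update m a p = Poly_Mapping.single m a + p"
    by (intro poly_mapping_eqI) (auto simp: lookup_update lookup_add lookup_single when_def in_keys_iff)
  then show ?case
    using assms(2) update by metis
qed (fact assms(1))

lemma monomial_deriv_mult:
  "monomial_deriv j (m + k) (a * b) =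
    monomial_deriv j m a * Poly_Mapping.single k b + Poly_Mapping.single m a * monomial_deriv j k b"
proof -
  let ?e = "Poly_Mapping.single j (1::nat)"
  have shift: "m + k - ?e = (m - ?e) + k" if "Poly_Mapping.lookup m j > 0" for m k :: "nat \<Rightarrow>\<^sub>0 nat"
    using that by (intro poly_mapping_eqI) (auto simp: lookup_add lookup_minus lookup_single when_def)
  have "monomial_deriv j m a * Poly_Mapping.single k b =
      Poly_Mapping.single (m + k - ?e) (of_nat (Poly_Mapping.lookup m j) * (a * b))"
    using shift[of m k] by (cases "Poly_Mapping.lookup m j = 0") (auto simp: monomial_deriv_def mult_single mult.assoc)
  moreover have "Poly_Mapping.single m a * monomial_deriv j k b =
      Poly_Mapping.single (m + k - ?e) (of_nat (Poly_Mapping.lookup k j) * (a * b))"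
    using shift[of k m] by (cases "Poly_Mapping.lookup k j = 0") (auto simp: monomial_deriv_def mult_single add.commute mult.left_commute)
  ultimately show ?thesis
    by (simp add: monomial_deriv_def lookup_add distrib_right flip: single_add)
qed

lemma poly_deriv_mult: "poly_deriv j (p * q) = poly_deriv j p * q + p * poly_deriv j q"
proof (induction p rule: poly_mapping_induct_add)
  case 1
  then show ?case
    by (simp add: poly_deriv_def)
next
  case (2 m a p)
  have "poly_deriv j (Poly_Mapping.single m a * q) =
      poly_deriv j (Poly_Mapping.single m a) * q + Poly_Mapping.single m a * poly_deriv j q"
  proof (induction q rule: poly_mapping_induct_add)
    case 1
    then show ?case
      by (simp add: poly_deriv_def)
  next
    case (2 k b q)
    then show ?case
      by (simp add: distrib_left poly_deriv_add mult_single poly_deriv_single monomial_deriv_mult)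
  qed
  then show ?case
    using 2 by (simp add: distrib_left distrib_right poly_deriv_add)
qed

text \<open>The quotient rule on some representative; independence of the choice is shown in
  \<open>fract_deriv_Fract\<close>.\<close>

definition fract_deriv :: "('b::idom \<Rightarrow> 'b) \<Rightarrow> 'b fract \<Rightarrow> 'b fract" where
  "fract_deriv d q = (SOME r. \<exists>a b. b \<noteq> 0 \<and> q = Fract a b \<and> r = Fract (d a * b - a * d b) (b * b))"

text \<open>The second hypothesis is the derivative of the first, and the difference of the two
  sides is a combination of both.\<close>

lemma quotient_rule_welldefined:
  fixes a b a' b' x y x' y' :: "'b::idom"
  assumes "a * b' = a' * b" "x * b' + a * y' = x' * b + a' * y"
  shows "(x' * b' - a' * y') * (b * b) = (x * b - a * y) * (b' * b')"
proof -
  have "(x' * b' - a' * y') * (b * b) - (x * b - a * y) * (b' * b') =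
      (b * y' + y * b') * (a * b' - a' * b) - b * b' * (x * b' + a * y' - (x' * b + a' * y))"
    by (simp add: algebra_simps)
  then show ?thesis
    using assms by simp
qed

context
  fixes d :: "'b::idom \<Rightarrow> 'b"
  assumes d_add: "d (x + z) = d x + d z" and d_mult: "d (x * z) = d x * z + x * d z"
begin

lemma fract_deriv_Fract:
  assumes "b \<noteq> 0"
  shows "fract_deriv d (Fract a b) = Fract (d a * b - a * d b) (b * b)"
  unfolding fract_deriv_def
proof (rule some_equality)
  fix r assume "\<exists>a' b'. b' \<noteq> 0 \<and> Fract a b = Fract a' b' \<and> r = Fract (d a' * b' - a' * d b') (b' * b')"
  then obtain a' b' where b': "b' \<noteq> 0" and eq: "Fract a b = Fract a' b'" and r: "r = Fract (d a' * b' - a' * d b') (b' * b')"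
    by blast
  have e: "a * b' = a' * b"
    using eq assms b' by (simp add: eq_fract)
  have "d a * b' + a * d b' = d a' * b + a' * d b"
    using arg_cong[OF e, of d] by (simp add: d_mult)
  with e have "(d a' * b' - a' * d b') * (b * b) = (d a * b - a * d b) * (b' * b')"
    by (rule quotient_rule_welldefined)
  then show "r = Fract (d a * b - a * d b) (b * b)"
    using r assms b' by (simp add: eq_fract)
qed (use assms in blast)

lemma fract_deriv_add: "fract_deriv d (p + q) = fract_deriv d p + fract_deriv d q"
proof -
  obtain a b where p: "p = Fract a b" "b \<noteq> 0"
    by (cases p) auto
  obtain a' b' where q: "q = Fract a' b'" "b' \<noteq> 0"
    by (cases q) auto
  show ?thesis
    using p q by (simp add: fract_deriv_Fract eq_fract d_add d_mult) (simp add: algebra_simps)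
qed

lemma fract_deriv_mult: "fract_deriv d (p * q) = fract_deriv d p * q + p * fract_deriv d q"
proof -
  obtain a b where p: "p = Fract a b" "b \<noteq> 0"
    by (cases p) auto
  obtain a' b' where q: "q = Fract a' b'" "b' \<noteq> 0"
    by (cases q) auto
  show ?thesis
    using p q by (simp add: fract_deriv_Fract eq_fract d_add d_mult) (simp add: algebra_simps)
qed

end

definition ratfun_deriv :: "nat \<Rightarrow> ratfun \<Rightarrow> ratfun" where
  "ratfun_deriv j = fract_deriv (poly_deriv j)"

interpretation ratfun: constants const
proof
  show "const (a + b) = const a + const b" "const (a * b) = const a * const b" for a b
    by (simp_all add: const_def single_add mult_single)
  show "const 1 = 1"
    by (simp add: const_def One_fract_def)
qed

lemma ratfun_deriv_const: "ratfun_deriv j (const c) = 0"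
  unfolding ratfun_deriv_def const_def
  by (subst fract_deriv_Fract[where d = "poly_deriv j", OF poly_deriv_add poly_deriv_mult])
     (auto simp: poly_deriv_single monomial_deriv_def Zero_fract_def eq_fract poly_deriv_single[of j 0 1, simplified])

lemma derivation_ratfun_deriv: "derivation const UNIV (ratfun_deriv j)"
  using fract_deriv_add[where d = "poly_deriv j", OF poly_deriv_add poly_deriv_mult]
    fract_deriv_mult[where d = "poly_deriv j", OF poly_deriv_add poly_deriv_mult] ratfun_deriv_const by (auto simp: derivation_def ratfun_deriv_def)

lemma ratfun_deriv_coord: "ratfun_deriv j (coord i) = (if i = j then 1 else 0)"
proof -
  have "poly_deriv j (Poly_Mapping.single (Poly_Mapping.single i 1) 1) = (if i = j then 1 else 0)"
    by (simp add: poly_deriv_single monomial_deriv_def lookup_single)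
  moreover have "poly_deriv j 1 = 0"
    using poly_deriv_single[of j 0 1] by (simp add: monomial_deriv_def)
  ultimately show ?thesis
    unfolding ratfun_deriv_def coord_def
    by (subst fract_deriv_Fract[where d = "poly_deriv j", OF poly_deriv_add poly_deriv_mult])
       (auto simp: One_fract_def Zero_fract_def eq_fract)
qed

lemma coord_nonzero: "coord i \<noteq> 0"
  using ratfun_deriv_coord[of i i] ratfun.deriv_0[OF ratfun.subfield_UNIV derivation_ratfun_deriv[of i]] by auto

section \<open>The standard charts of projective space\<close>

text \<open>Chart \<open>i\<close> has no use for the constant x_i/x_i; its slot is taken by
  x_n/x_i. So every chart is indexed by the numbers below \<open>n\<close>, and chart
  \<open>n\<close> keeps the natural order.\<close>

definition chart_index :: "nat \<Rightarrow> nat \<Rightarrow> nat \<Rightarrow> nat" where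
  "chart_index n i l = (if l = i then n else l)"

definition affine_coord :: "nat \<Rightarrow> nat \<Rightarrow> nat \<Rightarrow> ratfun" where
  "affine_coord n i l = coord (chart_index n i l) / coord i"

text \<open>Differentiating x_k/x_i by x_k gives 1/x_i, which the factor \<open>coord i\<close>
  corrects. The result is the affine partial derivative, extended to the whole ambient
  field.\<close>

definition affine_deriv :: "nat \<Rightarrow> nat \<Rightarrow> nat \<Rightarrow> ratfun \<Rightarrow> ratfun" where
  "affine_deriv n i l f = coord i * ratfun_deriv (chart_index n i l) f"

lemma ratfun_deriv_quotient:
  "ratfun_deriv j (coord a / coord b) = (if a = j then 1 / coord b else 0) - (if b = j then coord a / (coord b)\<^sup>2 else 0)"
  using ratfun.deriv_divide[OF ratfun.subfield_UNIV derivation_ratfun_deriv, of "coord a" "coord b" j] coord_nonzero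
  by (auto simp: ratfun_deriv_coord power2_eq_square field_simps)

lemma chart_projective:
  assumes "i \<le> n"
  shows "chart const n (affine_coord n i) (affine_deriv n i)"
proof
  show "derivation const UNIV (affine_deriv n i l)" for l
    using derivation_ratfun_deriv[of "chart_index n i l"]
    by (auto simp: derivation_def affine_deriv_def algebra_simps)
  show "affine_deriv n i l (affine_coord n i k) = (if l = k then 1 else 0)" if "l < n" "k < n" for l k
    using that assms coord_nonzero[of i]
    by (auto simp: affine_deriv_def affine_coord_def ratfun_deriv_quotient chart_index_def)
qed

abbreviation affine :: "nat \<Rightarrow> nat \<Rightarrow> ratfun set" where
  "affine n i \<equiv> adjoin const (affine_coord n i ` {..<n})"

lemma subalgebra_affine: "subalgebra const (affine n i)"
  by (rule ratfun.subalgebra_adjoin)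

lemma coord_quotient_affine:
  assumes "i \<le> n" "j \<le> n"
  shows "coord j / coord i \<in> affine n i"
proof (cases "j = i")
  case True
  then show ?thesis
    using coord_nonzero ratfun.subalg_1[OF subalgebra_affine] by simp
next
  case False
  define l where "l = (if j = n then i else j)"
  have "l < n" "affine_coord n i l = coord j / coord i"
    using assms False by (auto simp: l_def affine_coord_def chart_index_def)
  then show ?thesis
    using ratfun.adjoin_superset[of "affine_coord n i ` {..<n}"] by force
qed

lemma adjoin_quotients_eq_affine:
  assumes "i \<le> n"
  shows "adjoin const {coord j / coord i | j. j \<le> n} = affine n i"
proof
  show "adjoin const {coord j / coord i | j. j \<le> n} \<subseteq> affine n i"
    using coord_quotient_affine[OF assms] by (intro ratfun.adjoin_least subalgebra_affine) auto
  show "affine n i \<subseteq> adjoin const {coord j / coord i | j. j \<le> n}"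
    by (intro ratfun.adjoin_mono) (auto simp: affine_coord_def chart_index_def)
qed

lemma affine_least:
  assumes "i \<le> n" "subalgebra const B" "\<And>j. j \<le> n \<Longrightarrow> coord j / coord i \<in> B"
  shows "affine n i \<subseteq> B"
  unfolding adjoin_quotients_eq_affine[OF assms(1), symmetric] using assms by (intro ratfun.adjoin_least) auto

lemma proj_space_eq: "proj_space n = (\<Union>i\<le>n. spec (affine n i))"
  unfolding proj_space_def by (simp add: adjoin_quotients_eq_affine)

lemma fractions_affine:
  assumes "i \<le> n" "k \<le> n"
  shows "fractions (affine n i) = fractions (affine n k)"
proof -
  have "fractions (affine n i) \<subseteq> fractions (affine n k)" if "i \<le> n" "k \<le> n" for i k
  proof (rule ratfun.fractions_least)
    note F = ratfun.subfield_fractions[OF subalgebra_affine[of n k]]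
    show "ratfun.subfield (fractions (affine n k))"
      by (rule F)
    show "affine n i \<subseteq> fractions (affine n k)"
    proof (rule affine_least[OF that(1) ratfun.subfieldD[OF F]])
      fix j assume "j \<le> n"
      then have "(coord j / coord k) / (coord i / coord k) \<in> fractions (affine n k)"
        using that coord_nonzero by (intro ratfun.fractionsI coord_quotient_affine subalgebra_affine) auto
      then show "coord j / coord i \<in> fractions (affine n k)"
        using coord_nonzero by simp
    qed
  qed
  then show ?thesis
    using assms by blast
qed

section \<open>Points of projective space\<close>

abbreviation ratfun_field :: "nat \<Rightarrow> ratfun set" where
  "ratfun_field n \<equiv> fractions (affine n n)"

lemma fractions_affine_eq: "i \<le> n \<Longrightarrow> fractions (affine n i) = ratfun_field n"
  by (rule fractions_affine) auto

lemma proj_space_cases: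
  assumes "R \<in> proj_space n"
  obtains i P where "i \<le> n" "prime_ideal (affine n i) P" "R = localization (affine n i) P" "R \<in> spec (affine n i)"
proof -
  obtain i where i: "i \<le> n" "R \<in> spec (affine n i)"
    using assms unfolding proj_space_eq by auto
  obtain P where "prime_ideal (affine n i) P" "R = localization (affine n i) P"
    using i(2) unfolding spec_def by auto
  then show ?thesis
    using that i by simp
qed

lemma spec_affine_subset_proj_space: "i \<le> n \<Longrightarrow> spec (affine n i) \<subseteq> proj_space n"
  unfolding proj_space_eq by blast

lemma fractions_proj_point:
  assumes "R \<in> proj_space n" shows "fractions R = ratfun_field n"
proof -
  obtain i where "i \<le> n" "R \<in> spec (affine n i)"
    using assms by (rule proj_space_cases)
  then show ?thesis
    using ratfun.fractions_spec[OF subalgebra_affine] fractions_affine_eq by metis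
qed

lemma subalgebra_proj_point:
  assumes "R \<in> proj_space n" shows "subalgebra const R"
proof -
  obtain i where "R \<in> spec (affine n i)"
    using assms by (rule proj_space_cases)
  then show ?thesis
    by (rule ratfun.subalgebra_spec[OF subalgebra_affine])
qed

lemma function_field_proj_space: "function_field (proj_space n) = ratfun_field n"
proof -
  have "localization (affine n n) {0} \<in> proj_space n"
    using spec_affine_subset_proj_space[of n n] ratfun.prime_ideal_zero[OF subalgebra_affine]
    by (auto simp: spec_def)
  then have "ratfun_field n \<subseteq> function_field (proj_space n)"
    using fractions_proj_point by (fastforce simp: function_field_def)
  moreover have "function_field (proj_space n) \<subseteq> ratfun_field n"
    using fractions_proj_point by (auto simp: function_field_def)
  ultimately show ?thesis
    by auto
qed

text \<open>The ratio x_i/x_j lies in one chart ring and its inverse in the other, both inside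
  \<open>V\<close>; so it is a unit of \<open>V\<close> and not in \<open>Q\<close>. Hence the ring
  of chart \<open>i\<close> is contained in the local ring on chart \<open>j\<close>, and
  denominators outside \<open>P\<close>, being units of \<open>V\<close>, become invertible
  there.\<close>

lemma localization_subset_of_common_domination:
  assumes ij: "i \<le> n" "j \<le> n" and V: "subalgebra const V"
    and P: "prime_ideal (affine n i) P" and Q: "prime_ideal (affine n j) Q"
    and R: "dominates V (localization (affine n i) P)" and S: "dominates V (localization (affine n j) Q)"
  shows "localization (affine n i) P \<subseteq> localization (affine n j) Q"
proof -
  let ?A = "affine n i" and ?B = "affine n j"
  let ?S = "localization ?B Q"
  note A = subalgebra_affine[of n i] and B = subalgebra_affine[of n j]
  note SA = ratfun.subalgebra_localization[OF B Q]
  note dA = ratfun.dominates_localizationD[OF A P V R] and dB = ratfun.dominates_localizationD[OF B Q V S]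
  have unit: "x \<notin> nonunits V \<longleftrightarrow> x \<noteq> 0 \<and> inverse x \<in> V" if "x \<in> V" for x
    using that by (auto simp: nonunits_def)
  have u: "coord i / coord j \<in> ?B" "coord j / coord i \<in> V"
    using coord_quotient_affine ij dA(1) by blast+
  then have "coord i / coord j \<notin> nonunits V"
    using unit[of "coord i / coord j"] dB(1) coord_nonzero by (auto simp: inverse_eq_divide)
  then have uQ: "coord i / coord j \<notin> Q"
    using dB(2) by blast
  have AS: "?A \<subseteq> ?S"
  proof (rule affine_least[OF ij(1) SA])
    fix k assume "k \<le> n"
    then have "(coord k / coord j) / (coord i / coord j) \<in> ?S"
      using u uQ coord_quotient_affine[OF ij(2)] by (intro ratfun.localizationI[OF B Q]) auto
    then show "coord k / coord i \<in> ?S"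
      using coord_nonzero by simp
  qed
  show ?thesis
  proof
    fix x assume "x \<in> localization ?A P"
    then obtain a b where ab: "a \<in> ?A" "b \<in> ?A" "b \<notin> P" "b \<noteq> 0" "x = a / b"
      using ratfun.localizationE[OF A P] by metis
    have "b \<in> ?S"
      using AS ab(2) by blast
    then obtain c d where cd: "c \<in> ?B" "d \<in> ?B" "d \<notin> Q" "d \<noteq> 0" "b = c / d"
      using ratfun.localizationE[OF B Q] by metis
    have "b \<in> V" "d \<in> V" "b \<notin> nonunits V" "d \<notin> nonunits V"
      using dA dB ab cd by blast+
    then have "inverse b * inverse d \<in> V"
      using unit ratfun.subalg_mult[OF V] by blast
    moreover have "c = b * d" "c \<in> V"
      using cd dB(1) by auto
    moreover have "inverse (b * d) = inverse b * inverse d" "b * d \<noteq> 0"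
      using ab(4) cd(4) by (simp_all only: inverse_mult_distrib mult_eq_0_iff simp_thms)
    ultimately have "c \<notin> nonunits V"
      using unit[of c] by simp
    then have "c \<notin> Q"
      using dB(2) by blast
    then have "d / c \<in> ?S"
      using cd by (intro ratfun.localizationI[OF B Q])
    then have "a * (d / c) \<in> ?S"
      using ratfun.subalg_mult[OF SA] AS ab by blast
    then show "x \<in> ?S"
      using ab cd by (simp add: inverse_eq_divide)
  qed
qed

text \<open>Separatedness, for every dominating subalgebra and not just for valuation rings. It
  makes centres unique.\<close>

lemma proj_point_unique:
  assumes "subalgebra const V" "R \<in> proj_space n" "S \<in> proj_space n" "dominates V R" "dominates V S"
  shows "R = S"
proof -
  obtain i P where R: "i \<le> n" "prime_ideal (affine n i) P" "R = localization (affine n i) P"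
    using assms(2) by (rule proj_space_cases)
  obtain j Q where S: "j \<le> n" "prime_ideal (affine n j) Q" "S = localization (affine n j) Q"
    using assms(3) by (rule proj_space_cases)
  show ?thesis
    using localization_subset_of_common_domination[OF R(1) S(1) assms(1) R(2) S(2)]
      localization_subset_of_common_domination[OF S(1) R(1) assms(1) S(2) R(2)] assms R S by auto
qed

text \<open>Contracting the nonunits of \<open>E\<close> to the chart ring gives a point of the
  chart dominated by \<open>E\<close>, and uniqueness identifies it with \<open>E\<close>. So prime
  divisors through a centre in a chart are visible on that chart.\<close>

lemma proj_point_in_chart:
  assumes E: "E \<in> proj_space n" and i: "i \<le> n" and sub: "affine n i \<subseteq> E"
  shows "E \<in> spec (affine n i)"
proof -
  let ?A = "affine n i"
  note A = subalgebra_affine[of n i]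
  obtain j Q where j: "j \<le> n" "prime_ideal (affine n j) Q" "E = localization (affine n j) Q"
    using E by (rule proj_space_cases)
  note B = subalgebra_affine[of n j]
  note EA = subalgebra_proj_point[OF E]
  have unit: "x \<notin> nonunits E \<longleftrightarrow> x \<noteq> 0 \<and> inverse x \<in> E" if "x \<in> E" for x
    using that by (auto simp: nonunits_def)
  have mult: "x * z \<in> nonunits E" if "x \<in> E" "z \<in> nonunits E" for x z
    using ratfun.nonunits_localization_mult[OF B j(2)] that j(3) by blast
  define P where "P = {a \<in> ?A. a \<in> nonunits E}"
  have P: "prime_ideal ?A P"
    unfolding prime_ideal_def
  proof (intro conjI ballI impI)
    show "0 \<in> P"
      using ratfun.subalg_0[OF A] sub by (auto simp: P_def nonunits_def)
    show "1 \<notin> P"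
      using ratfun.subalg_1[OF EA] by (auto simp: P_def nonunits_def)
    show "x + z \<in> P" if "x \<in> P" "z \<in> P" for x z
      using that ratfun.nonunits_localization_add[OF B j(2)] j(3) ratfun.subalg_add[OF A] by (auto simp: P_def)
    show "a * x \<in> P" if "a \<in> ?A" "x \<in> P" for a x
      using that mult sub ratfun.subalg_mult[OF A] by (auto simp: P_def)
    show "a \<in> P \<or> b \<in> P" if ab: "a \<in> ?A" "b \<in> ?A" "a * b \<in> P" for a b
    proof (rule ccontr)
      assume "\<not> ?thesis"
      then have "a \<notin> nonunits E" "b \<notin> nonunits E"
        using ab by (auto simp: P_def)
      then have "a \<noteq> 0 \<and> inverse a \<in> E" "b \<noteq> 0 \<and> inverse b \<in> E"
        using unit ab sub by blast+
      then have "a * b \<notin> nonunits E"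
        using unit[of "a * b"] ratfun.subalg_mult[OF EA] ab sub by auto
      then show False
        using ab by (simp add: P_def)
    qed
  qed (auto simp: P_def)
  have inv: "inverse b \<in> E" if "b \<in> ?A" "b \<notin> P" for b
    using that unit sub by (auto simp: P_def)
  have "localization ?A P \<subseteq> E"
  proof
    fix x assume "x \<in> localization ?A P"
    then obtain a b where "a \<in> ?A" "b \<in> ?A" "b \<notin> P" "x = a / b"
      using ratfun.localizationE[OF A P] by metis
    then show "x \<in> E"
      using inv ratfun.subalg_mult[OF EA, of a "inverse b"] sub by (auto simp: divide_inverse)
  qed
  moreover have "nonunits (localization ?A P) \<subseteq> nonunits E"
  proof
    fix x assume x: "x \<in> nonunits (localization ?A P)"
    then obtain a b where ab: "a \<in> ?A" "b \<in> ?A" "b \<notin> P" "x = a / b"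
      using ratfun.localizationE[OF A P] unfolding nonunits_def by (metis (no_types, lifting) mem_Collect_eq)
    then have "a \<in> nonunits E"
      using x ratfun.nonunit_localization_iff[OF A P] by (auto simp: P_def)
    then show "x \<in> nonunits E"
      using mult[OF inv[OF ab(2,3)]] ab by (simp add: divide_inverse mult.commute)
  qed
  ultimately have "dominates E (localization ?A P)"
    by (simp add: dominates_def)
  moreover have spec: "localization ?A P \<in> spec ?A"
    using P by (auto simp: spec_def)
  ultimately have "localization ?A P = E"
    using spec_affine_subset_proj_space[OF i] by (intro proj_point_unique[OF EA _ E _ dominates_refl]) auto
  then show ?thesis
    using spec by simp
qed

text \<open>Needed for the upper bound: projective space is a model over itself, so its own prime
  divisors count as divisors over it.\<close>

lemma variety_proj_space: "variety const (proj_space n)"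
  unfolding variety_def
proof (intro conjI allI impI)
  show "\<exists>\<A>. finite \<A> \<and> \<A> \<noteq> {} \<and> proj_space n = (\<Union>A\<in>\<A>. spec A) \<and>
      (\<forall>A\<in>\<A>. (\<exists>S. finite S \<and> A = adjoin const S) \<and> fractions A = function_field (proj_space n))"
    unfolding function_field_proj_space
  proof (intro exI[of _ "affine n ` {..n}"] conjI ballI)
    show "proj_space n = (\<Union>A\<in>affine n ` {..n}. spec A)"
      by (simp add: proj_space_eq)
    fix A assume "A \<in> affine n ` {..n}"
    then obtain i where i: "i \<le> n" "A = affine n i"
      by auto
    show "\<exists>S. finite S \<and> A = adjoin const S"
      using i by (intro exI[of _ "affine_coord n i ` {..<n}"]) simp
    show "fractions A = ratfun_field n"
      unfolding i(2) by (rule fractions_affine_eq[OF i(1)])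
  qed auto
next
  fix V R S
  assume "valuation_ring const (function_field (proj_space n)) V \<and> R \<in> proj_space n \<and> S \<in> proj_space n \<and>
    dominates V R \<and> dominates V S"
  then show "R = S"
    using proj_point_unique by (auto simp: valuation_ring_def)
qed

lemma prime_divisors_subset_divisors_over: "prime_divisors (proj_space n) \<subseteq> divisors_over const (proj_space n)"
proof
  fix F assume "F \<in> prime_divisors (proj_space n)"
  moreover have "proper_birational_morphism const (proj_space n) (proj_space n)"
    using dominates_refl by (auto simp: proper_birational_morphism_def)
  ultimately show "F \<in> divisors_over const (proj_space n)"
    using variety_proj_space unfolding divisors_over_def by auto
qed

section \<open>Divisors over projective space\<close>

lemma prime_divisor_dvr:
  assumes "E \<in> prime_divisors (proj_space n)"
  obtains t where "dvr const E t" "fractions E = ratfun_field n"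
proof -
  have E: "E \<in> proj_space n"
    using assms by (simp add: prime_divisors_def)
  obtain t where "uniformizer E t"
    using assms by (auto simp: prime_divisors_def)
  then have "dvr const E t"
    using subalgebra_proj_point[OF E] by unfold_locales
  then show ?thesis
    using that fractions_proj_point[OF E] by blast
qed

text \<open>Of the model carrying \<open>F\<close> only the valuation ring is kept, together with
  its centre \<open>S\<close> in chart \<open>i\<close>.\<close>

locale divisor_over_chart =
  fixes n i :: nat and S F :: "ratfun set" and t :: ratfun
  assumes i: "i \<le> n" and S: "S \<in> spec (affine n i)" and dom: "dominates F S"
    and F: "subalgebra const F" and unif: "uniformizer F t" and fractions_F: "fractions F = ratfun_field n"
begin

sublocale chart_dvr const n "affine_coord n i" "affine_deriv n i" F t
proof -
  interpret chart const n "affine_coord n i" "affine_deriv n i"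
    by (rule chart_projective[OF i])
  have "affine n i \<subseteq> F"
    using dom ratfun.subset_spec[OF A S] by (auto simp: dominates_def)
  then show "chart_dvr const n (affine_coord n i) (affine_deriv n i) F t"
    using y_mem_A F unif fractions_F fractions_affine_eq[OF i] by unfold_locales auto
qed

lemma K_eq: "K = ratfun_field n"
  by (rule fractions_affine_eq[OF i])

lemma S_in_proj_space: "S \<in> proj_space n"
  using S spec_affine_subset_proj_space[OF i] by blast

lemma center_eq: "center (proj_space n) F = S"
  unfolding center_def
proof (rule the_equality)
  show "S \<in> proj_space n \<and> dominates F S"
    using S_in_proj_space dom by simp
  show "S' = S" if "S' \<in> proj_space n \<and> dominates F S'" for S'
    using that proj_point_unique[OF F] S_in_proj_space dom by blast
qed

lemma prime_divisor_through_center: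
  assumes "E \<in> prime_divisors (proj_space n)" "S \<subseteq> E"
  shows "E \<in> spec (affine n i)"
  using assms ratfun.subset_spec[OF A S] by (intro proj_point_in_chart[OF _ i]) (auto simp: prime_divisors_def)

text \<open>There are neither zeros nor poles along prime divisors through the centre, so by
  factoriality \<open>f\<close> and its inverse both lie in the local ring \<open>S\<close>, hence
  in \<open>F\<close>.\<close>

lemma unit_at_center:
  assumes f: "f \<in> K" "f \<noteq> 0"
    and ord: "\<And>E. E \<in> prime_divisors (proj_space n) \<Longrightarrow> S \<subseteq> E \<Longrightarrow> ord E f = 0"
  shows "ord F f = 0"
proof -
  obtain P where P: "prime_ideal (affine n i) P" "S = localization (affine n i) P"
    using S by (auto simp: spec_def)
  have *: "g \<in> S" if g: "g \<in> K" "g \<noteq> 0" "\<And>E. E \<in> prime_divisors (proj_space n) \<Longrightarrow> S \<subseteq> E \<Longrightarrow> ord E g = 0" for g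
    unfolding P(2)
  proof (rule ratfun.mem_localization_if_mem_localizations[OF A factorial_A g(1) P(1)])
    fix p assume p: "prime_in (affine n i) p" "p \<in> P"
    let ?E = "localization (affine n i) (principal (affine n i) p)"
    note E = ratfun.prime_ideal_principal[OF A p(1)]
    have "?E \<in> spec (affine n i)"
      using E by (auto simp: spec_def)
    then have PD: "?E \<in> prime_divisors (proj_space n)"
      using spec_affine_subset_proj_space[OF i] ratfun.uniformizer_principal[OF A p(1) factorial_A]
      by (auto simp: prime_divisors_def)
    have "S \<subseteq> ?E"
      unfolding P(2) by (rule ratfun.localization_principal_superset[OF A factorial_A P(1) p(2)])
    then have "ord ?E g = 0"
      using g(3) PD by blast
    obtain s where "dvr const ?E s" "fractions ?E = ratfun_field n"
      using prime_divisor_dvr[OF PD] .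
    then show "g \<in> ?E"
      using dvr.mem_iff_ord[of const ?E s g] g K_eq \<open>ord ?E g = 0\<close> by simp
  qed
  have "f \<in> S"
    using f ord by (intro *) auto
  moreover have "inverse f \<in> S"
  proof (rule *)
    fix E assume E: "E \<in> prime_divisors (proj_space n)" "S \<subseteq> E"
    obtain s where "dvr const E s" "fractions E = ratfun_field n"
      using prime_divisor_dvr[OF E(1)] .
    then show "ord E (inverse f) = 0"
      using dvr.ord_inverse[of const E s f] f K_eq ord[OF E] by simp
  qed (use f ratfun.subfield_inverse[OF K(1)] in auto)
  ultimately have "f \<in> F" "inverse f \<in> F"
    using dom by (auto simp: dominates_def)
  then show ?thesis
    using V.ord_unit[of f] f by (simp add: V.U_iff)
qed

text \<open>Makes the definite description computable from any single local equation, tested only on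
  prime divisors visible in the chart.\<close>

lemma ord_pullback_eq:
  assumes N: "N > 0" and g: "g \<in> K" "g \<noteq> 0"
    and D: "\<And>E. E \<in> prime_divisors (proj_space n) \<Longrightarrow> E \<in> spec (affine n i) \<Longrightarrow> of_nat N * D E = of_int (ord E g)"
  shows "ord_pullback (proj_space n) D F = of_int (ord F g) / of_nat N"
  unfolding ord_pullback_def center_eq
proof (rule the_equality)
  show "\<exists>N' g'. N' > 0 \<and> local_equation (proj_space n) (\<lambda>E. of_nat N' * D E) S g' \<and>
      of_int (ord F g) / real N = of_int (ord F g') / of_nat N'"
    using N g D K_eq function_field_proj_space prime_divisor_through_center
    by (intro exI[of _ N] exI[of _ g]) (auto simp: local_equation_def)
  fix r :: real assume "\<exists>N' g'. N' > 0 \<and> local_equation (proj_space n) (\<lambda>E. of_nat N' * D E) S g' \<and>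
      r = of_int (ord F g') / of_nat N'"
  then obtain N' g' where N': "N' > 0" "r = of_int (ord F g') / of_nat N'"
    and "local_equation (proj_space n) (\<lambda>E. of_nat N' * D E) S g'"
    by blast
  then have g': "g' \<in> K" "g' \<noteq> 0"
    and D': "\<And>E. E \<in> prime_divisors (proj_space n) \<Longrightarrow> S \<subseteq> E \<Longrightarrow> of_nat N' * D E = of_int (ord E g')"
    using K_eq function_field_proj_space by (auto simp: local_equation_def)
  \<comment> \<open>Both powers are equations of N N' D at the centre, so the quotient is a unit
    there.\<close>
  let ?f = "g' ^ N / g ^ N'"
  have powers: "g' ^ N \<in> K" "g ^ N' \<in> K" "g' ^ N \<noteq> 0" "g ^ N' \<noteq> 0"
    using g g' ratfun.subalg_power[OF K(2)] by auto
  have f: "?f \<in> K" "?f \<noteq> 0"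
    using powers ratfun.subfield_divide[OF K(1)] by auto
  have ordf: "ord E ?f = int N * ord E g' - int N' * ord E g" if "dvr const E s" "fractions E = K" for E s
    using that g g' powers by (simp add: dvr.ord_divide dvr.ord_power)
  have "ord F ?f = 0"
  proof (rule unit_at_center[OF f])
    fix E assume E: "E \<in> prime_divisors (proj_space n)" "S \<subseteq> E"
    obtain s where s: "dvr const E s" "fractions E = ratfun_field n"
      using prime_divisor_dvr[OF E(1)] .
    have "real N * of_int (ord E g') = of_nat N' * of_int (ord E g)"
      using D'[OF E] D[OF E(1) prime_divisor_through_center[OF E]] by (metis mult.left_commute)
    then have "int N * ord E g' = int N' * ord E g"
      by (metis of_int_eq_iff of_int_mult of_int_of_nat_eq)
    then show "ord E ?f = 0"
      using ordf[OF s(1)] s(2) K_eq by simp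
  qed
  then have "int N * ord F g' = int N' * ord F g"
    using ordf[OF V.dvr_axioms fractions_R] by simp
  then have "real N * of_int (ord F g') = of_nat N' * of_int (ord F g)"
    by (metis of_int_mult of_int_of_nat_eq)
  then show "r = of_int (ord F g) / of_nat N"
    unfolding N'(2) using N N'(1) by (simp add: field_simps)
qed

end

text \<open>The chart derivations preserve the local ring of a prime divisor of the chart, so the
  coordinates form a canonical generator, and the coefficient of the form in the chart is a local
  equation of its divisor.\<close>

lemma div_form_prime_divisor:
  assumes E: "E \<in> prime_divisors (proj_space n)" "E \<in> spec (affine n i)" and i: "i \<le> n"
    and \<omega>: "nonzero_top_form const n (ratfun_field n) \<omega>"
  shows "div_form const n (proj_space n) \<omega> E = ord E (\<omega> (affine_deriv n i))"
    and "canonical_generator const n E (affine_coord n i)"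
proof -
  obtain t where t: "uniformizer E t"
    using E by (auto simp: prime_divisors_def)
  have EP: "E \<in> proj_space n"
    using E by (simp add: prime_divisors_def)
  interpret divisor_over_chart n i E E t
    using i E t EP dominates_refl subalgebra_proj_point fractions_proj_point by unfold_locales auto
  obtain P where P: "prime_ideal (affine n i) P" "E = localization (affine n i) P"
    using E(2) by (auto simp: spec_def)
  have "affine_deriv n i l f \<in> E" if l: "l < n" and f: "f \<in> E" for l f
  proof -
    have "affine_deriv n i l a \<in> localization (affine n i) P" if "a \<in> affine n i" for a
      using deriv_A[OF l that] ratfun.subset_localization[OF A P(1)] by (rule subsetD[rotated])
    from ratfun.deriv_localization_closed[OF K(1) derivation_K[OF l] A P(1) A_subset_K this f[unfolded P(2)]]
    show ?thesis
      unfolding P(2) .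
  qed
  then show gen: "canonical_generator const n E (affine_coord n i)"
    by (rule canonical_generator_coordinate)
  have "nonzero_top_form const n K \<omega>"
    using \<omega> K_eq by simp
  then have "ord_form const n E \<omega> = ord E (\<omega> (affine_deriv n i))"
    using ord_form_eq[OF gen] by (simp add: wedge_coordinate)
  then show "div_form const n (proj_space n) \<omega> E = ord E (\<omega> (affine_deriv n i))"
    using E by (simp add: div_form_def)
qed

context divisor_over_chart
begin

text \<open>The value of the form on the chart derivations enters both its order along
  \<open>F\<close> and the pullback of its divisor; it cancels, and only the Jacobian
  remains.\<close>

lemma log_discrepancy_eq:
  assumes r: "canonical_generator const n F r"
  shows "log_discrepancy const n (proj_space n) F = of_int (1 - ord F (jacobian r))"
  unfolding log_discrepancy_def function_field_proj_space
proof (rule the_equality)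
  have *: "1 + (of_int (ord_form const n F \<omega>) - ord_pullback (proj_space n) (\<lambda>E. of_int (div_form const n (proj_space n) \<omega> E)) F) =
      of_int (1 - ord F (jacobian r))" if \<omega>: "nonzero_top_form const n (ratfun_field n) \<omega>" for \<omega>
  proof -
    have \<omega>': "nonzero_top_form const n K \<omega>"
      using \<omega> K_eq by simp
    have "ord_pullback (proj_space n) (\<lambda>E. of_int (div_form const n (proj_space n) \<omega> E)) F =
        of_int (ord F (\<omega> (affine_deriv n i))) / of_nat 1"
      using nonzero_top_formE[OF \<omega>'] div_form_prime_divisor(1)[OF _ _ i \<omega>] by (intro ord_pullback_eq) auto
    then show ?thesis
      using ord_form_eq[OF r \<omega>'] by simp
  qed
  show "\<exists>\<omega>. nonzero_top_form const n (ratfun_field n) \<omega> \<and> real_of_int (1 - ord F (jacobian r)) =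
      1 + (of_int (ord_form const n F \<omega>) - ord_pullback (proj_space n) (\<lambda>E. of_int (div_form const n (proj_space n) \<omega> E)) F)"
    using nonzero_top_form_coordinate *[of "wedge n (affine_coord n i)"] K_eq
    by (intro exI[of _ "wedge n (affine_coord n i)"]) simp
  show "a = of_int (1 - ord F (jacobian r))" if "\<exists>\<omega>. nonzero_top_form const n (ratfun_field n) \<omega> \<and>
      a = 1 + (of_int (ord_form const n F \<omega>) - ord_pullback (proj_space n) (\<lambda>E. of_int (div_form const n (proj_space n) \<omega> E)) F)" for a
    using that * by auto
qed

end

section \<open>Pluri-anticanonical sections\<close>

abbreviation proj_pdeg :: "nat \<Rightarrow> nat \<Rightarrow> nat \<Rightarrow> ratfun set" where
  "proj_pdeg n i N \<equiv> chart.pdeg const n (affine_coord n i) N"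

abbreviation proj_mon :: "nat \<Rightarrow> nat \<Rightarrow> (nat \<Rightarrow> nat) \<Rightarrow> ratfun" where
  "proj_mon n i \<gamma> \<equiv> chart.mon n (affine_coord n i) \<gamma>"

lemma coord_quotient_pdeg:
  assumes "a \<le> n" "i \<le> n"
  shows "coord a / coord i \<in> proj_pdeg n i 1"
proof -
  interpret chart const n "affine_coord n i" "affine_deriv n i"
    by (rule chart_projective[OF assms(2)])
  show ?thesis
  proof (cases "a = i")
    case True
    then show ?thesis
      using pdeg_const[of 1 1] coord_nonzero by simp
  next
    case False
    define l where "l = (if a = n then i else a)"
    have "l < n" "affine_coord n i l = coord a / coord i"
      using assms False by (auto simp: l_def affine_coord_def chart_index_def)
    then show ?thesis
      using pdeg_y by metis
  qed
qed

text \<open>Homogenization: a polynomial of degree at most \<open>k\<close> in chart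
  \<open>i\<close> is a form of degree \<open>k\<close> divided by the \<open>k\<close>-th power of
  x_i, and the factor exchanges this denominator for the power of x_j.\<close>

lemma pdeg_change_chart:
  assumes i: "i \<le> n" and j: "j \<le> n" and g: "g \<in> proj_pdeg n i k"
  shows "g * (coord i / coord j) ^ k \<in> proj_pdeg n j k"
proof -
  interpret I: chart const n "affine_coord n i" "affine_deriv n i"
    by (rule chart_projective[OF i])
  interpret J: chart const n "affine_coord n j" "affine_deriv n j"
    by (rule chart_projective[OF j])
  let ?u = "coord i / coord j"
  have mon: "I.mon \<beta> * ?u ^ k \<in> J.pdeg k" if \<beta>: "\<beta> \<in> multi n k" for \<beta>
  proof -
    let ?d = "\<Sum>l<n. \<beta> l"
    have d: "?d \<le> k"
      using \<beta> by (simp add: multi_def)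
    then have k: "?u ^ k = ?u ^ (k - ?d) * (\<Prod>l<n. ?u ^ \<beta> l)"
      by (simp flip: power_add power_sum)
    have mon_u: "I.mon \<beta> * (\<Prod>l<n. ?u ^ \<beta> l) = (\<Prod>l<n. (coord (chart_index n i l) / coord j) ^ \<beta> l)"
      unfolding I.mon_def prod.distrib[symmetric] power_mult_distrib[symmetric] affine_coord_def
      using coord_nonzero by simp
    have "I.mon \<beta> * ?u ^ k = I.mon \<beta> * (?u ^ (k - ?d) * (\<Prod>l<n. ?u ^ \<beta> l))"
      using k by (rule arg_cong)
    also have "\<dots> = ?u ^ (k - ?d) * (I.mon \<beta> * (\<Prod>l<n. ?u ^ \<beta> l))"
      by (rule mult.left_commute)
    finally have "I.mon \<beta> * ?u ^ k = ?u ^ (k - ?d) * (\<Prod>l<n. (coord (chart_index n i l) / coord j) ^ \<beta> l)"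
      unfolding mon_u .
    moreover have "chart_index n i l \<le> n" if "l < n" for l
      using that by (simp add: chart_index_def)
    then have "?u ^ (k - ?d) * (\<Prod>l<n. (coord (chart_index n i l) / coord j) ^ \<beta> l) \<in>
        J.pdeg ((k - ?d) * 1 + (\<Sum>l<n. \<beta> l * 1))"
      by (intro J.pdeg_mult J.pdeg_power J.pdeg_prod coord_quotient_pdeg i j) auto
    ultimately show ?thesis
      using d by simp
  qed
  show ?thesis
    using g unfolding I.pdeg_def
  proof (induction rule: ratfun.VS.span_induct_alt)
    case base
    then show ?case
      by (simp add: J.pdeg_def ratfun.VS.span_zero)
  next
    case (step c x z)
    then obtain \<beta> where "\<beta> \<in> multi n k" "x = I.mon \<beta>"
      by blast
    then have "const c * (x * ?u ^ k) + z * ?u ^ k \<in> J.pdeg k"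
      using mon step unfolding J.pdeg_def by (intro ratfun.VS.span_add ratfun.VS.span_scale) auto
    then show ?case
      by (simp only: distrib_right mult.assoc)
  qed
qed

text \<open>The matrix is diagonal with entries x_j/x_n except in column \<open>j\<close>, the
  derivative by x_n, whose diagonal entry is minus the square of that ratio. The exponent n + 1 = (n
  - 1) + 2 is the degree of the anticanonical bundle.\<close>

lemma wedge_transition:
  assumes j: "j < n"
  shows "wedge n (affine_coord n n) (affine_deriv n j) = - ((coord j / coord n) ^ (n + 1))"
proof -
  let ?f = "\<lambda>(k, l). affine_deriv n j l (affine_coord n n k)"
  let ?u = "coord j / coord n"
  have f: "?f (k, l) = (if l = j then - (coord j * coord k / (coord n)\<^sup>2) else if k = l then ?u else 0)"
    if "k < n" "l < n" for k l
    using that j coord_nonzero[of n]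
    by (auto simp: affine_deriv_def affine_coord_def chart_index_def ratfun_deriv_quotient)
  have "wedge n (affine_coord n n) (affine_deriv n j) = det (mat n n ?f)"
    by (simp add: wedge_def)
  also have "\<dots> = (\<Prod>k<n. ?f (k, k))"
  proof (rule det_triangular_weight[where w = "\<lambda>l. if l = j then 0 else 1"])
    fix k l assume "k < n" "l < n" "?f (k, l) \<noteq> 0"
    then show "k = l \<or> (if l = j then 0 else 1::int) < (if k = j then 0 else 1)"
      using f[of k l] by (auto split: if_splits)
  qed
  also have "\<dots> = ?f (j, j) * (\<Prod>k\<in>{..<n} - {j}. ?f (k, k))"
    using j by (subst prod.remove[of _ j]) auto
  also have "(\<Prod>k\<in>{..<n} - {j}. ?f (k, k)) = (\<Prod>k\<in>{..<n} - {j}. ?u)"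
    by (rule prod.cong[OF refl], subst f) auto
  also have "\<dots> = ?u ^ (n - 1)"
    using j by simp
  also have "?f (j, j) = - (?u ^ 2)"
    using f[OF j j] by (simp add: power_divide power2_eq_square)
  also have "- (?u ^ 2) * ?u ^ (n - 1) = - (?u ^ (2 + (n - 1)))"
    by (simp only: power_add mult_minus_left)
  also have "2 + (n - 1) = n + 1"
    using j by simp
  finally show ?thesis .
qed

locale top_form =
  fixes n :: nat and \<omega> :: "(nat \<Rightarrow> ratfun \<Rightarrow> ratfun) \<Rightarrow> ratfun"
  assumes \<omega>: "nonzero_top_form const n (ratfun_field n) \<omega>" and n: "n \<ge> 1"
begin

text \<open>The coefficient of \<open>\<omega>\<close> with respect to the coordinate form of chart
  \<open>i\<close>. Dividing sections of -mK by its \<open>m\<close>-th power trivializes the bundle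
  on the chart.\<close>

definition h :: "nat \<Rightarrow> ratfun" where
  "h i = \<omega> (affine_deriv n i)"

lemma h_mem: "i \<le> n \<Longrightarrow> h i \<in> ratfun_field n" and h_nonzero: "i \<le> n \<Longrightarrow> h i \<noteq> 0"
proof -
  assume i: "i \<le> n"
  interpret chart const n "affine_coord n i" "affine_deriv n i"
    by (rule chart_projective[OF i])
  have "nonzero_top_form const n K \<omega>"
    using \<omega> fractions_affine_eq[OF i] by metis
  then show "h i \<in> ratfun_field n" "h i \<noteq> 0"
    using nonzero_top_formE(1,2) fractions_affine_eq[OF i] unfolding h_def by auto
qed

lemma transition_last:
  assumes i: "i \<le> n"
  shows "\<exists>e\<in>{1, -1}. h i = e * (coord i / coord n) ^ (n + 1) * h n"
proof (cases "i = n")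
  case True
  then show ?thesis
    using coord_nonzero by simp
next
  case False
  interpret I: chart const n "affine_coord n i" "affine_deriv n i"
    by (rule chart_projective[OF i])
  interpret N: chart const n "affine_coord n n" "affine_deriv n n"
    by (rule chart_projective) simp
  have "affine_deriv n i \<in> frames const (ratfun_field n) n"
    using I.coordinate_frame unfolding fractions_affine_eq[OF i] .
  then have "h i = h n * wedge n (affine_coord n n) (affine_deriv n i)"
    using N.nonzero_top_formE(3)[OF \<omega>] by (simp add: h_def)
  also have "\<dots> = - 1 * (coord i / coord n) ^ (n + 1) * h n"
    using False i by (subst wedge_transition) auto
  finally show ?thesis
    by blast
qed

text \<open>The constant is a sign, stemming from the minus in \<open>wedge_transition\<close>.
  Comparing both charts with chart \<open>n\<close> avoids a Jacobian computation for arbitrary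
  pairs of charts.\<close>

lemma transition:
  assumes "i \<le> n" "j \<le> n"
  shows "\<exists>c. const c * const c = 1 \<and> h i ^ m = const c * (coord i / coord j) ^ (m * (n + 1)) * h j ^ m"
proof -
  obtain a b where a: "a \<in> {1, -1}" "h i = a * (coord i / coord n) ^ (n + 1) * h n"
    and b: "b \<in> {1, -1}" "h j = b * (coord j / coord n) ^ (n + 1) * h n"
    using transition_last assms by blast
  have bb: "b * b = 1"
    using b(1) by auto
  have u: "(coord i / coord j) ^ (n + 1) * (coord j / coord n) ^ (n + 1) = (coord i / coord n) ^ (n + 1)"
    using coord_nonzero by (simp flip: power_mult_distrib)
  have "a * b * (coord i / coord j) ^ (n + 1) * h j =
      a * (b * b) * ((coord i / coord j) ^ (n + 1) * (coord j / coord n) ^ (n + 1)) * h n"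
    by (subst b(2)) (simp only: ac_simps)
  then have "h i = (a * b) * (coord i / coord j) ^ (n + 1) * h j"
    using a(2) by (simp only: bb u mult_1_right)
  then have "h i ^ m = (a * b) ^ m * (coord i / coord j) ^ (m * (n + 1)) * h j ^ m"
    by (simp only: power_mult_distrib power_mult[symmetric] mult.commute[of "n + 1" m])
  moreover have "\<exists>c. const c * const c = 1 \<and> (a * b) ^ m = const c"
  proof -
    have "a * b \<in> {1, -1}"
      using a(1) b(1) by auto
    then have "(a * b) ^ m \<in> {1, -1}"
      using minus_one_power_iff[of m] by (auto split: if_splits)
    moreover have "const (-1) = -1"
      using ratfun.const_minus[of 1] by simp
    ultimately show ?thesis
      by (metis insertE mult_1 mult_minus1 ratfun.const_1 singletonD minus_minus)
  qed
  ultimately show ?thesis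
    by auto
qed

definition sections :: "nat \<Rightarrow> ratfun set" where
  "sections m = global_sections (proj_space n) (\<lambda>E. int m * - div_form const n (proj_space n) \<omega> E)"

lemma zero_divisor_eq:
  assumes E: "E \<in> prime_divisors (proj_space n)" "E \<in> spec (affine n i)" and i: "i \<le> n"
    and f: "f \<in> ratfun_field n" "f \<noteq> 0"
  shows "zero_divisor (\<lambda>E. int m * - div_form const n (proj_space n) \<omega> E) f E = ord E (f / h i ^ m)"
proof -
  obtain s where s: "dvr const E s" "fractions E = ratfun_field n"
    using prime_divisor_dvr[OF E(1)] .
  interpret V: dvr const E s
    by (rule s(1))
  have hE: "h i \<in> V.K" "h i \<noteq> 0"
    using h_mem[OF i] h_nonzero[OF i] s(2) by auto
  then have "h i ^ m \<in> V.K" "h i ^ m \<noteq> 0"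
    using ratfun.subalg_power[OF V.K(2)] by auto
  then have "ord E (f / h i ^ m) = ord E f - int m * ord E (h i)"
    using f s(2) hE by (simp add: V.ord_divide V.ord_power)
  then show ?thesis
    using div_form_prime_divisor(1)[OF E i \<omega>] by (simp add: zero_divisor_def h_def)
qed

text \<open>An effective zero divisor means that \<open>f / h i ^ m\<close> has no poles along the
  prime divisors of chart \<open>i\<close>; by factoriality it then belongs to the chart
  ring.\<close>

lemma mem_sections_iff:
  "f \<in> sections m \<longleftrightarrow> f \<in> ratfun_field n \<and> (\<forall>i\<le>n. f / h i ^ m \<in> affine n i)"
proof (cases "f = 0")
  case True
  then show ?thesis
    using ratfun.subalg_0[OF subalgebra_affine] ratfun.subset_fractions[OF subalgebra_affine, of n n]
    by (auto simp: sections_def global_sections_def function_field_proj_space)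
next
  case f0: False
  have iff: "f \<in> sections m \<longleftrightarrow> f \<in> ratfun_field n \<and> (\<forall>E\<in>prime_divisors (proj_space n).
      zero_divisor (\<lambda>E. int m * - div_form const n (proj_space n) \<omega> E) f E \<ge> 0)"
    using f0 by (simp add: sections_def global_sections_def function_field_proj_space zero_divisor_def)
  have quot: "f / h i ^ m \<in> ratfun_field n" "f / h i ^ m \<noteq> 0" if "f \<in> ratfun_field n" "i \<le> n" for i
  proof -
    note F = ratfun.subfield_fractions[OF subalgebra_affine, of n n]
    show "f / h i ^ m \<in> ratfun_field n"
      using that h_mem by (intro ratfun.subfield_divide[OF F] ratfun.subalg_power[OF ratfun.subfieldD[OF F]]) auto
    show "f / h i ^ m \<noteq> 0"
      using f0 h_nonzero[OF that(2)] by simp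
  qed
  show ?thesis
    unfolding iff
  proof (intro conj_cong refl iffI allI impI ballI)
    fix i assume f: "f \<in> ratfun_field n" and i: "i \<le> n"
      and pos: "\<forall>E\<in>prime_divisors (proj_space n). zero_divisor (\<lambda>E. int m * - div_form const n (proj_space n) \<omega> E) f E \<ge> 0"
    interpret chart const n "affine_coord n i" "affine_deriv n i"
      by (rule chart_projective[OF i])
    have fK: "f / h i ^ m \<in> K"
      using quot[OF f i] unfolding fractions_affine_eq[OF i] by blast
    show "f / h i ^ m \<in> affine n i"
    proof (rule ratfun.mem_if_mem_localizations[OF A factorial_A fK])
      fix p assume p: "prime_in (affine n i) p"
      let ?E = "localization (affine n i) (principal (affine n i) p)"
      have spec: "?E \<in> spec (affine n i)"
        using ratfun.prime_ideal_principal[OF A p] by (auto simp: spec_def)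
      then have PD: "?E \<in> prime_divisors (proj_space n)"
        using spec_affine_subset_proj_space[OF i] ratfun.uniformizer_principal[OF A p factorial_A]
        by (auto simp: prime_divisors_def)
      then have "ord ?E (f / h i ^ m) \<ge> 0"
        using pos zero_divisor_eq[OF PD spec i f f0, of m] by auto
      moreover obtain s where "dvr const ?E s" "fractions ?E = ratfun_field n"
        using prime_divisor_dvr[OF PD] .
      ultimately show "f / h i ^ m \<in> ?E"
        using dvr.mem_iff_ord[of const ?E s "f / h i ^ m"] quot[OF f i] by simp
    qed
  next
    fix E assume f: "f \<in> ratfun_field n" and mem: "\<forall>i\<le>n. f / h i ^ m \<in> affine n i"
      and E: "E \<in> prime_divisors (proj_space n)"
    have "E \<in> proj_space n"
      using E by (simp add: prime_divisors_def)
    then obtain i where i: "i \<le> n" "E \<in> spec (affine n i)"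
      by (rule proj_space_cases)
    obtain s where "dvr const E s" "fractions E = ratfun_field n"
      using prime_divisor_dvr[OF E] .
    moreover have "f / h i ^ m \<in> E"
      using mem i ratfun.subset_spec[OF subalgebra_affine i(2)] by blast
    ultimately have "ord E (f / h i ^ m) \<ge> 0"
      using dvr.mem_iff_ord[of const E s "f / h i ^ m"] quot[OF f i(1)] by simp
    then show "zero_divisor (\<lambda>E. int m * - div_form const n (proj_space n) \<omega> E) f E \<ge> 0"
      using zero_divisor_eq[OF E i(2,1) f f0, of m] by simp
  qed
qed

lemma mem_sections_of_pdeg:
  assumes i: "i \<le> n" and g: "g \<in> proj_pdeg n i (m * (n + 1))"
  shows "g * h i ^ m \<in> sections m"
  unfolding mem_sections_iff
proof (intro conjI allI impI)
  interpret I: chart const n "affine_coord n i" "affine_deriv n i"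
    by (rule chart_projective[OF i])
  have "g \<in> ratfun_field n"
    using g I.pdeg_subset_A I.A_subset_K unfolding fractions_affine_eq[OF i] by blast
  then show "g * h i ^ m \<in> ratfun_field n"
    using I.K(2) h_mem[OF i] unfolding fractions_affine_eq[OF i]
    by (intro ratfun.subalg_mult ratfun.subalg_power) auto
  fix j assume j: "j \<le> n"
  interpret J: chart const n "affine_coord n j" "affine_deriv n j"
    by (rule chart_projective[OF j])
  obtain c where c: "h i ^ m = const c * (coord i / coord j) ^ (m * (n + 1)) * h j ^ m"
    using transition[OF i j] by blast
  have "g * h i ^ m / h j ^ m = const c * (g * (coord i / coord j) ^ (m * (n + 1)))"
    unfolding c using h_nonzero[OF j] by simp
  moreover have "g * (coord i / coord j) ^ (m * (n + 1)) \<in> affine n j"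
    using pdeg_change_chart[OF i j g] J.pdeg_subset_A by blast
  ultimately show "g * h i ^ m / h j ^ m \<in> affine n j"
    using ratfun.subalg_mult[OF J.A ratfun.subalg_const[OF J.A]] by simp
qed

text \<open>
  A polynomial in the last chart whose degree exceeds \<open>m (n + 1)\<close> has a pole along the hyperplane at
  infinity, which is visible in the chart \<open>0\<close>.
\<close>

lemma pdeg_of_mem_sections:
  assumes f: "f \<in> sections m"
  shows "f / h n ^ m \<in> proj_pdeg n n (m * (n + 1))"
proof -
  let ?N = "m * (n + 1)" and ?u = "coord 0 / coord n" and ?g = "f / h n ^ m"
  interpret I: chart const n "affine_coord n 0" "affine_deriv n 0"
    by (rule chart_projective) simp
  interpret J: chart const n "affine_coord n n" "affine_deriv n n"
    by (rule chart_projective) simp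
  have g: "?g \<in> affine n n" and f0: "f / h 0 ^ m \<in> affine n 0"
    using f mem_sections_iff by auto
  \<comment> \<open>Chart 0 bounds the degree only by some \<open>k\<close>. Transported to the last
    chart, the bound concerns the product with a power of x_0/x_n, which
    \<open>pdeg_cancel_y\<close> removes; this ratio is an affine coordinate there because
    \<open>n \<ge> 1\<close>.\<close>
  obtain k where k: "k \<ge> ?N" "f / h 0 ^ m \<in> I.pdeg k"
    using I.A_pdeg[OF f0] by blast
  have "f / h 0 ^ m * ?u ^ k \<in> J.pdeg k"
    using pdeg_change_chart[OF _ _ k(2)] by simp
  obtain c where c: "const c * const c = 1" "h 0 ^ m = const c * ?u ^ ?N * h n ^ m"
    using transition[of 0 n m] by auto
  have nz: "const c \<noteq> 0" "?u \<noteq> 0" "h n ^ m \<noteq> 0"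
    using c(1) coord_nonzero h_nonzero[of n] by auto
  have "const c * (f / h 0 ^ m * ?u ^ k) = const c * (f / (const c * ?u ^ ?N * h n ^ m) * (?u ^ (k - ?N) * ?u ^ ?N))"
    using k(1) by (simp only: c(2) power_add[symmetric] le_add_diff_inverse2)
  also have "\<dots> = ?u ^ (k - ?N) * ?g"
    using nz by (simp add: field_simps)
  finally have eq: "const c * (f / h 0 ^ m * ?u ^ k) = ?u ^ (k - ?N) * ?g" .
  have "const c * (f / h 0 ^ m * ?u ^ k) \<in> J.pdeg k"
    using \<open>f / h 0 ^ m * ?u ^ k \<in> J.pdeg k\<close> unfolding J.pdeg_def by (rule ratfun.VS.span_scale)
  then have "?u ^ (k - ?N) * ?g \<in> J.pdeg k"
    unfolding eq .
  moreover have "affine_coord n n 0 = ?u"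
    using n by (simp add: affine_coord_def chart_index_def)
  ultimately show ?thesis
    using J.pdeg_cancel_y[of 0 ?g "k - ?N" ?N] n g k(1) by simp
qed

abbreviation "monomial_sections m \<equiv> (\<lambda>\<gamma>. h n ^ m * proj_mon n n \<gamma>) ` multi n (m * (n + 1))"

lemma span_monomial_sections: "ratfun.VS.span (monomial_sections m) = sections m"
proof
  interpret chart const n "affine_coord n n" "affine_deriv n n"
    by (rule chart_projective) simp
  let ?N = "m * (n + 1)"
  have h0: "h n ^ m \<noteq> 0"
    using h_nonzero[of n] by simp
  show "sections m \<subseteq> ratfun.VS.span (monomial_sections m)"
  proof
    fix f assume "f \<in> sections m"
    then obtain c where c: "f / h n ^ m = (\<Sum>\<gamma>\<in>multi n ?N. const (c \<gamma>) * mon \<gamma>)"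
      using pdeg_of_mem_sections pdeg_iff by blast
    have "f = h n ^ m * (f / h n ^ m)"
      using h0 by simp
    then have f: "f = (\<Sum>\<gamma>\<in>multi n ?N. const (c \<gamma>) * (h n ^ m * mon \<gamma>))"
      unfolding c by (simp only: sum_distrib_left ac_simps)
    show "f \<in> ratfun.VS.span (monomial_sections m)"
      unfolding f by (intro ratfun.VS.span_sum ratfun.VS.span_scale ratfun.VS.span_base imageI)
  qed
  show "ratfun.VS.span (monomial_sections m) \<subseteq> sections m"
  proof
    fix f assume "f \<in> ratfun.VS.span (monomial_sections m)"
    then have "f / h n ^ m \<in> pdeg ?N"
    proof (induction rule: ratfun.VS.span_induct_alt)
      case base
      then show ?case
        by (simp add: pdeg_def ratfun.VS.span_zero)
    next
      case (step c x z)
      then obtain \<gamma> where "\<gamma> \<in> multi n ?N" "x = h n ^ m * mon \<gamma>"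
        by blast
      then have x: "x / h n ^ m \<in> pdeg ?N"
        using pdeg_mon nonzero_mult_div_cancel_left[OF h0] by simp
      have "(const c * x + z) / h n ^ m = const c * (x / h n ^ m) + z / h n ^ m"
        by (simp add: add_divide_distrib)
      also have "\<dots> \<in> pdeg ?N"
        using x step unfolding pdeg_def by (intro ratfun.VS.span_add ratfun.VS.span_scale)
      finally show ?case .
    qed
    then have "f / h n ^ m * h n ^ m \<in> sections m"
      by (intro mem_sections_of_pdeg) auto
    then show "f \<in> sections m"
      using h0 by (auto split: if_splits)
  qed
qed

lemma monomial_sections_basis:
  "basis_over const (sections m) (monomial_sections m)"
  "card (monomial_sections m) = card (multi n (m * (n + 1)))"
proof -
  interpret chart const n "affine_coord n n" "affine_deriv n n"
    by (rule chart_projective) simp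
  have "h n ^ m \<noteq> 0"
    using h_nonzero[of n] by simp
  from independent_scaled_mon[OF this, of "m * (n + 1)"] span_monomial_sections[of m]
  show "basis_over const (sections m) (monomial_sections m)"
    "card (monomial_sections m) = card (multi n (m * (n + 1)))"
    by (simp_all add: basis_over_def)
qed

lemma dim_sections: "ratfun.VS.dim (sections m) = card (multi n (m * (n + 1)))"
proof -
  have ind: "ratfun.VS.independent (monomial_sections m)"
    using monomial_sections_basis(1)[of m] by (simp add: basis_over_def)
  have "monomial_sections m \<subseteq> sections m" "sections m \<subseteq> ratfun.VS.span (monomial_sections m)"
    using ratfun.VS.span_superset[of "monomial_sections m"] unfolding span_monomial_sections by blast+
  from ratfun.VS.dim_unique[OF this ind monomial_sections_basis(2)] show ?thesis .
qed

lemma basis_facts: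
  assumes "basis_over const (sections m) B"
  shows "finite B" "card B = card (multi n (m * (n + 1)))" "B \<subseteq> sections m" "0 \<notin> B"
proof -
  have B: "ratfun.VS.independent B" "ratfun.VS.span B = sections m"
    using assms by (auto simp: basis_over_def)
  show sub: "B \<subseteq> sections m"
    using ratfun.VS.span_superset[of B] B(2) by simp
  have "finite (monomial_sections m)"
    using finite_multi by auto
  then show "finite B"
    using ratfun.VS.independent_span_bound[OF _ B(1), of "monomial_sections m"] sub span_monomial_sections by simp
  show "card B = card (multi n (m * (n + 1)))"
    using ratfun.VS.dim_unique[OF sub _ B(1) refl] B(2) dim_sections by simp
  show "0 \<notin> B"
    using B(1) ratfun.VS.dependent_zero by blast
qed

definition basis_divisor :: "nat \<Rightarrow> ratfun set \<Rightarrow> ratfun set \<Rightarrow> real" where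
  "basis_divisor m B E =
    (\<Sum>s\<in>B. of_int (zero_divisor (\<lambda>E. int m * - div_form const n (proj_space n) \<omega> E) s E)) /
    (of_nat m * of_nat (card (multi n (m * (n + 1)))))"

lemma basis_divisors_eq:
  "basis_divisors const (proj_space n) (\<lambda>E. - div_form const n (proj_space n) \<omega> E) m =
    {basis_divisor m B | B. basis_over const (sections m) B}"
  unfolding basis_divisors_def Let_def sections_def[symmetric] dim_sections basis_divisor_def ..

lemma card_multi_pos: "card (multi n N) > 0"
  using zero_multi[of n N] finite_multi[of n N] by (auto simp: card_gt_0_iff)

end

section \<open>The two bounds\<close>

locale divisor_over_form = top_form n \<omega> + divisor_over_chart n i S F t for n \<omega> i S F t
begin

lemma section_quotient:
  assumes B: "basis_over const (sections m) B" and s: "s \<in> B"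
  shows "s / h i ^ m \<in> F" "s / h i ^ m \<in> K" "s / h i ^ m \<noteq> 0"
proof -
  have "s \<in> sections m" "s \<noteq> 0"
    using basis_facts[OF B] s by auto
  then have *: "s / h i ^ m \<in> A" "s / h i ^ m \<noteq> 0"
    using mem_sections_iff i h_nonzero[OF i] by auto
  then show "s / h i ^ m \<in> K" "s / h i ^ m \<noteq> 0"
    using A_subset_K by blast+
  show "s / h i ^ m \<in> F"
    using *(1) ratfun.subset_spec[OF A S] dom by (auto simp: dominates_def)
qed

text \<open>The product of the quotients \<open>s / h i ^ m\<close> is an equation, on the whole
  chart, of the basis divisor multiplied by its denominator m d.\<close>

lemma ord_basis_divisor:
  assumes B: "basis_over const (sections m) B" and m: "m \<ge> 1"
  shows "ord_pullback (proj_space n) (basis_divisor m B) F =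
    of_int (\<Sum>s\<in>B. ord F (s / h i ^ m)) / of_nat (m * card (multi n (m * (n + 1))))"
proof -
  let ?d = "card (multi n (m * (n + 1)))"
  let ?g = "\<Prod>s\<in>B. s / h i ^ m"
  note q = section_quotient[OF B]
  have g: "?g \<in> K" "?g \<noteq> 0"
    using q basis_facts[OF B] by (auto intro!: ratfun.subalg_prod[OF K(2)])
  have "ord_pullback (proj_space n) (basis_divisor m B) F = of_int (ord F ?g) / of_nat (m * ?d)"
  proof (rule ord_pullback_eq[OF _ g])
    show "m * ?d > 0"
      using m card_multi_pos by simp
    fix E assume E: "E \<in> prime_divisors (proj_space n)" "E \<in> spec (affine n i)"
    obtain s where s: "dvr const E s" "fractions E = ratfun_field n"
      using prime_divisor_dvr[OF E(1)] .
    have "ord E ?g = (\<Sum>s\<in>B. ord E (s / h i ^ m))"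
      using q s(2) K_eq by (intro dvr.ord_prod[OF s(1)]) auto
    also have "\<dots> = (\<Sum>s\<in>B. zero_divisor (\<lambda>E. int m * - div_form const n (proj_space n) \<omega> E) s E)"
      using basis_facts[OF B] mem_sections_iff by (intro sum.cong refl zero_divisor_eq[OF E i, symmetric]) auto
    finally show "of_nat (m * ?d) * basis_divisor m B E = of_int (ord E ?g)"
      using m card_multi_pos[of "m * (n + 1)"] by (simp add: basis_divisor_def)
  qed
  also have "ord F ?g = (\<Sum>s\<in>B. ord F (s / h i ^ m))"
    using q fractions_R by (intro V.ord_prod) auto
  finally show ?thesis .
qed

text \<open>Divided by \<open>h i ^ m\<close>, the basis spans the monomials of degree at most m (n
  + 1) in whichever chart contains the centre, so the Wronskian bound applies there; the common
  factor n + 1 then cancels.\<close>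

lemma sum_ord_sections_le:
  assumes B: "basis_over const (sections m) B" and r: "canonical_generator const n F r"
  shows "(\<Sum>s\<in>B. ord F (s / h i ^ m)) \<le> int (m * card (multi n (m * (n + 1)))) * (1 - ord F (jacobian r))"
proof -
  let ?N = "m * (n + 1)"
  let ?q = "\<lambda>s. s / h i ^ m"
  note bf = basis_facts[OF B]
  have h0: "h i ^ m \<noteq> 0"
    using h_nonzero[OF i] by simp
  have inj: "inj_on ?q B"
    using h0 by (auto simp: inj_on_def)
  have card: "card (?q ` B) = card (multi n ?N)"
    using card_image[OF inj] bf by simp
  have "\<exists>c. mon \<gamma> = (\<Sum>s\<in>?q ` B. const (c s) * s)" if \<gamma>: "\<gamma> \<in> multi n ?N" for \<gamma>
  proof -
    have "mon \<gamma> * h i ^ m \<in> ratfun.VS.span B"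
      using mem_sections_of_pdeg[OF i pdeg_mon[OF \<gamma>]] B by (simp add: basis_over_def)
    then obtain c where c: "mon \<gamma> * h i ^ m = (\<Sum>s\<in>B. const (c s) * s)"
      using ratfun.VS.span_finite[OF bf(1)] by auto
    have "mon \<gamma> = (mon \<gamma> * h i ^ m) / h i ^ m"
      using h0 by simp
    also have "\<dots> = (\<Sum>s\<in>B. const (c (?q s * h i ^ m)) * ?q s)"
      unfolding c sum_divide_distrib using h0 by simp
    also have "\<dots> = (\<Sum>s\<in>?q ` B. const (c (s * h i ^ m)) * s)"
      by (subst sum.reindex[OF inj]) simp
    finally show ?thesis
      by (intro exI[of _ "\<lambda>s. c (s * h i ^ m)"])
  qed
  then have "int (n + 1) * (\<Sum>s\<in>?q ` B. ord F s) \<le> int (?N * card (?q ` B)) * (1 - ord F (jacobian r))"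
    using bf section_quotient[OF B] card by (intro sum_ord_basis_le[OF r]) auto
  then have "int (n + 1) * (\<Sum>s\<in>B. ord F (?q s)) \<le> int (n + 1) * (int (m * card (multi n ?N)) * (1 - ord F (jacobian r)))"
    unfolding card sum.reindex[OF inj] by (simp only: o_def of_nat_mult ac_simps)
  then show ?thesis
    by (rule mult_left_le_imp_le) simp
qed

lemma lct_term_ge_1:
  assumes B: "basis_over const (sections m) B" and m: "m \<ge> 1" and r: "canonical_generator const n F r"
  shows "1 \<le> ereal (log_discrepancy const n (proj_space n) F) / ereal (ord_pullback (proj_space n) (basis_divisor m B) F)"
proof -
  let ?c = "m * card (multi n (m * (n + 1)))"
  let ?s = "\<Sum>s\<in>B. ord F (s / h i ^ m)"
  define a where "a = log_discrepancy const n (proj_space n) F"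
  define o' where "o' = ord_pullback (proj_space n) (basis_divisor m B) F"
  have c: "?c > 0"
    using m card_multi_pos by simp
  have a: "a = of_int (1 - ord F (jacobian r))"
    unfolding a_def by (rule log_discrepancy_eq[OF r])
  have o': "o' = of_int ?s / of_nat ?c"
    unfolding o'_def by (rule ord_basis_divisor[OF B m])
  have "a \<ge> 1"
    using ord_jacobian_nonpos[OF r] by (simp add: a)
  have "?s \<ge> 0"
    using section_quotient[OF B] V.mem_iff_ord fractions_R by (intro sum_nonneg) auto
  then have "o' \<ge> 0"
    unfolding o' by (intro divide_nonneg_nonneg) (simp_all only: of_int_0_le_iff of_nat_0_le_iff)
  have "real_of_int ?s \<le> of_int (int ?c * (1 - ord F (jacobian r)))"
    using sum_ord_sections_le[OF B r] by (simp only: of_int_le_iff)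
  then have "real_of_int ?s \<le> of_nat ?c * a"
    by (simp add: a)
  then have "o' \<le> a"
    unfolding o' using c by (simp add: divide_le_eq mult.commute)
  show ?thesis
    unfolding a_def[symmetric] o'_def[symmetric]
  \<comment> \<open>For order 0 the quotient of the positive log discrepancy is infinite, which
    needs a case of its own.\<close>
  proof (cases "o' = 0")
    case True
    then show "1 \<le> ereal a / ereal o'"
      using \<open>a \<ge> 1\<close> by simp
  next
    case False
    then show "1 \<le> ereal a / ereal o'"
      using \<open>o' \<ge> 0\<close> \<open>o' \<le> a\<close> by simp
  qed
qed

end

context top_form
begin

lemma lct_basis_divisor_ge_1:
  assumes B: "basis_over const (sections m) B" and m: "m \<ge> 1"
  shows "1 \<le> lct const n (proj_space n) (basis_divisor m B)"
  unfolding lct_def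
proof (rule INF_greatest)
  fix F assume "F \<in> divisors_over const (proj_space n)"
  then obtain Y where Y: "variety const Y" "proper_birational_morphism const Y (proj_space n)" "F \<in> prime_divisors Y"
    by (auto simp: divisors_over_def)
  have FY: "F \<in> Y" and "\<exists>t. uniformizer F t"
    using Y(3) by (auto simp: prime_divisors_def)
  then obtain t where t: "uniformizer F t"
    by blast
  obtain \<A> where \<A>: "Y = (\<Union>A\<in>\<A>. spec A)"
    "\<forall>A\<in>\<A>. (\<exists>S. finite S \<and> A = adjoin const S) \<and> fractions A = function_field Y"
    using Y(1) by (auto simp: variety_def)
  obtain A where A: "A \<in> \<A>" "F \<in> spec A"
    using \<A>(1) FY by auto
  from bspec[OF \<A>(2) A(1)] obtain G where "finite G" "A = adjoin const G" "fractions A = function_field Y"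
    by (elim conjE exE)
  then have G: "finite G" "F \<in> spec (adjoin const G)" "fractions (adjoin const G) = function_field Y"
    using A(2) by simp_all
  then obtain P where P: "prime_ideal (adjoin const G) P" "F = localization (adjoin const G) P"
    by (auto simp: spec_def)
  note G' = ratfun.subalgebra_adjoin[of G]
  have "fractions F = function_field (proj_space n)"
    using ratfun.fractions_spec[OF G' G(2)] G(3) Y(2) by (simp add: proper_birational_morphism_def)
  then have frac: "fractions F = ratfun_field n"
    by (simp add: function_field_proj_space)
  obtain S where S: "S \<in> proj_space n" "dominates F S"
    using Y(2) FY by (auto simp: proper_birational_morphism_def)
  obtain i where i: "i \<le> n" "S \<in> spec (affine n i)"
    using S(1) by (rule proj_space_cases)
  interpret divisor_over_form n \<omega> i S F t
    using i S t frac ratfun.subalgebra_spec[OF G' G(2)] by unfold_locales auto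
  \<comment> \<open>Here the finite type of the model \<open>Y\<close> enters: \<open>F\<close> is a
    localization of a finitely generated algebra.\<close>
  obtain r where "canonical_generator const n F r"
    using canonical_generator_exists[OF G(1) P] by blast
  then show "1 \<le> ereal (log_discrepancy const n (proj_space n) F) / ereal (ord_pullback (proj_space n) (basis_divisor m B) F)"
    by (rule lct_term_ge_1[OF B m])
qed

text \<open>A prime factor \<open>p\<close> of the last affine coordinate takes the place of the
  hyperplane, which saves proving that the coordinate itself is prime: lower bounds for orders along
  \<open>p\<close> already bound the threshold from above.\<close>

lemma lct_monomial_divisor_le_1:
  assumes m: "m \<ge> 1"
  shows "lct const n (proj_space n) (basis_divisor m (monomial_sections m)) \<le> 1"
proof -
  interpret C: chart const n "affine_coord n n" "affine_deriv n n"
    by (rule chart_projective) simp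
  let ?A = "affine n n" and ?y = "affine_coord n n" and ?N = "m * (n + 1)"
  \<comment> \<open>The index for which \<open>y_not_unit\<close> is available.\<close>
  define l where "l = n - 1"
  have l: "l < n"
    using n by (simp add: l_def)
  obtain u ps where ps: "factorization ?A (?y l) u ps"
    using C.factorial_A C.y_mem_A[OF l] C.y_nonzero[OF l] by (auto simp: factorial_in_def)
  have "ps \<noteq> []"
  proof
    assume "ps = []"
    then have "divides_in ?A (?y l) 1"
      using ps by (simp add: factorization_def)
    then obtain c where c: "c \<in> ?A" "?y l * c = 1"
      unfolding divides_in_def by metis
    then have "inverse (?y l) \<in> ?A"
      using inverse_unique[OF c(2)] by simp
    then show False
      using C.y_not_unit n by (simp add: l_def)
  qed
  then obtain p qs where pqs: "ps = p # qs"
    by (cases ps) auto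
  have p: "prime_in ?A p" "divides_in ?A p (?y l)"
  proof -
    show "prime_in ?A p"
      using ps pqs by (simp add: factorization_def)
    have "u * prod_list qs \<in> ?A"
      using ps pqs factorization_mem[OF ratfun.is_subring_subalgebra[OF C.A], of qs]
      by (auto simp: factorization_def intro: ratfun.subalg_mult[OF C.A])
    moreover have "?y l = p * (u * prod_list qs)"
      using ps pqs by (simp add: factorization_def mult.left_commute)
    ultimately show "divides_in ?A p (?y l)"
      by (auto simp: divides_in_def)
  qed
  let ?P = "principal ?A p"
  define E where "E = localization ?A ?P"
  note P = ratfun.prime_ideal_principal[OF C.A p(1)]
  have spec: "E \<in> spec ?A"
    using P by (auto simp: E_def spec_def)
  have E: "E \<in> proj_space n"
    using spec spec_affine_subset_proj_space[of n n] by auto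
  have t: "uniformizer E p"
    unfolding E_def by (rule ratfun.uniformizer_principal[OF C.A p(1) C.factorial_A])
  have PD: "E \<in> prime_divisors (proj_space n)"
    using E t by (auto simp: prime_divisors_def)
  interpret divisor_over_form n \<omega> n E E p
    using E t spec dominates_refl subalgebra_proj_point[OF E] fractions_proj_point[OF E] by unfold_locales auto
  have "canonical_generator const n E ?y"
    by (rule div_form_prime_divisor(2)[OF PD spec order_refl \<omega>])
  from log_discrepancy_eq[OF this] have A: "log_discrepancy const n (proj_space n) E = 1"
    by (simp add: C.wedge_coordinate)
  have yE: "?y j \<in> fractions E" "?y j \<noteq> 0" if "j < n" for j
    using C.y_mem_K[OF that] C.y_nonzero[OF that] fractions_R by auto
  have ord_y: "ord E (?y j) \<ge> (if j = l then 1 else 0)" if "j < n" for j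
  proof -
    have "ord E (?y j) \<ge> 0"
      using V.mem_iff_ord[OF yE[OF that]] y_mem_R[OF that] by simp
    moreover have "ord E (?y l) \<noteq> 0"
    proof -
      have "?y l \<in> nonunits E"
        unfolding E_def ratfun.nonunit_localization_iff'[OF C.A P C.y_mem_A[OF l]]
        using p C.y_mem_A[OF l] by (simp add: principal_def)
      then show ?thesis
        using V.U_iff_ord[OF yE[OF l]] by (simp add: V.U_def)
    qed
    ultimately show ?thesis
      by auto
  qed
  have ord_mon: "ord E (C.mon \<gamma>) \<ge> int (\<gamma> l)" for \<gamma>
  proof -
    have "ord E (C.mon \<gamma>) = (\<Sum>j<n. ord E (?y j ^ \<gamma> j))"
      unfolding C.mon_def using yE ratfun.subalg_power[OF V.K(2)] by (intro V.ord_prod) auto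
    also have "\<dots> = (\<Sum>j<n. int (\<gamma> j) * ord E (?y j))"
      using yE by (intro sum.cong) (auto simp: V.ord_power)
    also have "\<dots> \<ge> (\<Sum>j<n. int (\<gamma> j) * (if j = l then 1 else 0))"
      using ord_y by (intro sum_mono mult_left_mono) auto
    also have "(\<Sum>j<n. int (\<gamma> j) * (if j = l then 1 else 0)) = int (\<gamma> l)"
      using l by (simp add: if_distrib[of "(*) _"] cong: if_cong)
    finally show ?thesis .
  qed
  note B = monomial_sections_basis(1)[of m]
  let ?c = "m * card (multi n ?N)"
  have c: "?c > 0"
    using m card_multi_pos by simp
  have h0: "h n ^ m \<noteq> 0"
    using h_nonzero[of n] by simp
  have inj: "inj_on (\<lambda>\<gamma>. h n ^ m * C.mon \<gamma>) (multi n ?N)"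
    using C.mon_inj[of ?N] h0 by (auto simp: inj_on_def)
  \<comment> \<open>By the symmetry of the multi-indices, the exponents of one coordinate add up to
    m d, exactly the denominator of the basis divisor; so its order along \<open>E\<close> is at
    least 1.\<close>
  have "(n + 1) * (\<Sum>\<gamma>\<in>multi n ?N. \<gamma> l) = (n + 1) * ?c"
    using sum_multi[OF l, of ?N] by (simp only: ac_simps)
  then have "(\<Sum>\<gamma>\<in>multi n ?N. \<gamma> l) = ?c"
    unfolding mult_cancel1 by simp
  then have "int ?c = (\<Sum>\<gamma>\<in>multi n ?N. int (\<gamma> l))"
    by (simp flip: of_nat_sum)
  also have "\<dots> \<le> (\<Sum>\<gamma>\<in>multi n ?N. ord E (C.mon \<gamma>))"
    by (intro sum_mono ord_mon)
  also have "\<dots> = (\<Sum>s\<in>monomial_sections m. ord E (s / h n ^ m))"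
    using h0 by (subst sum.reindex[OF inj]) simp
  finally have "real_of_int (int ?c) \<le> of_int (\<Sum>s\<in>monomial_sections m. ord E (s / h n ^ m))"
    by (simp only: of_int_le_iff)
  then have "real ?c \<le> of_int (\<Sum>s\<in>monomial_sections m. ord E (s / h n ^ m))"
    by (simp only: of_int_of_nat_eq)
  then have "ord_pullback (proj_space n) (basis_divisor m (monomial_sections m)) E \<ge> 1"
    unfolding ord_basis_divisor[OF B m] using c by (simp add: le_divide_eq)
  then have "ereal (log_discrepancy const n (proj_space n) E) /
      ereal (ord_pullback (proj_space n) (basis_divisor m (monomial_sections m)) E) \<le> 1"
    by (simp add: A)
  moreover have "E \<in> divisors_over const (proj_space n)"
    using PD prime_divisors_subset_divisors_over by blast
  ultimately show ?thesis
    unfolding lct_def by (rule INF_lower2[rotated])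
qed

end

theorem corollary7p2:
  fixes n m :: nat and KX :: "ratfun set \<Rightarrow> int"
  assumes "n \<ge> 1" and "m \<ge> 1"
    and "canonical_divisor const n (proj_space n) KX"
  shows "delta const n (proj_space n) (\<lambda>E. - KX E) m = 1"
proof -
  obtain \<omega> where \<omega>: "nonzero_top_form const n (ratfun_field n) \<omega>"
    and KX: "KX = div_form const n (proj_space n) \<omega>"
    using assms(3) by (auto simp: canonical_divisor_def function_field_proj_space)
  interpret top_form n \<omega>
    by unfold_locales (use assms \<omega> in auto)
  have "delta const n (proj_space n) (\<lambda>E. - KX E) m =
      (INF D\<in>{basis_divisor m B | B. basis_over const (sections m) B}. lct const n (proj_space n) D)"
    by (simp add: delta_def KX basis_divisors_eq)
  also have "\<dots> = 1"
  proof (rule antisym)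
    show "1 \<le> (INF D\<in>{basis_divisor m B | B. basis_over const (sections m) B}. lct const n (proj_space n) D)"
      using lct_basis_divisor_ge_1 assms(2) by (intro INF_greatest) auto
    show "(INF D\<in>{basis_divisor m B | B. basis_over const (sections m) B}. lct const n (proj_space n) D) \<le> 1"
      using monomial_sections_basis(1) lct_monomial_divisor_le_1[OF assms(2)] by (intro INF_lower2) auto
  qed
  finally show ?thesis .
qed

end
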